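(* Let $P(X)=(X-\alpha)^n+a(X-\alpha)^m+b$ be a polynomial of degree $n$, where $\alpha,a,b\in\mathbf{C}$ and $1\le m\le n-1$. Then: (i) $P(X)$ is a uniqueness polynomial for rational functions if and only if $n\geq 4$, $n-m\geq 2$, $\gcd(n,m)=1$ and $a\ne 0$; (ii) $P(X)$ is a strong uniqueness polynomial for rational functions if and only if $n\geq 4$, $n-m\geq 2$, $\gcd(n,m)=1$, $a\ne 0$ and $b\ne 0$; (iii) $P(X)$ is a uniqueness polynomial for meromorphic functions if and only if $n\geq 5$, $n-m\geq 2$, $\gcd(n,m)=1$ and $a\ne 0$; (iv) $P(X)$ is a strong uniqueness polynomial for meromorphic functions if and only if $n\geq 5$, $n-m\geq 2$, $\gcd(n,m)=1$, $a\ne 0$ and $b\ne 0$.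
   Context: Meromorphic functions are meromorphic functions on $\mathbf{C}$; rational functions are rational functions over $\mathbf{C}$ in one variable. A polynomial $P$ over $\mathbf{C}$ is a uniqueness polynomial for meromorphic (respectively, rational) functions if $P(f)=P(g)$ for non-constant meromorphic (respectively, rational) functions $f,g$ implies $f\equiv g$. It is a strong uniqueness polynomial for meromorphic (respectively, rational) functions if, whenever $f,g$ are non-constant meromorphic (respectively, rational) functions and $c$ is a non-zero complex constant with $P(f)=cP(g)$, one has $c=1$ and $f\equiv g$. *)

theory Defs
  imports "HOL-Complex_Analysis.Complex_Analysis" "HOL-Computational_Algebra.Polynomial_Factorial"
begin

text \<open>
  Rational functions are elements of the field of fractions of the polynomial ring
  over the complex numbers.
\<close>

definition rat_const :: "complex \<Rightarrow> complex poly fract" where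
  "rat_const c = to_fract [:c:]"

definition rat_eval :: "complex poly \<Rightarrow> complex poly fract \<Rightarrow> complex poly fract" where
  "rat_eval P f = poly (map_poly rat_const P) f"

definition nonconstant_rational :: "complex poly fract \<Rightarrow> bool" where
  "nonconstant_rational f \<longleftrightarrow> f \<notin> range rat_const"

definition uniqueness_poly_rational :: "complex poly \<Rightarrow> bool" where
  "uniqueness_poly_rational P \<longleftrightarrow>
     (\<forall>f g. nonconstant_rational f \<longrightarrow> nonconstant_rational g \<longrightarrow>
        rat_eval P f = rat_eval P g \<longrightarrow> f = g)"

definition strong_uniqueness_poly_rational :: "complex poly \<Rightarrow> bool" where
  "strong_uniqueness_poly_rational P \<longleftrightarrow>
     (\<forall>f g c. nonconstant_rational f \<longrightarrow> nonconstant_rational g \<longrightarrow> c \<noteq> 0 \<longrightarrow>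
        rat_eval P f = rat_const c * rat_eval P g \<longrightarrow> c = 1 \<and> f = g)"

text \<open>
  The predicate \<open>f meromorphic_on UNIV\<close> does not constrain the value of \<open>f\<close> at a pole, or at
  the points of any other sparse (closed and discrete) set. Two such functions therefore represent
  the same meromorphic function iff they agree outside a sparse set, and all identities between
  meromorphic functions below (including being a constant) are understood in this sense.
\<close>

definition nonconstant_meromorphic :: "(complex \<Rightarrow> complex) \<Rightarrow> bool" where
  "nonconstant_meromorphic f \<longleftrightarrow> f meromorphic_on UNIV \<and> \<not> (\<exists>k. \<forall>\<^sub>\<approx>z. f z = k)"

definition uniqueness_poly_meromorphic :: "complex poly \<Rightarrow> bool" where
  "uniqueness_poly_meromorphic P \<longleftrightarrow>
     (\<forall>f g. nonconstant_meromorphic f \<longrightarrow> nonconstant_meromorphic g \<longrightarrow>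
        (\<forall>\<^sub>\<approx>z. poly P (f z) = poly P (g z)) \<longrightarrow> (\<forall>\<^sub>\<approx>z. f z = g z))"

definition strong_uniqueness_poly_meromorphic :: "complex poly \<Rightarrow> bool" where
  "strong_uniqueness_poly_meromorphic P \<longleftrightarrow>
     (\<forall>f g c. nonconstant_meromorphic f \<longrightarrow> nonconstant_meromorphic g \<longrightarrow> c \<noteq> 0 \<longrightarrow>
        (\<forall>\<^sub>\<approx>z. poly P (f z) = c * poly P (g z)) \<longrightarrow> c = 1 \<and> (\<forall>\<^sub>\<approx>z. f z = g z))"

end

theory Submission
  imports Defs "HOL-Computational_Algebra.Fundamental_Theorem_Algebra"
begin

text \<open>
  Write \<open>P\<close> centred, \<open>P = X\<^sup>n + a X\<^sup>m + b\<close> with \<open>k = n - m\<close>. A solution of \<open>P(f) = c P(g)\<close> is a map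
  into a plane curve. Pulling back a holomorphic differential \<open>Q(x, y) dx / P'(y)\<close> of that curve
  gives \<open>E = Q(f, g) f' / P'(g)\<close>, and near every point of the compactified curve \<open>E\<close> is bounded by
  the derivative of a bounded holomorphic function (a local parameter), whence \<open>|E| \<le> C / r\<close> at
  the centre of a disc of radius \<open>r\<close> which is mapped near that point. In particular \<open>E\<close> is entire. If
  \<open>f\<close> and \<open>g\<close> are rational, the same bound at infinity and Liouville's theorem give \<open>E = 0\<close>. If they
  are meromorphic and both \<open>E\<close> and \<open>f E\<close> come from holomorphic differentials, then around a point
  almost maximising \<open>(r - |z|) (|E| + |f E|)\<close> both functions are nearly constant on discs
  that are large compared with \<open>1 / (|E| + |f E|)\<close>; so is their ratio \<open>f\<close>, and the local bound is
  violated unless \<open>E = 0\<close>.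

  It remains to find \<open>Q\<close>. For \<open>c = 1\<close> and \<open>k \<ge> 3\<close> take \<open>(x - y) y\<^sup>m\<^sup>-\<^sup>2\<close>; for \<open>k = 2\<close> the quotient
  \<open>h = f / g\<close> parametrises the hyperelliptic curve \<open>y\<^sup>2 = -a A(h) B(h)\<close> with
  \<open>(X - 1) A = X\<^sup>m - 1\<close> and \<open>(X - 1) B = X\<^sup>n - 1\<close>. For \<open>c \<noteq> 1\<close> the curve has at most two nodes, because
  critical values with nonzero critical point lie on a circle, and \<open>Q\<close> is a line through the nodes,
  times a linear factor for each singular point on a coordinate axis (for \<open>n = 5\<close> a line suffices).
  The exceptional case \<open>n = 4\<close>, \<open>m = 1\<close> is an elliptic curve, parametrised by meromorphic functions
  but not by rational ones.
\<close>

subsection \<open>Meromorphic functions up to sparse sets\<close>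

text \<open>The proof rests on a count of degrees. On a curve \<open>P1(x) = P2(y)\<close> of degree
  n, a polynomial Q gives a form without poles at infinity if deg Q is at most n - 3. One form
  suffices for rational functions. Since curves of genus one admit nonconstant meromorphic maps,
  meromorphic functions call for two forms; the pair Q, x * Q is convenient because its ratio is f,
  and it costs one degree. A line through two nodes has degree 1, whence the bounds n \<ge> 4 and n
  \<ge> 5. A line with two more linear factors has degree 3 and needs n \<ge> 7; for n = 6
  coprimality and the gap leave only m = 1, where no singular point has a zero coordinate. For c = 1
  the form named above has degree m - 1 if m \<ge> 2, which is at most n - 4 only when k \<ge> 3;
  this is why k = 2 is treated on a different curve. Branches of singular points are never
  parametrised: f and g are already functions of one variable, and Cauchy's estimate is applied to
  f, g, 1/f or, at a cusp, to a quotient of differences.\<close>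

lemma meromorphic_locally_bounded_removable:
  assumes f: "f meromorphic_on A" and A: "open A"
    and bd: "\<And>z. z \<in> A \<Longrightarrow> \<exists>B. \<forall>\<^sub>F w in at z. norm (f w) \<le> B"
  shows "remove_sings f holomorphic_on A"
proof -
  have "remove_sings f analytic_on {z}" if z: "z \<in> A" for z
  proof -
    have iso: "isolated_singularity_at f z" and ne: "not_essential f z"
      using f z by (auto simp: meromorphic_on_altdef)
    obtain B where B: "\<forall>\<^sub>F w in at z. norm (f w) \<le> B" using bd z by blast
    have "\<not> is_pole f z"
    proof
      assume "is_pole f z"
      then have "\<forall>\<^sub>F w in at z. norm (f w) \<ge> \<bar>B\<bar> + 1"
        unfolding is_pole_def filterlim_at_infinity[OF order_refl] by simp
      with B have "\<forall>\<^sub>F w in at z. False" by eventually_elim auto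
      then show False by simp
    qed
    with ne obtain c where "f \<midarrow>z\<rightarrow> c" by (auto simp: not_essential_def)
    with iso show ?thesis by (rule remove_sings_analytic_at)
  qed
  then have "remove_sings f analytic_on A" by (subst analytic_on_analytic_at) blast
  then show ?thesis using A by (simp add: analytic_imp_holomorphic)
qed

lemma cosparse_ball_mono:
  assumes "\<forall>\<^sub>\<approx>z\<in>A. P z" "B \<subseteq> A"
  shows "\<forall>\<^sub>\<approx>z\<in>B. P z"
  using assms unfolding eventually_cosparse by (rule sparse_in_subset)

lemma continuous_cosparse_closed:
  fixes f :: "complex \<Rightarrow> 'a :: t2_space"
  assumes "open A" "continuous_on A f" "\<forall>\<^sub>\<approx>z\<in>A. f z \<in> S" "closed S" "z \<in> A"
  shows "f z \<in> S"
proof -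
  have "\<forall>\<^sub>F w in at z. f w \<in> S"
    using assms(1,3,5) by (simp add: eventually_cosparse_open_eq)
  moreover have "f \<midarrow>z\<rightarrow> f z"
    using assms(1,2,5) by (simp add: continuous_on_eq_continuous_at isContD)
  ultimately show ?thesis
    using Lim_in_closed_set[OF assms(4)] by (metis trivial_limit_at)
qed

lemma continuous_cosparse_eq:
  fixes f g :: "complex \<Rightarrow> complex"
  assumes "open A" "continuous_on A f" "continuous_on A g" "\<forall>\<^sub>\<approx>z\<in>A. f z = g z" "z \<in> A"
  shows "f z = g z"
  using continuous_cosparse_closed[of A "\<lambda>z. f z - g z" "{0}" z] assms
  by (auto intro: continuous_intros)

lemma deriv_bound_ball:
  assumes "f holomorphic_on ball z r" "r > 0" "\<And>w. w \<in> ball z r \<Longrightarrow> norm (f w) \<le> B"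
  shows "norm (deriv f z) \<le> 2 * B / r"
proof -
  have "norm ((deriv ^^ 1) f z) \<le> fact 1 * B / (r/2)^1"
  proof (rule Cauchy_inequality)
    show "f holomorphic_on ball z (r/2)"
      by (rule holomorphic_on_subset[OF assms(1)]) (use assms(2) in auto)
    show "continuous_on (cball z (r/2)) f"
      by (rule continuous_on_subset[OF holomorphic_on_imp_continuous_on[OF assms(1)]]) (use assms(2) in auto)
    show "norm (f x) \<le> B" if "norm (z - x) = r/2" for x
      by (rule assms(3)) (use that assms(2) in \<open>auto simp: dist_norm\<close>)
  qed (use assms(2) in auto)
  then show ?thesis by (simp add: mult_ac)
qed

lemma meromorphic_on_poly [meromorphic_intros]:
  "f meromorphic_on A \<Longrightarrow> (\<lambda>z. poly p (f z)) meromorphic_on A"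
  by (induction p) (auto intro!: meromorphic_intros)

text \<open>On a connected open set a meromorphic function is zero off a sparse set or nonzero off
  one, so there are no zero divisors. This lets factors of \<open>Q (f z) (g z)\<close> be discarded
  one at a time.\<close>

lemma meromorphic_mult_eq_0_cosparse:
  assumes "f meromorphic_on A" "g meromorphic_on A" "open A" "connected A"
    and "\<forall>\<^sub>\<approx>z\<in>A. f z * g z = 0"
  shows "(\<forall>\<^sub>\<approx>z\<in>A. f z = 0) \<or> (\<forall>\<^sub>\<approx>z\<in>A. g z = 0)"
proof -
  consider "\<forall>\<^sub>\<approx>z\<in>A. f z = 0" | "\<forall>\<^sub>\<approx>z\<in>A. f z \<noteq> 0"
    using meromorphic_imp_constant_or_avoid[OF assms(1,3,4)] by blast
  then show ?thesis
  proof cases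
    case 2
    with assms(5) have "\<forall>\<^sub>\<approx>z\<in>A. g z = 0" by eventually_elim auto
    then show ?thesis by blast
  qed blast
qed

lemma meromorphic_poly_eq_0_imp_const:
  assumes f: "f meromorphic_on UNIV" and "p \<noteq> 0" and "\<forall>\<^sub>\<approx>z. poly p (f z) = 0"
  shows "\<exists>k. \<forall>\<^sub>\<approx>z. f z = k"
  using assms(2,3)
proof (induction "degree p" arbitrary: p)
  case 0
  then obtain c where "p = [:c:]" "c \<noteq> 0" by (metis degree_eq_zeroE pCons_0_0)
  with 0 have "\<forall>\<^sub>\<approx>z::complex. False" by simp
  then show ?case by simp
next
  case (Suc d)
  obtain r where "poly p r = 0"
    using alg_closed_imp_poly_has_root[of p] Suc(2) by auto
  then obtain q where q: "p = [:-r, 1:] * q" by (metis poly_eq_0_iff_dvd dvdE)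
  have "\<forall>\<^sub>\<approx>z. (f z - r) * poly q (f z) = 0"
    using Suc(4) by (simp add: q algebra_simps)
  then have "(\<forall>\<^sub>\<approx>z. f z - r = 0) \<or> (\<forall>\<^sub>\<approx>z. poly q (f z) = 0)"
    by (rule meromorphic_mult_eq_0_cosparse[rotated 4]) (auto intro!: meromorphic_intros f)
  then consider "\<forall>\<^sub>\<approx>z. f z - r = 0" | "\<forall>\<^sub>\<approx>z. poly q (f z) = 0" by blast
  then show ?case
  proof cases
    case 1
    then show ?thesis by auto
  next
    case 2
    have "q \<noteq> 0" using q Suc(3) by auto
    then have "degree p = degree [:-r, 1:] + degree q" unfolding q by (intro degree_mult_eq) auto
    then have "d = degree q" using Suc(2) by simp
    then show ?thesis using Suc(1)[of q] 2 \<open>q \<noteq> 0\<close> by blast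
  qed
qed

text \<open>The points where \<open>f\<close> is not analytic form a sparse set, whose complement in
  the plane stays connected; hence one constant serves everywhere.\<close>

lemma meromorphic_deriv_eq_0_imp_const:
  assumes f: "f meromorphic_on UNIV" and 0: "\<forall>\<^sub>\<approx>z. deriv f z = 0"
  shows "\<exists>k. \<forall>\<^sub>\<approx>z. f z = k"
proof -
  have an: "\<forall>\<^sub>\<approx>z. f analytic_on {z}" using f by (rule meromorphic_on_imp_analytic_cosparse)
  define S where "S = {z. \<not> f analytic_on {z}}"
  have sp: "S sparse_in UNIV" using an by (simp add: eventually_cosparse S_def)
  have con: "connected (UNIV - S)" by (rule sparse_imp_connected[OF _ _ _ sp]) auto
  have op: "open (UNIV - S)" using sparse_in_UNIV_imp_closed[OF sp] by blast
  have "f analytic_on (UNIV - S)" by (subst analytic_on_analytic_at) (auto simp: S_def)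
  then have hol: "f holomorphic_on (UNIV - S)" by (rule analytic_imp_holomorphic)
  have d0: "deriv f z = 0" if "z \<in> UNIV - S" for z
    by (rule continuous_cosparse_eq[OF op holomorphic_on_imp_continuous_on[OF holomorphic_deriv[OF hol op]]
          continuous_on_const cosparse_ball_mono[OF 0] that]) auto
  have "f constant_on (UNIV - S)"
    by (rule has_field_derivative_0_imp_constant_on[OF _ con op])
       (use holomorphic_derivI[OF hol op] d0 in fastforce)
  then obtain k where "f z = k" if "z \<in> UNIV - S" for z by (auto simp: constant_on_def)
  then have "\<forall>\<^sub>\<approx>z. f z = k" using an by (auto simp: S_def elim!: eventually_mono)
  then show ?thesis by blast
qed

subsection \<open>Differential forms on the curve P1(x) = P2(y)\<close>

text \<open>If \<open>y\<close> keeps distance \<open>e\<close> from every root, each factor of the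
  split polynomial has modulus at least \<open>e\<close>; this gives the witness for
  \<open>\<delta>\<close>. The lemma confines \<open>g\<close> to a neighbourhood of a finite fibre
  when \<open>f\<close> is near \<open>x0\<close>.\<close>

lemma poly_small_imp_near_root:
  fixes p :: "complex poly"
  assumes "p \<noteq> 0" "e > 0"
  obtains \<delta> where "\<delta> > 0" "\<And>y. norm (poly p y) < \<delta> \<Longrightarrow> \<exists>r. poly p r = 0 \<and> norm (y - r) < e"
proof -
  obtain root where root: "smult (lead_coeff p) (\<Prod>i<degree p. [:-root i, 1:]) = p"
    by (rule complex_poly_decompose')
  have pol: "poly p y = lead_coeff p * (\<Prod>i<degree p. (y - root i))" for y
    by (subst root[symmetric]) (simp add: poly_prod)
  show ?thesis
  proof
    show "norm (lead_coeff p) * e ^ degree p > 0" using assms by simp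
    fix y assume y: "norm (poly p y) < norm (lead_coeff p) * e ^ degree p"
    have "\<exists>i<degree p. norm (y - root i) < e"
    proof (rule ccontr)
      assume "\<not> ?thesis"
      then have "(\<Prod>i<degree p. e) \<le> (\<Prod>i<degree p. norm (y - root i))"
        using assms(2) by (intro prod_mono) (meson atLeastLessThan_iff less_imp_le lessThan_iff not_less)
      then have "norm (lead_coeff p) * e ^ degree p \<le> norm (poly p y)"
        by (simp add: pol norm_mult prod_norm mult_left_mono)
      with y show False by simp
    qed
    then obtain i where i: "i < degree p" "norm (y - root i) < e" by blast
    moreover have "poly p (root i) = 0" using i by (auto simp: pol)
    ultimately show "\<exists>r. poly p r = 0 \<and> norm (y - r) < e" by blast
  qed
qed

definition curve_form :: "complex poly \<Rightarrow> (complex \<Rightarrow> complex \<Rightarrow> complex) \<Rightarrow> (complex \<Rightarrow> complex) \<Rightarrow> (complex \<Rightarrow> complex) \<Rightarrow> complex \<Rightarrow> complex" where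
  "curve_form P2 Q f g w = Q (f w) (g w) * deriv f w / poly (pderiv P2) (g w)"

text \<open>
  An analytic substitute for holomorphy of the form \<open>Q dx / P2'(y)\<close> at all points of the
  normalised curve above \<open>(x0, y0)\<close>. At infinity, where \<open>dx = - dw / w\<^sup>2\<close> with \<open>w = 1 / x\<close>, it becomes
  the growth condition in \<open>regular_form\<close>.
\<close>

definition regular_at :: "complex poly \<Rightarrow> complex poly \<Rightarrow> (complex \<Rightarrow> complex \<Rightarrow> complex) \<Rightarrow> complex \<Rightarrow> complex \<Rightarrow> bool" where
  "regular_at P1 P2 Q x0 y0 \<longleftrightarrow> (\<exists>\<epsilon>>0. \<exists>C. \<forall>z \<rho> f g. 0 < \<rho> \<longrightarrow>
     f holomorphic_on ball z \<rho> \<longrightarrow> g holomorphic_on ball z \<rho> \<longrightarrow>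
     (\<forall>w\<in>ball z \<rho>. f w \<in> ball x0 \<epsilon> \<and> g w \<in> ball y0 \<epsilon> \<and> poly P1 (f w) = poly P2 (g w)) \<longrightarrow>
     poly (pderiv P1) (f z) \<noteq> 0 \<longrightarrow> poly (pderiv P2) (g z) \<noteq> 0 \<longrightarrow>
     \<rho> * norm (Q (f z) (g z) * deriv f z) \<le> C * norm (poly (pderiv P2) (g z)))"

text \<open>\<open>Q\<close> is any function of two variables, so the last clause records that its
  composites with meromorphic functions are meromorphic. The growth clause speaks of large
  \<open>x\<close> alone: where \<open>x\<close> is bounded, so is \<open>P2(y)\<close>, and then
  \<open>y\<close>, because \<open>degree P2 > 0\<close>.\<close>

definition regular_form :: "complex poly \<Rightarrow> complex poly \<Rightarrow> (complex \<Rightarrow> complex \<Rightarrow> complex) \<Rightarrow> bool" where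
  "regular_form P1 P2 Q \<longleftrightarrow> degree P2 > 0 \<and>
     (\<forall>x0 y0. poly P1 x0 = poly P2 y0 \<longrightarrow> regular_at P1 P2 Q x0 y0) \<and>
     (\<exists>M C. \<forall>x y. poly P1 x = poly P2 y \<longrightarrow> norm x \<ge> M \<longrightarrow>
        norm x ^ 2 * norm (Q x y) \<le> C * norm (poly (pderiv P2) y)) \<and>
     (\<forall>f g A. f meromorphic_on A \<longrightarrow> g meromorphic_on A \<longrightarrow> (\<lambda>z. Q (f z) (g z)) meromorphic_on A)"

text \<open>Off a sparse set the image avoids points with a critical coordinate, so that
  \<open>curve_form\<close> divides by a nonzero number there and the local bounds apply.\<close>

definition curve_map :: "complex poly \<Rightarrow> complex poly \<Rightarrow> (complex \<Rightarrow> complex) \<Rightarrow> (complex \<Rightarrow> complex) \<Rightarrow> complex set \<Rightarrow> bool" where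
  "curve_map P1 P2 f g A \<longleftrightarrow> f meromorphic_on A \<and> g meromorphic_on A \<and>
     (\<forall>\<^sub>\<approx>w\<in>A. poly P1 (f w) = poly P2 (g w) \<and> poly (pderiv P1) (f w) \<noteq> 0 \<and> poly (pderiv P2) (g w) \<noteq> 0)"

text \<open>One \<open>C\<close> serves all discs and all maps; rescaling depends on this
  uniformity. The bound is claimed on the half disc, each point of which still has a disc of radius
  \<open>\<rho>/2\<close> inside the given one.\<close>

definition form_bounded_on :: "complex poly \<Rightarrow> complex poly \<Rightarrow> (complex \<Rightarrow> complex \<Rightarrow> complex) \<Rightarrow> complex set \<Rightarrow> bool" where
  "form_bounded_on P1 P2 Q N \<longleftrightarrow> (\<exists>C. \<forall>z \<rho> f g. 0 < \<rho> \<longrightarrow> curve_map P1 P2 f g (ball z \<rho>) \<longrightarrow>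
     (\<forall>\<^sub>\<approx>w\<in>ball z \<rho>. f w \<in> N) \<longrightarrow> (\<forall>\<^sub>\<approx>w\<in>ball z (\<rho>/2). norm (curve_form P2 Q f g w) \<le> C / \<rho>))"

lemma form_bounded_on_subset:
  assumes "form_bounded_on P1 P2 Q N" "N' \<subseteq> N" shows "form_bounded_on P1 P2 Q N'"
proof -
  obtain C where C: "\<forall>z \<rho> f g. 0 < \<rho> \<longrightarrow> curve_map P1 P2 f g (ball z \<rho>) \<longrightarrow>
     (\<forall>\<^sub>\<approx>w\<in>ball z \<rho>. f w \<in> N) \<longrightarrow> (\<forall>\<^sub>\<approx>w\<in>ball z (\<rho>/2). norm (curve_form P2 Q f g w) \<le> C / \<rho>)"
    using assms(1) unfolding form_bounded_on_def by (elim exE) (rule that)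
  show ?thesis unfolding form_bounded_on_def
  proof (rule exI[of _ C], intro allI impI)
    fix z \<rho> f g
    assume *: "0 < (\<rho>::real)" "curve_map P1 P2 f g (ball z \<rho>)" and N': "\<forall>\<^sub>\<approx>w\<in>ball z \<rho>. f w \<in> N'"
    have "\<forall>\<^sub>\<approx>w\<in>ball z \<rho>. f w \<in> N" using N' by eventually_elim (use assms(2) in blast)
    then show "\<forall>\<^sub>\<approx>w\<in>ball z (\<rho>/2). norm (curve_form P2 Q f g w) \<le> C / \<rho>" by (rule C[rule_format, OF *])
  qed
qed

text \<open>The balls are disjoint, so a connected set covered by them cannot leave the one that it
  meets. This keeps \<open>g\<close> near a single point of the fibre over \<open>x0\<close> on a
  whole disc.\<close>

lemma connected_in_separated_balls:
  fixes S :: "complex set"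
  assumes "connected S" "finite Y" "y0 \<in> Y" "u0 \<in> S" "norm (u0 - y0) < e"
    and sep: "\<And>y y'. y \<in> Y \<Longrightarrow> y' \<in> Y \<Longrightarrow> y \<noteq> y' \<Longrightarrow> 2 * e \<le> dist y y'"
    and cov: "\<And>u. u \<in> S \<Longrightarrow> \<exists>y\<in>Y. norm (u - y) < e"
  shows "S \<subseteq> ball y0 e"
proof (rule ccontr)
  assume "\<not> S \<subseteq> ball y0 e"
  then obtain u1 where u1: "u1 \<in> S" "u1 \<notin> ball y0 e" by blast
  define B where "B = (\<Union>y\<in>Y - {y0}. ball y e)"
  have "S \<subseteq> ball y0 e \<union> B"
  proof
    fix u assume "u \<in> S"
    then obtain y where "y \<in> Y" "norm (u - y) < e" using cov by blast
    then show "u \<in> ball y0 e \<union> B"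
      unfolding B_def by (cases "y = y0") (auto simp: dist_norm norm_minus_commute)
  qed
  moreover have "ball y0 e \<inter> B = {}"
  proof -
    have "ball y0 e \<inter> ball y e = {}" if "y \<in> Y" "y \<noteq> y0" for y
      using sep[OF assms(3) that(1)] that by (intro disjoint_ballI) auto
    then show ?thesis unfolding B_def by blast
  qed
  ultimately have "ball y0 e \<inter> S = {} \<or> B \<inter> S = {}"
    using connectedD[OF assms(1), of "ball y0 e" B] unfolding B_def by blast
  moreover have "u0 \<in> ball y0 e \<inter> S" using assms(4,5) by (auto simp: dist_norm norm_minus_commute)
  moreover have "u1 \<in> B" using \<open>S \<subseteq> ball y0 e \<union> B\<close> u1 by blast
  ultimately show False using u1 by blast
qed

text \<open>When \<open>f\<close> stays near \<open>x0\<close>, the equation keeps \<open>g\<close>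
  bounded and close to a finite fibre, so both extend holomorphically. Connectedness singles out one
  fibre point \<open>y0\<close>, and the local bound at \<open>(x0, y0)\<close> is applied on discs
  of radius \<open>\<rho>/2\<close> about the points of the half disc.\<close>

lemma curve_form_bound_finite:
  assumes reg: "regular_form P1 P2 Q"
  shows "\<exists>\<epsilon>>0. form_bounded_on P1 P2 Q (ball x0 \<epsilon>)"
proof -
  define p where "p = P2 - [:poly P1 x0:]"
  have deg: "degree P2 > 0" using reg by (simp add: regular_form_def)
  then have p0: "p \<noteq> 0" unfolding p_def by auto
  define Y where "Y = {y. poly p y = 0}"
  have finY: "finite Y" unfolding Y_def using p0 by (rule poly_roots_finite)
  have Y: "y \<in> Y \<longleftrightarrow> poly P1 x0 = poly P2 y" for y by (auto simp: Y_def p_def)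
  have "\<forall>y\<in>Y. regular_at P1 P2 Q x0 y" using reg Y by (auto simp: regular_form_def)
  then obtain e C where e: "\<And>y. y \<in> Y \<Longrightarrow> e y > 0" and
    C: "\<And>y z \<rho> f g. y \<in> Y \<Longrightarrow> 0 < \<rho> \<Longrightarrow>
     f holomorphic_on ball z \<rho> \<Longrightarrow> g holomorphic_on ball z \<rho> \<Longrightarrow>
     (\<forall>w\<in>ball z \<rho>. f w \<in> ball x0 (e y) \<and> g w \<in> ball y (e y) \<and> poly P1 (f w) = poly P2 (g w)) \<Longrightarrow>
     poly (pderiv P1) (f z) \<noteq> 0 \<Longrightarrow> poly (pderiv P2) (g z) \<noteq> 0 \<Longrightarrow>
     \<rho> * norm (Q (f z) (g z) * deriv f z) \<le> C y * norm (poly (pderiv P2) (g z))"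
    unfolding regular_at_def by metis
  \<comment> \<open>The minimum of this set is below every radius supplied by
    \<open>regular_at\<close> over the fibre and below half of every distance between fibre points,
    which makes the balls disjoint. The entry 1 keeps the set nonempty.\<close>
  define E where "E = insert 1 (e ` Y \<union> (\<lambda>(y,y'). dist y y' / 2) ` {(y,y'). y \<in> Y \<and> y' \<in> Y \<and> y \<noteq> y'})"
  have finE: "finite E" unfolding E_def
    by (intro finite.insertI finite_UnI finite_imageI finY finite_subset[OF _ finite_cartesian_product[OF finY finY]]) auto
  define e1 where "e1 = Min E"
  have e1: "e1 > 0" unfolding e1_def using finE by (subst Min_gr_iff) (auto simp: E_def e)
  have e1_le: "e1 \<le> e y" if "y \<in> Y" for y
    unfolding e1_def by (rule Min_le[OF finE]) (use that in \<open>auto simp: E_def\<close>)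
  have e1_sep: "2 * e1 \<le> dist y y'" if "y \<in> Y" "y' \<in> Y" "y \<noteq> y'" for y y'
  proof -
    have "e1 \<le> dist y y' / 2"
      unfolding e1_def by (rule Min_le[OF finE]) (use that in \<open>force simp: E_def\<close>)
    then show ?thesis by simp
  qed
  define C0 where "C0 = (\<Sum>y\<in>Y. \<bar>C y\<bar>)"
  have C0: "C y \<le> C0" if "y \<in> Y" for y
    using member_le_sum[OF that, of "\<lambda>y. \<bar>C y\<bar>"] finY unfolding C0_def by auto
  obtain \<delta> where \<delta>: "\<delta> > 0" "\<And>y. norm (poly p y) < \<delta> \<Longrightarrow> \<exists>r. poly p r = 0 \<and> norm (y - r) < e1"
    using poly_small_imp_near_root[OF p0 e1] by blast
  have "isCont (poly P1) x0" by simp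
  then obtain \<epsilon>0 where \<epsilon>0: "\<epsilon>0 > 0" "\<And>x. dist x x0 < \<epsilon>0 \<Longrightarrow> dist (poly P1 x) (poly P1 x0) < \<delta>"
    unfolding continuous_at_eps_delta using \<delta>(1) by blast
  define \<epsilon> where "\<epsilon> = min \<epsilon>0 e1 / 2"
  have \<epsilon>: "\<epsilon> > 0" "\<epsilon> < \<epsilon>0" "\<epsilon> < e1" using \<epsilon>0 e1 by (auto simp: \<epsilon>_def)
  have near: "\<exists>y\<in>Y. norm (v - y) < e1" if "norm (u - x0) \<le> \<epsilon>" "poly P1 u = poly P2 v" for u v
  proof -
    have "norm (poly p v) < \<delta>" using \<epsilon>0(2)[of u] that \<epsilon> by (simp add: p_def dist_norm)
    then show ?thesis using \<delta>(2)[of v] by (auto simp: Y_def)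
  qed
  show ?thesis unfolding form_bounded_on_def
  proof (rule exI[of _ \<epsilon>], rule conjI, rule \<epsilon>(1), rule exI[of _ "2 * C0"], intro allI impI)
    fix z \<rho> f g
    assume \<rho>: "0 < \<rho>" and cm: "curve_map P1 P2 f g (ball z \<rho>)" and "\<forall>\<^sub>\<approx>w\<in>ball z \<rho>. f w \<in> ball x0 \<epsilon>"
    then have fe: "\<forall>\<^sub>\<approx>w\<in>ball z \<rho>. norm (f w - x0) < \<epsilon>"
      by (auto simp: dist_norm norm_minus_commute)
    have f: "f meromorphic_on ball z \<rho>" and g: "g meromorphic_on ball z \<rho>" and
      rel: "\<forall>\<^sub>\<approx>w\<in>ball z \<rho>. poly P1 (f w) = poly P2 (g w)" and
      nz: "\<forall>\<^sub>\<approx>w\<in>ball z \<rho>. poly (pderiv P1) (f w) \<noteq> 0 \<and> poly (pderiv P2) (g w) \<noteq> 0"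
      using cm by (auto simp: curve_map_def elim: eventually_mono)
    define F G where "F = remove_sings f" and "G = remove_sings g"
    have "\<forall>\<^sub>\<approx>w\<in>ball z \<rho>. norm (f w) \<le> norm x0 + \<epsilon>"
      using fe
    proof eventually_elim
      case (elim w)
      then show ?case using norm_triangle_sub[of "f w" x0] by simp
    qed
    then have F: "F holomorphic_on ball z \<rho>" unfolding F_def
      by (intro meromorphic_locally_bounded_removable[OF f]) (auto simp: eventually_cosparse_open_eq)
    have "\<forall>\<^sub>\<approx>w\<in>ball z \<rho>. norm (g w) \<le> (\<Sum>y\<in>Y. norm y) + e1"
      using fe rel
    proof eventually_elim
      case (elim w)
      then obtain y where y: "y \<in> Y" "norm (g w - y) < e1" using near[of "f w" "g w"] by auto
      then have "norm y \<le> (\<Sum>y\<in>Y. norm y)" using finY by (intro member_le_sum) auto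
      then show ?case using y norm_triangle_sub[of "g w" y] by simp
    qed
    then have G: "G holomorphic_on ball z \<rho>" unfolding G_def
      by (intro meromorphic_locally_bounded_removable[OF g]) (auto simp: eventually_cosparse_open_eq)
    have Ff: "\<forall>\<^sub>\<approx>w\<in>ball z \<rho>. F w = f w" and Gg: "\<forall>\<^sub>\<approx>w\<in>ball z \<rho>. G w = g w"
      unfolding F_def G_def using f g by (auto intro: eventually_remove_sings_eq)
    have cF: "continuous_on (ball z \<rho>) F" and cG: "continuous_on (ball z \<rho>) G"
      using F G by (auto intro: holomorphic_on_imp_continuous_on)
    have "\<forall>\<^sub>\<approx>w\<in>ball z \<rho>. poly P1 (F w) = poly P2 (G w)"
      using Ff Gg rel by eventually_elim simp
    then have rel': "poly P1 (F w) = poly P2 (G w)" if "w \<in> ball z \<rho>" for w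
      by (rule continuous_cosparse_eq[rotated 3]) (use that cF cG in \<open>auto intro!: continuous_intros\<close>)
    have "\<forall>\<^sub>\<approx>w\<in>ball z \<rho>. F w \<in> cball x0 \<epsilon>"
      using Ff fe by eventually_elim (auto simp: dist_norm norm_minus_commute)
    then have Fx: "F w \<in> cball x0 \<epsilon>" if "w \<in> ball z \<rho>" for w
      by (rule continuous_cosparse_closed[rotated 2]) (use that cF in auto)
    have GY: "\<exists>y\<in>Y. norm (G w - y) < e1" if "w \<in> ball z \<rho>" for w
      using near[OF _ rel'[OF that]] Fx[OF that] by (auto simp: dist_norm norm_minus_commute)
    obtain y0 where y0: "y0 \<in> Y" "norm (G z - y0) < e1" using GY[of z] \<rho> by auto
    have Gy0: "G ` ball z \<rho> \<subseteq> ball y0 e1"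
      by (rule connected_in_separated_balls[OF _ finY y0(1) _ y0(2) e1_sep])
         (use GY \<rho> in \<open>auto intro!: connected_continuous_image cG\<close>)
    have sub: "ball z (\<rho>/2) \<subseteq> ball z \<rho>" using \<rho> by (intro subset_ball) auto
    have "\<forall>\<^sub>\<approx>w\<in>ball z \<rho>. w \<in> ball z (\<rho>/2) \<longrightarrow> norm (curve_form P2 Q f g w) \<le> 2 * C0 / \<rho>"
      using meromorphic_on_imp_analytic_cosparse[OF f] meromorphic_on_imp_analytic_cosparse[OF g] nz
    proof eventually_elim
      case (elim w)
      show ?case
      proof
        assume w: "w \<in> ball z (\<rho>/2)"
        have sub2: "ball w (\<rho>/2) \<subseteq> ball z \<rho>"
          using w by (intro ball_subset_ball_iff[THEN iffD2]) (simp add: dist_commute)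
        have Fw: "F w = f w" "deriv F w = deriv f w" "G w = g w"
          using elim by (auto simp: F_def G_def)
        have "\<rho>/2 * norm (Q (F w) (G w) * deriv F w) \<le> C y0 * norm (poly (pderiv P2) (G w))"
        proof (rule C[OF y0(1)])
          show "F holomorphic_on ball w (\<rho>/2)" "G holomorphic_on ball w (\<rho>/2)"
            using F G sub2 by (auto intro: holomorphic_on_subset)
          show "\<forall>w\<in>ball w (\<rho>/2). F w \<in> ball x0 (e y0) \<and> G w \<in> ball y0 (e y0) \<and> poly P1 (F w) = poly P2 (G w)"
          proof
            fix v assume "v \<in> ball w (\<rho>/2)"
            then have v: "v \<in> ball z \<rho>" using sub2 by blast
            then have "G v \<in> ball y0 e1" using Gy0 by blast
            then show "F v \<in> ball x0 (e y0) \<and> G v \<in> ball y0 (e y0) \<and> poly P1 (F v) = poly P2 (G v)"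
              using Fx[OF v] rel'[OF v] e1_le[OF y0(1)] \<epsilon> by auto
          qed
        qed (use \<rho> elim Fw in auto)
        also have "\<dots> \<le> C0 * norm (poly (pderiv P2) (G w))"
          by (intro mult_right_mono C0 y0) auto
        finally have "\<rho>/2 * norm (Q (f w) (g w) * deriv f w) \<le> C0 * norm (poly (pderiv P2) (g w))"
          by (simp add: Fw)
        then show "norm (curve_form P2 Q f g w) \<le> 2 * C0 / \<rho>"
          using \<rho> elim by (simp add: curve_form_def norm_divide norm_mult field_simps)
      qed
    qed
    then have "\<forall>\<^sub>\<approx>w\<in>ball z (\<rho>/2). w \<in> ball z (\<rho>/2) \<longrightarrow> norm (curve_form P2 Q f g w) \<le> 2 * C0 / \<rho>"
      using sub by (rule cosparse_ball_mono)
    moreover have "\<forall>\<^sub>\<approx>w\<in>ball z (\<rho>/2). w \<in> ball z (\<rho>/2)" by (rule eventually_in_cosparse) auto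
    ultimately show "\<forall>\<^sub>\<approx>w\<in>ball z (\<rho>/2). norm (curve_form P2 Q f g w) \<le> 2 * C0 / \<rho>"
      by eventually_elim auto
  qed
qed

text \<open>In the chart \<open>W = 1 / f\<close> at infinity,
  \<open>deriv f = - deriv W * f^2\<close>. The growth clause absorbs \<open>f^2\<close>, and as
  \<open>norm W \<le> 1\<close>, Cauchy's estimate bounds \<open>deriv W\<close> on the half
  disc.\<close>

lemma curve_form_bound_infinite:
  assumes reg: "regular_form P1 P2 Q"
  shows "\<exists>M>0. form_bounded_on P1 P2 Q {x. norm x > M}"
proof -
  obtain M0 C where C: "\<And>x y. poly P1 x = poly P2 y \<Longrightarrow> norm x \<ge> M0 \<Longrightarrow>
        norm x ^ 2 * norm (Q x y) \<le> C * norm (poly (pderiv P2) y)"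
    using reg unfolding regular_form_def by metis
  define M where "M = max M0 1"
  have M: "M \<ge> 1" "M \<ge> M0" by (auto simp: M_def)
  then have M_pos: "M > 0" by simp
  show ?thesis unfolding form_bounded_on_def
  proof (rule exI[of _ M], rule conjI, rule M_pos, rule exI[of _ "4 * \<bar>C\<bar>"], intro allI impI)
    fix z \<rho> f g
    assume \<rho>: "0 < \<rho>" and cm: "curve_map P1 P2 f g (ball z \<rho>)" and "\<forall>\<^sub>\<approx>w\<in>ball z \<rho>. f w \<in> {x. norm x > M}"
    then have fM: "\<forall>\<^sub>\<approx>w\<in>ball z \<rho>. norm (f w) > M" by simp
    have f: "f meromorphic_on ball z \<rho>" and g: "g meromorphic_on ball z \<rho>" and
      rel: "\<forall>\<^sub>\<approx>w\<in>ball z \<rho>. poly P1 (f w) = poly P2 (g w)" and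
      nz: "\<forall>\<^sub>\<approx>w\<in>ball z \<rho>. poly (pderiv P1) (f w) \<noteq> 0 \<and> poly (pderiv P2) (g w) \<noteq> 0"
      using cm by (auto simp: curve_map_def elim: eventually_mono)
    define h where "h = (\<lambda>w. inverse (f w))"
    have h: "h meromorphic_on ball z \<rho>" unfolding h_def by (intro meromorphic_intros f)
    define W where "W = remove_sings h"
    have h1: "\<forall>\<^sub>\<approx>w\<in>ball z \<rho>. norm (h w) \<le> 1"
      using fM
    proof eventually_elim
      case (elim w)
      then have "norm (f w) \<ge> 1" using M by simp
      then show ?case by (simp add: h_def norm_inverse inverse_le_1_iff)
    qed
    then have W: "W holomorphic_on ball z \<rho>" unfolding W_def
      by (intro meromorphic_locally_bounded_removable[OF h]) (auto simp: eventually_cosparse_open_eq)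
    have "\<forall>\<^sub>\<approx>w\<in>ball z \<rho>. W w = h w"
      unfolding W_def using h by (auto intro: eventually_remove_sings_eq)
    with h1 have "\<forall>\<^sub>\<approx>w\<in>ball z \<rho>. W w \<in> cball 0 1"
      by eventually_elim auto
    then have W1: "W w \<in> cball 0 1" if "w \<in> ball z \<rho>" for w
      by (rule continuous_cosparse_closed[rotated 2])
         (use that W in \<open>auto intro: holomorphic_on_imp_continuous_on\<close>)
    have sub: "ball z (\<rho>/2) \<subseteq> ball z \<rho>" using \<rho> by (intro subset_ball) auto
    have "\<forall>\<^sub>\<approx>w\<in>ball z \<rho>. w \<in> ball z (\<rho>/2) \<longrightarrow> norm (curve_form P2 Q f g w) \<le> 4 * \<bar>C\<bar> / \<rho>"
      using meromorphic_on_imp_analytic_cosparse[OF f] fM nz rel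
    proof eventually_elim
      case (elim w)
      show ?case
      proof
        assume w: "w \<in> ball z (\<rho>/2)"
        have sub2: "ball w (\<rho>/2) \<subseteq> ball z \<rho>"
          using w by (intro ball_subset_ball_iff[THEN iffD2]) (simp add: dist_commute)
        have f0: "f w \<noteq> 0" using elim M by auto
        have han: "h analytic_on {w}" unfolding h_def using elim f0 by (auto intro!: analytic_intros)
        have "(f has_field_derivative deriv f w) (at w)"
          using elim(1) by (simp add: analytic_on_imp_differentiable_at DERIV_deriv_iff_field_differentiable)
        then have "deriv h w = - (deriv f w / (f w)^2)"
          unfolding h_def using f0 by (intro DERIV_imp_deriv) (auto intro!: derivative_eq_intros simp: power2_eq_square field_simps)
        then have dW: "deriv f w = - deriv W w * (f w)^2"
          using f0 han by (simp add: W_def)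
        have "norm (deriv W w) \<le> 2 * 1 / (\<rho>/2)"
          by (rule deriv_bound_ball[OF holomorphic_on_subset[OF W sub2]]) (use \<rho> W1 sub2 in auto)
        then have dWb: "norm (deriv W w) \<le> 4 / \<rho>" by simp
        have "norm (Q (f w) (g w) * deriv f w) = (norm (f w) ^ 2 * norm (Q (f w) (g w))) * norm (deriv W w)"
          by (simp add: dW norm_mult norm_power)
        also have "\<dots> \<le> (\<bar>C\<bar> * norm (poly (pderiv P2) (g w))) * (4 / \<rho>)"
        proof (rule mult_mono)
          have "norm (f w) ^ 2 * norm (Q (f w) (g w)) \<le> C * norm (poly (pderiv P2) (g w))"
            using C[of "f w" "g w"] elim M by auto
          also have "\<dots> \<le> \<bar>C\<bar> * norm (poly (pderiv P2) (g w))" by (intro mult_right_mono) auto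
          finally show "norm (f w) ^ 2 * norm (Q (f w) (g w)) \<le> \<bar>C\<bar> * norm (poly (pderiv P2) (g w))" .
        qed (use dWb in auto)
        finally show "norm (curve_form P2 Q f g w) \<le> 4 * \<bar>C\<bar> / \<rho>"
          using \<rho> elim by (simp add: curve_form_def norm_divide field_simps)
      qed
    qed
    then have "\<forall>\<^sub>\<approx>w\<in>ball z (\<rho>/2). w \<in> ball z (\<rho>/2) \<longrightarrow> norm (curve_form P2 Q f g w) \<le> 4 * \<bar>C\<bar> / \<rho>"
      using sub by (rule cosparse_ball_mono)
    moreover have "\<forall>\<^sub>\<approx>w\<in>ball z (\<rho>/2). w \<in> ball z (\<rho>/2)" by (rule eventually_in_cosparse) auto
    ultimately show "\<forall>\<^sub>\<approx>w\<in>ball z (\<rho>/2). norm (curve_form P2 Q f g w) \<le> 4 * \<bar>C\<bar> / \<rho>"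
      by eventually_elim auto
  qed
qed

section \<open>Rescaling, and the vanishing of a pair of forms on the plane\<close>

lemma rescaling_point:
  fixes \<Phi> :: "complex \<Rightarrow> real"
  assumes cont: "continuous_on UNIV \<Phi>" and nn: "\<And>z. \<Phi> z \<ge> 0" and pos: "\<Phi> z0 > 0" and R: "R > 0"
  obtains z t where "t > 0" "\<Phi> z > 0" "R \<le> t * \<Phi> z" "\<And>w. w \<in> ball z t \<Longrightarrow> \<Phi> w \<le> 2 * \<Phi> z"
proof -
  \<comment> \<open>With this radius \<open>h z0 = 2 * R\<close>, so the maximum of \<open>h\<close>
    is at least that. If \<open>t\<close> is half the distance from the maximiser \<open>z\<close>
    to the boundary circle, the weight \<open>r - dist z0 w\<close> on \<open>ball z t\<close> is at
    least half its value at \<open>z\<close>; hence the factor 2 in the conclusion.\<close>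
  define r where "r = 2 * R / \<Phi> z0"
  have r: "r > 0" using pos R by (simp add: r_def)
  define h where "h = (\<lambda>z. (r - dist z0 z) * \<Phi> z)"
  have "\<exists>z\<in>cball z0 r. \<forall>w\<in>cball z0 r. h w \<le> h z"
    unfolding h_def using r
    by (intro continuous_attains_sup continuous_intros continuous_on_subset[OF cont]) auto
  then obtain z where z: "z \<in> cball z0 r" "\<And>w. w \<in> cball z0 r \<Longrightarrow> h w \<le> h z" by blast
  have "h z0 \<le> h z" using z r by auto
  then have hz: "2 * R \<le> h z" using pos by (simp add: h_def r_def)
  then have "h z > 0" using R by simp
  then have dz: "dist z0 z < r" and \<Phi>z: "\<Phi> z > 0"
    using z(1) nn[of z] by (auto simp: h_def zero_less_mult_iff)
  define t where "t = (r - dist z0 z) / 2"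
  show ?thesis
  proof
    show t: "t > 0" using dz by (simp add: t_def)
    show "\<Phi> z > 0" by fact
    show "R \<le> t * \<Phi> z" using hz by (simp add: h_def t_def)
    fix w assume w: "w \<in> ball z t"
    have "dist z0 w \<le> dist z0 z + dist z w" by (rule dist_triangle)
    also have "\<dots> \<le> r - t" using w by (simp add: t_def field_simps)
    finally have tw: "t \<le> r - dist z0 w" by simp
    then have "w \<in> cball z0 r" using t by simp
    then have "h w \<le> h z" by (rule z)
    moreover have "t * \<Phi> w \<le> h w" unfolding h_def using tw nn by (intro mult_right_mono) auto
    ultimately have "t * \<Phi> w \<le> t * (2 * \<Phi> z)" by (simp add: h_def t_def)
    then show "\<Phi> w \<le> 2 * \<Phi> z" using t by simp
  qed
qed

lemma entire_nearly_constant: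
  assumes F: "F holomorphic_on UNIV" and t: "t > 0" and B: "\<And>w. w \<in> ball z t \<Longrightarrow> norm (F w) \<le> B"
    and w: "w \<in> ball z (t/2)"
  shows "norm (F w - F z) \<le> 4 * B / t * norm (w - z)"
proof (rule field_differentiable_bound[where S = "ball z (t/2)" and f = F and f' = "deriv F"])
  fix v assume v: "v \<in> ball z (t/2)"
  show "(F has_field_derivative deriv F v) (at v within ball z (t/2))"
    using F by (intro DERIV_subset[OF holomorphic_derivI[OF F]]) auto
  have sub: "ball v (t/2) \<subseteq> ball z t"
    using v by (intro ball_subset_ball_iff[THEN iffD2]) (simp add: dist_commute)
  have "norm (deriv F v) \<le> 2 * B / (t/2)"
    by (rule deriv_bound_ball[OF holomorphic_on_subset[OF F]]) (use t sub B in auto)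
  then show "norm (deriv F v) \<le> 4 * B / t" by simp
qed (use t w in auto)

lemma cosparse_punctured_ballI:
  fixes z :: complex
  assumes "\<And>w. w \<in> ball z r \<Longrightarrow> w \<noteq> z \<Longrightarrow> P w"
  shows "\<forall>\<^sub>\<approx>w\<in>ball z r. P w"
proof -
  have "\<forall>\<^sub>\<approx>w\<in>ball z r. w \<notin> {z}" by (rule eventually_not_in_cosparse) simp
  moreover have "\<forall>\<^sub>\<approx>w\<in>ball z r. w \<in> ball z r" by (rule eventually_in_cosparse) auto
  ultimately show ?thesis by eventually_elim (use assms in auto)
qed

lemma curve_map_subset: "curve_map P1 P2 f g A \<Longrightarrow> B \<subseteq> A \<Longrightarrow> curve_map P1 P2 f g B"
  unfolding curve_map_def by (auto intro: meromorphic_on_subset cosparse_ball_mono)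

lemma curve_form_meromorphic:
  assumes "regular_form P1 P2 Q" "curve_map P1 P2 f g A"
  shows "curve_form P2 Q f g meromorphic_on A"
  unfolding curve_form_def using assms unfolding regular_form_def curve_map_def
  by (intro meromorphic_intros) auto

lemma form_bounded_on_imp_locally_bounded:
  assumes bd: "form_bounded_on P1 P2 Q N" and cm: "curve_map P1 P2 f g (ball z r)" and r: "r > 0"
    and ev: "\<forall>\<^sub>F w in at z. f w \<in> N"
  shows "\<exists>B. \<forall>\<^sub>F w in at z. norm (curve_form P2 Q f g w) \<le> B"
proof -
  obtain C where C: "\<forall>z \<rho> f g. 0 < \<rho> \<longrightarrow> curve_map P1 P2 f g (ball z \<rho>) \<longrightarrow>
     (\<forall>\<^sub>\<approx>w\<in>ball z \<rho>. f w \<in> N) \<longrightarrow> (\<forall>\<^sub>\<approx>w\<in>ball z (\<rho>/2). norm (curve_form P2 Q f g w) \<le> C / \<rho>)"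
    using bd unfolding form_bounded_on_def by (elim exE) (rule that)
  obtain d where d: "d > 0" "\<And>w. w \<in> ball z d \<Longrightarrow> w \<noteq> z \<Longrightarrow> f w \<in> N"
    using ev unfolding eventually_at by (auto simp: dist_commute)
  define \<rho> where "\<rho> = min d r"
  have \<rho>: "\<rho> > 0" using d r by (simp add: \<rho>_def)
  have "\<forall>\<^sub>\<approx>w\<in>ball z \<rho>. f w \<in> N"
    by (rule cosparse_punctured_ballI) (use d in \<open>auto simp: \<rho>_def\<close>)
  moreover have "curve_map P1 P2 f g (ball z \<rho>)"
    by (rule curve_map_subset[OF cm]) (auto simp: \<rho>_def)
  ultimately have "\<forall>\<^sub>\<approx>w\<in>ball z (\<rho>/2). norm (curve_form P2 Q f g w) \<le> C / \<rho>"
    using C[rule_format, OF \<rho>] by blast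
  then show ?thesis using \<rho> by (auto simp: eventually_cosparse_open_eq)
qed

text \<open>As a map to the sphere, \<open>f\<close> has a limit at every point, finite or infinite,
  and the uniform bound near that limit applies on a small disc.\<close>

lemma curve_form_locally_bounded:
  assumes reg: "regular_form P1 P2 Q" and cm: "curve_map P1 P2 f g (ball z r)" and r: "r > 0"
  shows "\<exists>B. \<forall>\<^sub>F w in at z. norm (curve_form P2 Q f g w) \<le> B"
proof (cases "is_pole f z")
  case True
  obtain M where M: "M > 0" "form_bounded_on P1 P2 Q {x. norm x > M}"
    using curve_form_bound_infinite[OF reg] by blast
  have "\<forall>\<^sub>F w in at z. M + 1 \<le> norm (f w)"
    using True M unfolding is_pole_def filterlim_at_infinity[OF order_refl] by simp
  then have "\<forall>\<^sub>F w in at z. f w \<in> {x. norm x > M}" by eventually_elim auto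
  then show ?thesis by (rule form_bounded_on_imp_locally_bounded[OF M(2) cm r])
next
  case False
  have "not_essential f z"
    using cm r unfolding curve_map_def by (auto simp: meromorphic_on_altdef)
  then obtain x0 where x0: "f \<midarrow>z\<rightarrow> x0" using False by (auto simp: not_essential_def)
  obtain \<epsilon> where \<epsilon>: "\<epsilon> > 0" "form_bounded_on P1 P2 Q (ball x0 \<epsilon>)"
    using curve_form_bound_finite[OF reg] by blast
  have "\<forall>\<^sub>F w in at z. f w \<in> ball x0 \<epsilon>" using tendstoD[OF x0 \<epsilon>(1)] by (simp add: dist_commute)
  then show ?thesis by (rule form_bounded_on_imp_locally_bounded[OF \<epsilon>(2) cm r])
qed

lemma curve_form_extends:
  assumes "regular_form P1 P2 Q" "curve_map P1 P2 f g UNIV"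
  shows "remove_sings (curve_form P2 Q f g) holomorphic_on UNIV"
  by (rule meromorphic_locally_bounded_removable[OF curve_form_meromorphic[OF assms]])
     (use curve_form_locally_bounded[OF assms(1) curve_map_subset[OF assms(2) subset_UNIV], where r = 1] in auto)

theorem regular_forms_vanish_meromorphic:
  assumes reg1: "regular_form P1 P2 Q" and reg2: "regular_form P1 P2 (\<lambda>x y. x * Q x y)"
    and cm: "curve_map P1 P2 f g UNIV"
  shows "\<forall>\<^sub>\<approx>z. Q (f z) (g z) * deriv f z = 0"
proof -
  define E1 where "E1 = curve_form P2 Q f g"
  define E2 where "E2 = curve_form P2 (\<lambda>x y. x * Q x y) f g"
  have E21: "E2 w = f w * E1 w" for w by (simp add: E1_def E2_def curve_form_def)
  define F1 F2 where "F1 = remove_sings E1" and "F2 = remove_sings E2"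
  have F1: "F1 holomorphic_on UNIV" and F2: "F2 holomorphic_on UNIV"
    unfolding F1_def F2_def E1_def E2_def using curve_form_extends reg1 reg2 cm by blast+
  have FE1: "\<forall>\<^sub>\<approx>w. F1 w = E1 w" and FE2: "\<forall>\<^sub>\<approx>w. F2 w = E2 w"
    unfolding F1_def F2_def E1_def E2_def
    by (intro eventually_remove_sings_eq curve_form_meromorphic[OF _ cm] reg1 reg2)+
  have c1: "continuous_on A F1" and c2: "continuous_on A F2" for A
    by (rule holomorphic_on_imp_continuous_on[OF holomorphic_on_subset[OF F1 subset_UNIV]],
        rule holomorphic_on_imp_continuous_on[OF holomorphic_on_subset[OF F2 subset_UNIV]])
  have nz: "\<forall>\<^sub>\<approx>w. poly (pderiv P2) (g w) \<noteq> 0"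
    using cm by (auto simp: curve_map_def elim: eventually_mono)
  have F10: "F1 z = 0" for z
  proof (rule ccontr)
    assume "F1 z \<noteq> 0"
    define \<Phi> where "\<Phi> = (\<lambda>w. norm (F1 w) + norm (F2 w))"
    have \<Phi>z: "\<Phi> z > 0" using \<open>F1 z \<noteq> 0\<close> by (simp add: \<Phi>_def add_pos_nonneg)
    \<comment> \<open>The square leaves room for an intermediate radius: \<open>\<rho> j\<close>
      below is shorter than \<open>t j\<close> by a factor of at least \<open>j + 2\<close>, so the
      forms vary little on that disc, and yet it exceeds \<open>1 / s j\<close> by the factor
      \<open>j + 2\<close>. The summand 2 ensures \<open>\<rho> j \<le> t j / 2\<close>.\<close>
    have "\<forall>j. \<exists>q. snd q > 0 \<and> \<Phi> (fst q) > 0 \<and> (real j + 2)^2 \<le> snd q * \<Phi> (fst q) \<and>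
        (\<forall>w\<in>ball (fst q) (snd q). \<Phi> w \<le> 2 * \<Phi> (fst q))"
    proof
      fix j
      have "continuous_on UNIV \<Phi>" unfolding \<Phi>_def by (intro continuous_intros c1 c2)
      moreover have "\<Phi> w \<ge> 0" for w by (simp add: \<Phi>_def)
      moreover have "(real j + 2)^2 > 0" by (simp add: add_nonneg_pos)
      ultimately obtain v t where "t > 0" "\<Phi> v > 0" "(real j + 2)^2 \<le> t * \<Phi> v" "\<And>w. w \<in> ball v t \<Longrightarrow> \<Phi> w \<le> 2 * \<Phi> v"
        using rescaling_point[of \<Phi> z "(real j + 2)^2", OF _ _ \<Phi>z] by (metis (no_types))
      then show "\<exists>q. snd q > 0 \<and> \<Phi> (fst q) > 0 \<and> (real j + 2)^2 \<le> snd q * \<Phi> (fst q) \<and>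
        (\<forall>w\<in>ball (fst q) (snd q). \<Phi> w \<le> 2 * \<Phi> (fst q))" by (intro exI[of _ "(v, t)"]) auto
    qed
    from choice[OF this] obtain q where q: "\<And>j. snd (q j) > 0 \<and> \<Phi> (fst (q j)) > 0 \<and> (real j + 2)^2 \<le> snd (q j) * \<Phi> (fst (q j)) \<and>
        (\<forall>w\<in>ball (fst (q j)) (snd (q j)). \<Phi> w \<le> 2 * \<Phi> (fst (q j)))" by blast
    define u t where "u j = fst (q j)" and "t j = snd (q j)" for j
    have t: "t j > 0" and \<Phi>u: "\<Phi> (u j) > 0" and big: "(real j + 2)^2 \<le> t j * \<Phi> (u j)"
      and dbl: "w \<in> ball (u j) (t j) \<Longrightarrow> \<Phi> w \<le> 2 * \<Phi> (u j)" for j w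
      using q[of j] by (auto simp: u_def t_def)
    define s where "s j = \<Phi> (u j)" for j
    have s: "s j > 0" for j by (simp add: s_def \<Phi>u)
    define \<rho> where "\<rho> j = (real j + 2) / s j" for j
    have \<rho>: "\<rho> j > 0" for j using s by (simp add: \<rho>_def)
    have t\<rho>: "(real j + 2) * \<rho> j \<le> t j" for j
      using big[of j] s[of j] by (simp add: \<rho>_def s_def field_simps power2_eq_square)
    have var: "norm (F w / s j - F (u j) / s j) \<le> 8 / (real j + 2)"
      if F: "F holomorphic_on UNIV" "\<And>w. norm (F w) \<le> \<Phi> w" and w: "w \<in> ball (u j) (\<rho> j)" for F w j
    proof -
      have "2 * \<rho> j \<le> (real j + 2) * \<rho> j" using \<rho>[of j] by (intro mult_right_mono) auto
      then have "\<rho> j \<le> t j / 2" using t\<rho>[of j] by simp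
      then have w': "w \<in> ball (u j) (t j / 2)" using w by auto
      have "norm (F w - F (u j)) \<le> 4 * (2 * s j) / t j * norm (w - u j)"
      proof (rule entire_nearly_constant[OF F(1) t _ w'])
        fix v assume "v \<in> ball (u j) (t j)"
        then show "norm (F v) \<le> 2 * s j" using F(2)[of v] dbl[of v j] by (simp add: s_def)
      qed
      also have "\<dots> \<le> 4 * (2 * s j) / t j * \<rho> j"
        using w t[of j] s[of j] by (intro mult_left_mono) (auto simp: dist_norm norm_minus_commute)
      also have "\<dots> = s j * (8 * (\<rho> j / t j))" by simp
      also have "\<rho> j / t j \<le> 1 / (real j + 2)"
        using t\<rho>[of j] t[of j] by (simp add: field_simps)
      finally have "norm (F w - F (u j)) \<le> s j * (8 * (1 / (real j + 2)))"
        using s[of j] by (simp add: mult_left_mono)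
      then have "norm (F w - F (u j)) / s j \<le> 8 / (real j + 2)" using s[of j] by (simp add: field_simps)
      moreover have "norm (F w / s j - F (u j) / s j) = norm (F w - F (u j)) / s j"
        using s[of j] by (simp add: diff_divide_distrib[symmetric] norm_divide)
      ultimately show ?thesis by simp
    qed
    \<comment> \<open>Divided by \<open>s j\<close>, the two values have moduli with sum 1, so a
      subsequence converges to some \<open>(a, b)\<close> other than \<open>(0, 0)\<close>. As
      \<open>F2 = f * F1\<close> off a sparse set, \<open>b / a\<close> is the limiting value of
      \<open>f\<close>, understood as infinity when \<open>a = 0\<close>.\<close>
    define p where "p j = (F1 (u j) / s j, F2 (u j) / s j)" for j
    have norm1: "norm (fst (p j)) + norm (snd (p j)) = 1" for j
      using s[of j] by (simp add: p_def norm_divide add_divide_distrib[symmetric]) (simp add: s_def \<Phi>_def)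
    have "norm (p j) \<le> 1" for j
      using norm_Pair_le[of "fst (p j)" "snd (p j)"] norm1[of j] by simp
    then have "bounded (range p)" by (auto simp: bounded_iff)
    then obtain l r where r: "strict_mono (r :: nat \<Rightarrow> nat)" and lim: "(p \<circ> r) \<longlonglongrightarrow> l"
      using bounded_imp_convergent_subsequence by blast
    define a b where "a = fst l" and "b = snd l"
    have lima: "(\<lambda>i. F1 (u (r i)) / s (r i)) \<longlonglongrightarrow> a" and limb: "(\<lambda>i. F2 (u (r i)) / s (r i)) \<longlonglongrightarrow> b"
      using tendsto_fst[OF lim] tendsto_snd[OF lim] by (simp_all add: p_def a_def b_def o_def)
    have "(\<lambda>i. norm (F1 (u (r i)) / s (r i)) + norm (F2 (u (r i)) / s (r i))) \<longlonglongrightarrow> norm a + norm b"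
      by (intro tendsto_intros lima limb)
    moreover have "norm (F1 (u (r i)) / s (r i)) + norm (F2 (u (r i)) / s (r i)) = 1" for i
      using norm1[of "r i"] by (simp add: p_def)
    ultimately have ab: "norm a + norm b = 1" by (simp add: LIMSEQ_const_iff)
    \<comment> \<open>\<open>N\<close> is a neighbourhood of \<open>b / a\<close> on the sphere that
      carries both uniform bounds. The variables \<open>x\<close>, \<open>y\<close> stand for the
      rescaled forms and \<open>v\<close> for \<open>f w\<close>; the equation
      \<open>y = v * x\<close> also covers \<open>x = 0\<close> without a division.\<close>
    have "\<exists>N \<eta>. \<eta> > 0 \<and> (\<forall>x y v. y = v * x \<longrightarrow> norm (x - a) < \<eta> \<longrightarrow> norm (y - b) < \<eta> \<longrightarrow> v \<in> N) \<and>
       form_bounded_on P1 P2 Q N \<and> form_bounded_on P1 P2 (\<lambda>x y. x * Q x y) N"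
    proof (cases "a = 0")
      case False
      obtain \<epsilon>1 where 1: "\<epsilon>1 > 0" "form_bounded_on P1 P2 Q (ball (b/a) \<epsilon>1)"
        using curve_form_bound_finite[OF reg1] by blast
      obtain \<epsilon>2 where 2: "\<epsilon>2 > 0" "form_bounded_on P1 P2 (\<lambda>x y. x * Q x y) (ball (b/a) \<epsilon>2)"
        using curve_form_bound_finite[OF reg2] by blast
      define \<epsilon> where "\<epsilon> = min \<epsilon>1 \<epsilon>2"
      have \<epsilon>: "\<epsilon> > 0" using 1 2 by (simp add: \<epsilon>_def)
      have "isCont (\<lambda>q. snd q / fst q) (a, b)"
        by (rule isCont_divide[OF isCont_snd[OF continuous_ident] isCont_fst[OF continuous_ident]]) (simp add: False)
      then have "\<forall>e>0. \<exists>d>0. \<forall>q. dist q (a, b) < d \<longrightarrow> dist (snd q / fst q) (b / a) < e"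
        unfolding continuous_at_eps_delta by simp
      from this[rule_format, OF \<epsilon>]
      obtain d where d: "d > 0" "\<And>q. dist q (a, b) < d \<Longrightarrow> dist (snd q / fst q) (b / a) < \<epsilon>"
        by blast
      show ?thesis
      proof (rule exI[of _ "ball (b/a) \<epsilon>"], rule exI[of _ "min (d/2) (norm a)"], intro conjI allI impI)
        show "0 < min (d/2) (norm a)" using d False by simp
        show "form_bounded_on P1 P2 Q (ball (b/a) \<epsilon>)"
          by (rule form_bounded_on_subset[OF 1(2)]) (auto simp: \<epsilon>_def)
        show "form_bounded_on P1 P2 (\<lambda>x y. x * Q x y) (ball (b/a) \<epsilon>)"
          by (rule form_bounded_on_subset[OF 2(2)]) (auto simp: \<epsilon>_def)
        fix x y v assume *: "y = v * x" "norm (x - a) < min (d/2) (norm a)" "norm (y - b) < min (d/2) (norm a)"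
        then have "x \<noteq> 0" by auto
        have "dist (x, y) (a, b) \<le> dist x a + dist y b"
          by (simp add: dist_Pair_Pair sqrt_sum_squares_le_sum)
        then have "dist (x, y) (a, b) < d" using * by (simp add: dist_norm)
        then show "v \<in> ball (b/a) \<epsilon>" using d(2)[of "(x,y)"] * \<open>x \<noteq> 0\<close> by (simp add: dist_commute)
      qed
    next
      case True
      then have b: "norm b = 1" using ab by simp
      obtain M1 where 1: "M1 > 0" "form_bounded_on P1 P2 Q {x. norm x > M1}"
        using curve_form_bound_infinite[OF reg1] by blast
      obtain M2 where 2: "M2 > 0" "form_bounded_on P1 P2 (\<lambda>x y. x * Q x y) {x. norm x > M2}"
        using curve_form_bound_infinite[OF reg2] by blast
      define M where "M = max M1 M2"
      have M: "M > 0" using 1 2 by (simp add: M_def)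
      show ?thesis
      proof (rule exI[of _ "{x. norm x > M}"], rule exI[of _ "1 / (M + 1)"], intro conjI allI impI)
        show "0 < 1 / (M + 1)" using M by simp
        show "form_bounded_on P1 P2 Q {x. norm x > M}"
          by (rule form_bounded_on_subset[OF 1(2)]) (auto simp: M_def)
        show "form_bounded_on P1 P2 (\<lambda>x y. x * Q x y) {x. norm x > M}"
          by (rule form_bounded_on_subset[OF 2(2)]) (auto simp: M_def)
        fix x y v assume *: "y = v * x" "norm (x - a) < 1 / (M + 1)" "norm (y - b) < 1 / (M + 1)"
        have "norm b \<le> norm y + norm (y - b)" using norm_triangle_sub[of b y] by (simp add: norm_minus_commute)
        then have "norm y > 1 - 1 / (M + 1)" using * b by simp
        moreover have "1 - 1 / (M + 1) = M * (1 / (M + 1))" using M by (simp add: field_simps)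
        moreover have "M * norm x \<le> M * (1 / (M + 1))" using * True M by (intro mult_left_mono) auto
        ultimately have "M * norm x < norm y" by linarith
        then have "M * norm x < norm v * norm x" using * by (simp add: norm_mult)
        then show "v \<in> {x. norm x > M}" by (simp add: mult_less_cancel_right)
      qed
    qed
    then obtain N \<eta> where \<eta>: "\<eta> > 0" and N: "\<forall>x y v. y = v * x \<longrightarrow> norm (x - a) < \<eta> \<longrightarrow> norm (y - b) < \<eta> \<longrightarrow> v \<in> N"
      and bounded: "form_bounded_on P1 P2 Q N" "form_bounded_on P1 P2 (\<lambda>x y. x * Q x y) N"
      by (elim exE conjE) (rule that)
    obtain C1 where C1: "\<forall>z \<rho> f g. 0 < \<rho> \<longrightarrow> curve_map P1 P2 f g (ball z \<rho>) \<longrightarrow> (\<forall>\<^sub>\<approx>w\<in>ball z \<rho>. f w \<in> N) \<longrightarrow>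
        (\<forall>\<^sub>\<approx>w\<in>ball z (\<rho>/2). norm (curve_form P2 Q f g w) \<le> C1 / \<rho>)"
      using bounded(1) unfolding form_bounded_on_def by (elim exE) (rule that)
    obtain C2 where C2: "\<forall>z \<rho> f g. 0 < \<rho> \<longrightarrow> curve_map P1 P2 f g (ball z \<rho>) \<longrightarrow> (\<forall>\<^sub>\<approx>w\<in>ball z \<rho>. f w \<in> N) \<longrightarrow>
        (\<forall>\<^sub>\<approx>w\<in>ball z (\<rho>/2). norm (curve_form P2 (\<lambda>x y. x * Q x y) f g w) \<le> C2 / \<rho>)"
      using bounded(2) unfolding form_bounded_on_def by (elim exE) (rule that)
    have rinf: "filterlim (\<lambda>i. real (r i)) at_top sequentially"
      by (intro filterlim_compose[OF filterlim_real_sequentially] filterlim_subseq r)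
    have "\<forall>\<^sub>F i in sequentially. norm (F1 (u (r i)) / s (r i) - a) < \<eta>/2"
      using tendstoD[OF lima, of "\<eta>/2"] \<eta> by (simp add: dist_norm)
    moreover have "\<forall>\<^sub>F i in sequentially. norm (F2 (u (r i)) / s (r i) - b) < \<eta>/2"
      using tendstoD[OF limb, of "\<eta>/2"] \<eta> by (simp add: dist_norm)
    moreover have "\<forall>\<^sub>F i in sequentially. real (r i) \<ge> max (16 / \<eta>) (C1 + C2)"
      using rinf unfolding filterlim_at_top by blast
    ultimately have "\<forall>\<^sub>F i in sequentially. False"
    proof eventually_elim
      case (elim i)
      define j where "j = r i"
      have "8 / (real j + 2) < \<eta>/2"
        using elim \<eta> by (simp add: j_def field_simps)
      then have small: "8 / (real j + 2) < \<eta>/2" .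
      have inN: "f w \<in> N" if w: "w \<in> ball (u j) (\<rho> j)" and e: "F1 w = E1 w" "F2 w = E2 w" for w
      proof (rule N[rule_format, of "F2 w / s j" "f w" "F1 w / s j"])
        show "F2 w / s j = f w * (F1 w / s j)" using e E21[of w] by simp
        have "norm (F1 w / s j - a) \<le> norm (F1 w / s j - F1 (u j) / s j) + norm (F1 (u j) / s j - a)"
          using norm_triangle_ineq[of "F1 w / s j - F1 (u j) / s j" "F1 (u j) / s j - a"] by simp
        also have "\<dots> < \<eta>" using var[OF F1 _ w] small elim(1) by (simp add: \<Phi>_def j_def)
        finally show "norm (F1 w / s j - a) < \<eta>" .
        have "norm (F2 w / s j - b) \<le> norm (F2 w / s j - F2 (u j) / s j) + norm (F2 (u j) / s j - b)"
          using norm_triangle_ineq[of "F2 w / s j - F2 (u j) / s j" "F2 (u j) / s j - b"] by simp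
        also have "\<dots> < \<eta>" using var[OF F2 _ w] small elim(2) by (simp add: \<Phi>_def j_def)
        finally show "norm (F2 w / s j - b) < \<eta>" .
      qed
      have FEb: "\<forall>\<^sub>\<approx>w\<in>B. F1 w = E1 w" "\<forall>\<^sub>\<approx>w\<in>B. F2 w = E2 w" for B
        using FE1 FE2 by (auto intro: cosparse_ball_mono)
      have "\<forall>\<^sub>\<approx>w\<in>ball (u j) (\<rho> j). w \<in> ball (u j) (\<rho> j)" by (rule eventually_in_cosparse) auto
      with FEb have "\<forall>\<^sub>\<approx>w\<in>ball (u j) (\<rho> j). f w \<in> N"
        by (rule eventually_elim2[OF eventually_conj]) (use inN in auto)
      moreover have "curve_map P1 P2 f g (ball (u j) (\<rho> j))" using cm by (rule curve_map_subset) auto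
      ultimately have bd: "\<forall>\<^sub>\<approx>w\<in>ball (u j) (\<rho> j/2). norm (E1 w) \<le> C1 / \<rho> j"
        "\<forall>\<^sub>\<approx>w\<in>ball (u j) (\<rho> j/2). norm (E2 w) \<le> C2 / \<rho> j"
        using C1[rule_format, OF \<rho>] C2[rule_format, OF \<rho>] unfolding E1_def E2_def by blast+
      have b1: "\<forall>\<^sub>\<approx>w\<in>ball (u j) (\<rho> j/2). F1 w \<in> cball 0 (C1 / \<rho> j)"
        using bd(1) FEb(1) by eventually_elim auto
      have "F1 (u j) \<in> cball 0 (C1 / \<rho> j)"
        by (rule continuous_cosparse_closed[OF _ c1 b1]) (use \<rho> in auto)
      moreover have b2: "\<forall>\<^sub>\<approx>w\<in>ball (u j) (\<rho> j/2). F2 w \<in> cball 0 (C2 / \<rho> j)"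
        using bd(2) FEb(2) by eventually_elim auto
      have "F2 (u j) \<in> cball 0 (C2 / \<rho> j)"
        by (rule continuous_cosparse_closed[OF _ c2 b2]) (use \<rho> in auto)
      \<comment> \<open>Since \<open>\<rho> j = (j + 2) / s j\<close>, the scale \<open>s j\<close>
        cancels and \<open>j + 2 \<le> C1 + C2\<close> remains, contrary to the choice of
        \<open>i\<close>.\<close>
      ultimately have "s j \<le> C1 / \<rho> j + C2 / \<rho> j" by (simp add: s_def \<Phi>_def)
      also have "\<dots> = (C1 + C2) * s j / (real j + 2)" 
        unfolding \<rho>_def by (simp only: divide_divide_eq_right add_divide_distrib[symmetric] distrib_right)
      finally have "s j * (real j + 2) \<le> s j * (C1 + C2)" by (simp add: field_simps)
      then have "real j + 2 \<le> C1 + C2" using s[of j] by simp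
      then show ?case using elim(3) by (simp add: j_def)
    qed
    then show False by simp
  qed
  have "\<forall>\<^sub>\<approx>w. E1 w = 0" using FE1 by eventually_elim (simp add: F10)
  with nz show ?thesis by eventually_elim (auto simp: E1_def curve_form_def)
qed

section \<open>Inversion, and the vanishing of a single form on the sphere\<close>

lemma meromorphic_inversion_eq_0_iff:
  assumes h: "h meromorphic_on UNIV" and hi: "(\<lambda>z. h (inverse z)) meromorphic_on UNIV"
  shows "(\<forall>\<^sub>\<approx>z. h (inverse z) = 0) \<longleftrightarrow> (\<forall>\<^sub>\<approx>z. h z = 0)"
    and "(\<forall>\<^sub>\<approx>z. h (inverse z) \<noteq> 0) \<longleftrightarrow> (\<forall>\<^sub>\<approx>z. h z \<noteq> 0)"
proof -
  \<comment> \<open>Inversion fixes the point 1, so punctured neighbourhoods of 1 compare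
    \<open>h\<close> with its composite. Each of the two is zero off a sparse set or nonzero off
    one, hence their behaviour near 1 decides everything.\<close>
  have lim: "filterlim (inverse :: complex \<Rightarrow> complex) (at 1) (at 1)"
    unfolding filterlim_at
  proof
    show "\<forall>\<^sub>F x in at (1::complex). inverse x \<in> UNIV \<and> inverse x \<noteq> 1"
      by (rule eventually_mono[OF eventually_neq_at_within[of 1]]) (metis UNIV_I inverse_eq_1_iff)
    show "(inverse \<longlongrightarrow> 1) (at (1::complex))"
      using tendsto_inverse[OF tendsto_ident_at, of "1::complex" UNIV] by simp
  qed
  have tr: "\<forall>\<^sub>F z in at 1. P (h (inverse z))" if "\<forall>\<^sub>\<approx>z. P (h z)" for P
    using eventually_compose_filterlim[OF eventually_cosparse_imp_eventually_at[OF that, of 1 UNIV] lim] by simp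
  have at1: "\<forall>\<^sub>F z in at 1. P z" if "\<forall>\<^sub>\<approx>z::complex. P z" for P
    using eventually_cosparse_imp_eventually_at[OF that, of 1 UNIV] by simp
  have contr: False if "\<forall>\<^sub>F z in at (1::complex). P z" "\<forall>\<^sub>F z in at 1. \<not> P z" for P
  proof -
    have "\<forall>\<^sub>F z in at (1::complex). False" using that by eventually_elim auto
    then show False by simp
  qed
  have d1: "(\<forall>\<^sub>\<approx>z. h z = 0) \<or> (\<forall>\<^sub>\<approx>z. h z \<noteq> 0)"
    using meromorphic_imp_constant_or_avoid[OF h] by auto
  have d2: "(\<forall>\<^sub>\<approx>z. h (inverse z) = 0) \<or> (\<forall>\<^sub>\<approx>z. h (inverse z) \<noteq> 0)"
    using meromorphic_imp_constant_or_avoid[OF hi] by auto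
  have no: "\<not> ((\<forall>\<^sub>\<approx>z. h z = 0) \<and> (\<forall>\<^sub>\<approx>z. h (inverse z) \<noteq> 0))"
    using contr[OF tr[of "\<lambda>x. x = 0"] at1[of "\<lambda>z. h (inverse z) \<noteq> 0"]] by auto
  have no2: "\<not> ((\<forall>\<^sub>\<approx>z. h z \<noteq> 0) \<and> (\<forall>\<^sub>\<approx>z. h (inverse z) = 0))"
    using contr[OF at1[of "\<lambda>z. h (inverse z) = 0"] tr[of "\<lambda>x. x \<noteq> 0"]] by auto
  have no3: "\<not> ((\<forall>\<^sub>\<approx>z. h z \<noteq> 0) \<and> (\<forall>\<^sub>\<approx>z. h z = 0))"
    using contr[OF at1[of "\<lambda>z. h z = 0"] at1[of "\<lambda>z. h z \<noteq> 0"]] by auto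
  have no4: "\<not> ((\<forall>\<^sub>\<approx>z. h (inverse z) \<noteq> 0) \<and> (\<forall>\<^sub>\<approx>z. h (inverse z) = 0))"
    using contr[OF at1[of "\<lambda>z. h (inverse z) = 0"] at1[of "\<lambda>z. h (inverse z) \<noteq> 0"]] by auto
  show "(\<forall>\<^sub>\<approx>z. h (inverse z) = 0) \<longleftrightarrow> (\<forall>\<^sub>\<approx>z. h z = 0)" using d1 d2 no no2 by argo
  show "(\<forall>\<^sub>\<approx>z. h (inverse z) \<noteq> 0) \<longleftrightarrow> (\<forall>\<^sub>\<approx>z. h z \<noteq> 0)" using d1 d2 no no2 no3 no4 by argo
qed

text \<open>Meromorphy of the composites with \<open>inverse\<close> says that \<open>f\<close> and
  \<open>g\<close> are meromorphic on the sphere. The pullback is then a holomorphic differential on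
  the sphere, where 0 is the only one.\<close>

theorem regular_form_vanishes_rational:
  assumes reg: "regular_form P1 P2 Q" and cm: "curve_map P1 P2 f g UNIV"
    and fi: "(\<lambda>z. f (inverse z)) meromorphic_on UNIV" and gi: "(\<lambda>z. g (inverse z)) meromorphic_on UNIV"
  shows "\<forall>\<^sub>\<approx>z. Q (f z) (g z) * deriv f z = 0"
proof -
  define f' g' where "f' = (\<lambda>z. f (inverse z))" and "g' = (\<lambda>z. g (inverse z))"
  have f: "f meromorphic_on UNIV" and g: "g meromorphic_on UNIV"
    using cm by (auto simp: curve_map_def)
  have nz: "\<forall>\<^sub>\<approx>w. poly (pderiv P2) (g w) \<noteq> 0" "\<forall>\<^sub>\<approx>w. poly (pderiv P1) (f w) \<noteq> 0"
    and rel: "\<forall>\<^sub>\<approx>w. poly P1 (f w) - poly P2 (g w) = 0"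
    using cm by (auto simp: curve_map_def elim: eventually_mono)
  have 1: "\<forall>\<^sub>\<approx>w. poly (pderiv P2) (g' w) \<noteq> 0" unfolding g'_def
    using meromorphic_inversion_eq_0_iff(2)[OF meromorphic_on_poly[OF g] meromorphic_on_poly[OF gi]] nz(1)
    by blast
  have 2: "\<forall>\<^sub>\<approx>w. poly (pderiv P1) (f' w) \<noteq> 0" unfolding f'_def
    using meromorphic_inversion_eq_0_iff(2)[OF meromorphic_on_poly[OF f] meromorphic_on_poly[OF fi]] nz(2)
    by blast
  have "(\<forall>\<^sub>\<approx>w. poly P1 (f' w) - poly P2 (g' w) = 0) \<longleftrightarrow> (\<forall>\<^sub>\<approx>w. poly P1 (f w) - poly P2 (g w) = 0)"
    unfolding f'_def g'_def
    by (rule meromorphic_inversion_eq_0_iff(1)[of "\<lambda>w. poly P1 (f w) - poly P2 (g w)"])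
       (intro meromorphic_intros f g fi gi)+
  then have "\<forall>\<^sub>\<approx>w. poly P1 (f' w) - poly P2 (g' w) = 0" using rel by blast
  with 1 2 have "\<forall>\<^sub>\<approx>w. poly P1 (f' w) = poly P2 (g' w) \<and> poly (pderiv P1) (f' w) \<noteq> 0 \<and> poly (pderiv P2) (g' w) \<noteq> 0"
    by eventually_elim simp
  then have cm': "curve_map P1 P2 f' g' UNIV"
    using fi gi by (simp add: curve_map_def f'_def g'_def)
  define E where "E = curve_form P2 Q f g"
  define E' where "E' = curve_form P2 Q f' g'"
  define F where "F = remove_sings E"
  have F: "F holomorphic_on UNIV" unfolding F_def E_def by (rule curve_form_extends[OF reg cm])
  have FE: "\<forall>\<^sub>\<approx>w. F w = E w"
    unfolding F_def E_def by (intro eventually_remove_sings_eq curve_form_meromorphic[OF reg cm])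
  obtain B where B: "\<forall>\<^sub>F w in at 0. norm (E' w) \<le> B"
    using curve_form_locally_bounded[OF reg curve_map_subset[OF cm' subset_UNIV], where z = 0 and r = 1]
    unfolding E'_def by auto
  have "\<forall>\<^sub>\<approx>w. f' analytic_on {w}" using fi unfolding f'_def by (rule meromorphic_on_imp_analytic_cosparse)
  then have an: "\<forall>\<^sub>F w in at 0. f' analytic_on {w}"
    using eventually_cosparse_imp_eventually_at[of _ UNIV 0 UNIV] by simp
  have "\<forall>\<^sub>F w in at 0. norm (E (inverse w)) \<le> B * norm w ^ 2"
    using B an eventually_neq_at_within[of "0::complex" 0]
  proof eventually_elim
    case (elim w)
    have eq: "f = (\<lambda>z. f' (inverse z))" by (auto simp: f'_def)
    have df: "(f' has_field_derivative deriv f' w) (at w)"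
      using elim(2) by (simp add: analytic_on_imp_differentiable_at DERIV_deriv_iff_field_differentiable)
    have "((\<lambda>z. f' (inverse z)) has_field_derivative deriv f' w * (- (inverse (inverse w) ^ Suc (Suc 0)))) (at (inverse w))"
      by (rule DERIV_chain2[OF _ DERIV_inverse]) (use df elim(3) in auto)
    then have "deriv f (inverse w) = - deriv f' w * w^2"
      by (subst eq, intro DERIV_imp_deriv) (simp add: power2_eq_square)
    \<comment> \<open>The substitution \<open>z = inverse w\<close> turns \<open>dz\<close> into
      \<open>- dw / w^2\<close>, so boundedness of \<open>E'\<close> near 0 means that
      \<open>E\<close> decays like the inverse square at infinity.\<close>
    then have "E (inverse w) = - E' w * w^2"
      by (simp add: E_def E'_def curve_form_def f'_def g'_def)
    then have "norm (E (inverse w)) = norm (E' w) * norm w ^ 2" by (simp add: norm_mult norm_power)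
    also have "\<dots> \<le> B * norm w ^ 2" using elim(1) by (intro mult_right_mono) auto
    finally show ?case .
  qed
  then obtain d where d: "d > 0" "\<And>w. w \<noteq> 0 \<Longrightarrow> norm w < d \<Longrightarrow> norm (E (inverse w)) \<le> B * norm w ^ 2"
    unfolding eventually_at by (auto simp: dist_norm)
  define A where "A = {w::complex. norm w > 1 / d}"
  have A: "open A" unfolding A_def by (intro open_Collect_less continuous_intros)
  have "\<forall>\<^sub>\<approx>w\<in>A. F w * w^2 \<in> cball 0 B"
  proof -
    have "\<forall>\<^sub>\<approx>w\<in>A. w \<in> A" by (rule eventually_in_cosparse[OF order_refl A])
    with cosparse_ball_mono[OF FE subset_UNIV] show ?thesis
    proof eventually_elim
      case (elim w)
      have nw: "norm w > 1 / d" using elim(2) by (simp add: A_def)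
      moreover have "1 / d > 0" using d by simp
      ultimately have w0: "norm w > 0" by linarith
      have "inverse (norm w) < d" using nw w0 d(1) by (simp add: inverse_eq_divide mult.commute divide_less_eq)
      then have "norm (inverse w) < d" by (simp only: norm_inverse)
      then have "norm (E (inverse (inverse w))) \<le> B * norm (inverse w) ^ 2" using w0 by (intro d(2)) auto
      then have "norm (F w) \<le> B / norm w ^ 2" using elim(1) by (simp add: norm_inverse power_inverse divide_inverse)
      then show ?case using w0 by (simp add: norm_mult norm_power field_simps)
    qed
  qed
  then have bd: "F w * w^2 \<in> cball 0 B" if "w \<in> A" for w
    by (rule continuous_cosparse_closed[rotated 2])
       (use that A in \<open>auto intro!: continuous_intros holomorphic_on_imp_continuous_on[OF holomorphic_on_subset[OF F]]\<close>)
  have "(F \<longlongrightarrow> 0) at_infinity"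
  proof (rule Lim_null_comparison)
    show "\<forall>\<^sub>F w in at_infinity. norm (F w) \<le> norm (of_real B * inverse (w * w))"
    proof (rule eventually_at_infinityI)
      fix w :: complex assume "norm w \<ge> 1 / d + 1"
      moreover have "1 / d > 0" using d by simp
      ultimately have "norm w > 1 / d" "norm w > 0" by linarith+
      then have w: "w \<in> A" "w \<noteq> 0" by (auto simp: A_def)
      have "norm (F w) * norm w ^ 2 \<le> B" using bd[OF w(1)] by (simp add: norm_mult norm_power)
      then have "norm (F w) \<le> B / norm w ^ 2" using w by (simp add: field_simps)
      also have "\<dots> \<le> \<bar>B\<bar> / norm w ^ 2" by (intro divide_right_mono) auto
      finally show "norm (F w) \<le> norm (of_real B * inverse (w * w))"
        by (simp add: norm_mult norm_inverse divide_inverse power2_eq_square)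
    qed
    have "((\<lambda>w. of_real B * (inverse w * inverse w)) \<longlongrightarrow> of_real B * (0 * 0)) (at_infinity :: complex filter)"
      by (intro tendsto_mult tendsto_const tendsto_inverse_0)
    then show "((\<lambda>w. norm (of_real B * inverse (w * w) :: complex)) \<longlongrightarrow> 0) at_infinity"
      by (intro tendsto_norm_zero) simp
  qed
  then have F0: "F w = 0" for w by (rule Liouville_weak_0[OF F])
  have "\<forall>\<^sub>\<approx>w. E w = 0" using FE by eventually_elim (simp add: F0)
  with nz(1) show ?thesis by eventually_elim (auto simp: E_def curve_form_def)
qed

subsection \<open>Local regularity of forms\<close>

lemma eventually_nhds_PairD:
  fixes x0 y0 :: complex
  assumes "\<forall>\<^sub>F q in nhds (x0, y0). R (fst q) (snd q)"
  obtains \<epsilon> where "\<epsilon> > 0" "\<And>x y. x \<in> ball x0 \<epsilon> \<Longrightarrow> y \<in> ball y0 \<epsilon> \<Longrightarrow> R x y"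
proof -
  obtain d where d: "d > 0" "\<And>q. dist q (x0, y0) < d \<Longrightarrow> R (fst q) (snd q)"
    using assms unfolding eventually_nhds_metric by blast
  show ?thesis
  proof (rule that[of "d/2"])
    fix x y assume "x \<in> ball x0 (d/2)" "y \<in> ball y0 (d/2)"
    moreover have "dist (x, y) (x0, y0) \<le> dist x x0 + dist y y0"
      by (simp add: dist_Pair_Pair sqrt_sum_squares_le_sum)
    ultimately have "dist (x, y) (x0, y0) < d" by (simp add: dist_commute)
    then show "R x y" using d(2)[of "(x, y)"] by simp
  qed (use d in auto)
qed

lemma curve_relation_deriv:
  assumes "f holomorphic_on ball z \<rho>" "g holomorphic_on ball z \<rho>" "\<rho> > 0"
    and rel: "\<And>w. w \<in> ball z \<rho> \<Longrightarrow> poly P1 (f w) = poly P2 (g w)"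
  shows "poly (pderiv P1) (f z) * deriv f z = poly (pderiv P2) (g z) * deriv g z"
proof -
  have z: "z \<in> ball z \<rho>" using assms by simp
  have "((\<lambda>w. poly P1 (f w)) has_field_derivative poly (pderiv P1) (f z) * deriv f z) (at z)"
    by (rule DERIV_chain2[OF poly_DERIV holomorphic_derivI[OF assms(1) open_ball z]])
  moreover have "((\<lambda>w. poly P2 (g w)) has_field_derivative poly (pderiv P2) (g z) * deriv g z) (at z)"
    by (rule DERIV_chain2[OF poly_DERIV holomorphic_derivI[OF assms(2) open_ball z]])
  then have "((\<lambda>w. poly P1 (f w)) has_field_derivative poly (pderiv P2) (g z) * deriv g z) (at z)"
    by (rule has_field_derivative_transform_within_open[OF _ open_ball z]) (simp add: rel)
  ultimately show ?thesis by (rule DERIV_unique)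
qed

lemma deriv_bound_ball_ball:
  assumes "f holomorphic_on ball z \<rho>" "\<rho> > 0" "\<And>w. w \<in> ball z \<rho> \<Longrightarrow> f w \<in> ball c \<epsilon>"
  shows "\<rho> * norm (deriv f z) \<le> 2 * (norm c + \<epsilon>)"
proof -
  have "norm (deriv f z) \<le> 2 * (norm c + \<epsilon>) / \<rho>"
  proof (rule deriv_bound_ball[OF assms(1,2)])
    fix w assume "w \<in> ball z \<rho>"
    then have "norm (f w - c) < \<epsilon>" using assms(3) by (auto simp: dist_norm norm_minus_commute)
    then show "norm (f w) \<le> norm c + \<epsilon>" using norm_triangle_sub[of "f w" c] by simp
  qed
  then show ?thesis using assms(2) by (simp add: field_simps)
qed

text \<open>When \<open>Q / P2'\<close> is bounded along the curve, the form is a bounded multiple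
  of \<open>deriv f\<close>, and \<open>f\<close> itself, bounded near \<open>x0\<close>, is the
  function to which Cauchy's estimate applies.\<close>

lemma regular_at_right:
  assumes "\<forall>\<^sub>F q in nhds (x0, y0). poly P1 (fst q) = poly P2 (snd q) \<longrightarrow>
     norm (Q (fst q) (snd q)) \<le> C * norm (poly (pderiv P2) (snd q))"
  shows "regular_at P1 P2 Q x0 y0"
proof -
  obtain \<epsilon> where \<epsilon>: "\<epsilon> > 0" and Q: "\<And>x y. x \<in> ball x0 \<epsilon> \<Longrightarrow> y \<in> ball y0 \<epsilon> \<Longrightarrow> poly P1 x = poly P2 y \<longrightarrow> 
     norm (Q x y) \<le> C * norm (poly (pderiv P2) y)"
    by (rule eventually_nhds_PairD[OF assms]) (rule that; blast)
  show ?thesis unfolding regular_at_def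
  proof (rule exI[of _ \<epsilon>], rule conjI, rule \<epsilon>, rule exI[of _ "\<bar>C\<bar> * (2 * (norm x0 + \<epsilon>))"], intro allI impI)
    fix z \<rho> f g
    assume \<rho>: "0 < (\<rho>::real)" and f: "f holomorphic_on ball z \<rho>" and g: "g holomorphic_on ball z \<rho>"
      and v: "\<forall>w\<in>ball z \<rho>. f w \<in> ball x0 \<epsilon> \<and> g w \<in> ball y0 \<epsilon> \<and> poly P1 (f w) = poly P2 (g w)"
    have z: "z \<in> ball z \<rho>" using \<rho> by simp
    have "norm (Q (f z) (g z)) \<le> C * norm (poly (pderiv P2) (g z))" using Q v z by blast
    also have "\<dots> \<le> \<bar>C\<bar> * norm (poly (pderiv P2) (g z))" by (intro mult_right_mono) auto
    finally have 1: "norm (Q (f z) (g z)) \<le> \<bar>C\<bar> * norm (poly (pderiv P2) (g z))" .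
    have 2: "\<rho> * norm (deriv f z) \<le> 2 * (norm x0 + \<epsilon>)"
      by (rule deriv_bound_ball_ball[OF f \<rho>]) (use v in auto)
    have "\<rho> * norm (Q (f z) (g z) * deriv f z) = norm (Q (f z) (g z)) * (\<rho> * norm (deriv f z))"
      by (simp add: norm_mult)
    also have "\<dots> \<le> (\<bar>C\<bar> * norm (poly (pderiv P2) (g z))) * (2 * (norm x0 + \<epsilon>))"
      by (rule mult_mono[OF 1 2]) (use \<rho> in auto)
    finally show "\<rho> * norm (Q (f z) (g z) * deriv f z) \<le> \<bar>C\<bar> * (2 * (norm x0 + \<epsilon>)) * norm (poly (pderiv P2) (g z))"
      by (simp add: mult_ac)
  qed
qed

text \<open>Differentiating the equation of the curve gives \<open>P1'(x) dx = P2'(y) dy\<close>,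
  which turns \<open>Q dx / P2'(y)\<close> into \<open>Q dy / P1'(x)\<close>: the two coordinates
  may be interchanged.\<close>

lemma regular_at_swap:
  assumes "regular_at P2 P1 (\<lambda>y x. Q x y) y0 x0"
  shows "regular_at P1 P2 Q x0 y0"
proof -
  obtain \<epsilon> C where \<epsilon>: "\<epsilon> > 0" and C: "\<forall>z \<rho> f g. 0 < \<rho> \<longrightarrow>
     f holomorphic_on ball z \<rho> \<longrightarrow> g holomorphic_on ball z \<rho> \<longrightarrow>
     (\<forall>w\<in>ball z \<rho>. f w \<in> ball y0 \<epsilon> \<and> g w \<in> ball x0 \<epsilon> \<and> poly P2 (f w) = poly P1 (g w)) \<longrightarrow>
     poly (pderiv P2) (f z) \<noteq> 0 \<longrightarrow> poly (pderiv P1) (g z) \<noteq> 0 \<longrightarrow>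
     \<rho> * norm (Q (g z) (f z) * deriv f z) \<le> C * norm (poly (pderiv P1) (g z))"
    using assms unfolding regular_at_def by (elim exE conjE) (rule that)
  show ?thesis unfolding regular_at_def
  proof (rule exI[of _ \<epsilon>], rule conjI, rule \<epsilon>, rule exI[of _ C], intro allI impI)
    fix z \<rho> f g
    assume \<rho>: "0 < (\<rho>::real)" and f: "f holomorphic_on ball z \<rho>" and g: "g holomorphic_on ball z \<rho>"
      and v: "\<forall>w\<in>ball z \<rho>. f w \<in> ball x0 \<epsilon> \<and> g w \<in> ball y0 \<epsilon> \<and> poly P1 (f w) = poly P2 (g w)"
      and nz: "poly (pderiv P1) (f z) \<noteq> 0" "poly (pderiv P2) (g z) \<noteq> 0"
    have "\<rho> * norm (Q (f z) (g z) * deriv g z) \<le> C * norm (poly (pderiv P1) (f z))"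
      by (rule C[rule_format, OF \<rho> g f _ nz(2,1)]) (use v in auto)
    then have "norm (poly (pderiv P2) (g z)) * (\<rho> * norm (Q (f z) (g z) * deriv g z))
        \<le> norm (poly (pderiv P2) (g z)) * (C * norm (poly (pderiv P1) (f z)))"
      by (intro mult_left_mono) auto
    also have "norm (poly (pderiv P2) (g z)) * (\<rho> * norm (Q (f z) (g z) * deriv g z)) =
        \<rho> * norm (Q (f z) (g z)) * norm (poly (pderiv P2) (g z) * deriv g z)"
      by (simp add: norm_mult)
    also have "poly (pderiv P2) (g z) * deriv g z = poly (pderiv P1) (f z) * deriv f z"
      by (rule curve_relation_deriv[OF f g \<rho>, symmetric]) (use v in auto)
    finally have "norm (poly (pderiv P1) (f z)) * (\<rho> * norm (Q (f z) (g z) * deriv f z))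
        \<le> norm (poly (pderiv P1) (f z)) * (C * norm (poly (pderiv P2) (g z)))"
      by (simp add: norm_mult mult_ac)
    then show "\<rho> * norm (Q (f z) (g z) * deriv f z) \<le> C * norm (poly (pderiv P2) (g z))"
      using nz by simp
  qed
qed

lemma eventually_nhds_swap:
  fixes x0 y0 :: complex
  assumes "\<forall>\<^sub>F q in nhds (x0, y0). R (fst q) (snd q)"
  shows "\<forall>\<^sub>F q in nhds (y0, x0). R (snd q) (fst q)"
proof -
  have "((\<lambda>q. (snd q, fst q)) \<longlongrightarrow> (snd (y0, x0), fst (y0, x0))) (nhds (y0, x0))"
    by (intro tendsto_intros filterlim_ident)
  then have "filterlim (\<lambda>q. (snd q, fst q)) (nhds (x0, y0)) (nhds (y0, x0))" by simp
  from eventually_compose_filterlim[OF assms this] show ?thesis by simp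
qed

lemma regular_at_times:
  assumes "regular_at P1 P2 Q x0 y0"
  shows "regular_at P1 P2 (\<lambda>x y. x * Q x y) x0 y0"
proof -
  obtain \<epsilon> C where \<epsilon>: "\<epsilon> > 0" and C: "\<forall>z \<rho> f g. 0 < \<rho> \<longrightarrow>
     f holomorphic_on ball z \<rho> \<longrightarrow> g holomorphic_on ball z \<rho> \<longrightarrow>
     (\<forall>w\<in>ball z \<rho>. f w \<in> ball x0 \<epsilon> \<and> g w \<in> ball y0 \<epsilon> \<and> poly P1 (f w) = poly P2 (g w)) \<longrightarrow>
     poly (pderiv P1) (f z) \<noteq> 0 \<longrightarrow> poly (pderiv P2) (g z) \<noteq> 0 \<longrightarrow>
     \<rho> * norm (Q (f z) (g z) * deriv f z) \<le> C * norm (poly (pderiv P2) (g z))"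
    using assms unfolding regular_at_def by (elim exE conjE) (rule that)
  show ?thesis unfolding regular_at_def
  proof (rule exI[of _ \<epsilon>], rule conjI, rule \<epsilon>, rule exI[of _ "(norm x0 + \<epsilon>) * \<bar>C\<bar>"], intro allI impI)
    fix z \<rho> f g
    assume \<rho>: "0 < (\<rho>::real)" and f: "f holomorphic_on ball z \<rho>" and g: "g holomorphic_on ball z \<rho>"
      and v: "\<forall>w\<in>ball z \<rho>. f w \<in> ball x0 \<epsilon> \<and> g w \<in> ball y0 \<epsilon> \<and> poly P1 (f w) = poly P2 (g w)"
      and nz: "poly (pderiv P1) (f z) \<noteq> 0" "poly (pderiv P2) (g z) \<noteq> 0"
    have "norm (f z - x0) < \<epsilon>" using v \<rho> by (auto simp: dist_norm norm_minus_commute)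
    then have 1: "norm (f z) \<le> norm x0 + \<epsilon>" using norm_triangle_sub[of "f z" x0] by simp
    have "\<rho> * norm (Q (f z) (g z) * deriv f z) \<le> C * norm (poly (pderiv P2) (g z))"
      by (rule C[rule_format, OF \<rho> f g _ nz]) (use v in auto)
    also have "\<dots> \<le> \<bar>C\<bar> * norm (poly (pderiv P2) (g z))" by (intro mult_right_mono) auto
    finally have 2: "\<rho> * norm (Q (f z) (g z) * deriv f z) \<le> \<bar>C\<bar> * norm (poly (pderiv P2) (g z))" .
    have "norm (f z) * (\<rho> * norm (Q (f z) (g z) * deriv f z)) \<le> (norm x0 + \<epsilon>) * (\<bar>C\<bar> * norm (poly (pderiv P2) (g z)))"
      by (rule mult_mono[OF 1 2]) (use \<rho> \<epsilon> in auto)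
    then show "\<rho> * norm (f z * Q (f z) (g z) * deriv f z) \<le> (norm x0 + \<epsilon>) * \<bar>C\<bar> * norm (poly (pderiv P2) (g z))"
      by (simp add: norm_mult mult_ac)
  qed
qed

lemma isCont_poly_fst: "isCont (\<lambda>q::complex \<times> complex. poly p (fst q)) q0"
  and isCont_poly_snd: "isCont (\<lambda>q::complex \<times> complex. poly p (snd q)) q0"
  by (intro continuous_intros)+

lemma isCont_imp_eventually_nhds_le:
  fixes h :: "complex \<times> complex \<Rightarrow> complex"
  assumes "isCont h q0" shows "\<forall>\<^sub>F q in nhds q0. norm (h q) \<le> norm (h q0) + 1"
proof -
  have "(h \<longlongrightarrow> h q0) (nhds q0)" using assms by (simp add: continuous_at tendsto_at_iff_tendsto_nhds)
  then have "((\<lambda>q. norm (h q)) \<longlongrightarrow> norm (h q0)) (nhds q0)" by (rule tendsto_norm)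
  from order_tendstoD(2)[OF this, of "norm (h q0) + 1"] show ?thesis by (auto elim: eventually_mono)
qed

lemma isCont_imp_eventually_nhds_ge:
  fixes h :: "complex \<times> complex \<Rightarrow> complex"
  assumes "isCont h q0" "h q0 \<noteq> 0" shows "\<forall>\<^sub>F q in nhds q0. norm (h q) \<ge> norm (h q0) / 2"
proof -
  have "(h \<longlongrightarrow> h q0) (nhds q0)" using assms by (simp add: continuous_at tendsto_at_iff_tendsto_nhds)
  then have "((\<lambda>q. norm (h q)) \<longlongrightarrow> norm (h q0)) (nhds q0)" by (rule tendsto_norm)
  from order_tendstoD(1)[OF this, of "norm (h q0) / 2"] show ?thesis using assms(2) by (auto elim: eventually_mono)
qed

lemma regular_at_noncritical_right:
  assumes Q: "isCont (\<lambda>q. Q (fst q) (snd q)) (x0, y0)" and y0: "poly (pderiv P2) y0 \<noteq> 0"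
  shows "regular_at P1 P2 Q x0 y0"
proof (rule regular_at_right)
  define B where "B = norm (Q x0 y0) + 1"
  define b where "b = norm (poly (pderiv P2) y0) / 2"
  have b: "b > 0" using y0 by (simp add: b_def)
  have B: "B > 0" by (simp add: B_def add_nonneg_pos)
  have ge: "\<forall>\<^sub>F q in nhds (x0, y0). norm (poly (pderiv P2) (snd q)) \<ge> b"
    using isCont_imp_eventually_nhds_ge[OF isCont_poly_snd[where p = "pderiv P2" and ?q0.0 = "(x0, y0)"]] y0
    by (simp add: b_def)
  show "\<forall>\<^sub>F q in nhds (x0, y0). poly P1 (fst q) = poly P2 (snd q) \<longrightarrow>
     norm (Q (fst q) (snd q)) \<le> B / b * norm (poly (pderiv P2) (snd q))"
    using isCont_imp_eventually_nhds_le[OF Q] ge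
  proof (eventually_elim)
    case (elim q)
    then have 1: "norm (Q (fst q) (snd q)) \<le> B" and 2: "b \<le> norm (poly (pderiv P2) (snd q))"
      by (auto simp: B_def)
    have "B / b * b \<le> B / b * norm (poly (pderiv P2) (snd q))"
      using 2 b B by (intro mult_left_mono) auto
    then show ?case using 1 b by simp
  qed
qed

lemma isCont_swap:
  fixes Q :: "complex \<Rightarrow> complex \<Rightarrow> complex"
  assumes "isCont (\<lambda>q. Q (fst q) (snd q)) (x0, y0)"
  shows "isCont (\<lambda>q. Q (snd q) (fst q)) (y0, x0)"
proof -
  have "isCont (\<lambda>q::complex \<times> complex. (snd q, fst q)) (y0, x0)" by (intro continuous_intros)
  from isCont_o2[OF this, of "\<lambda>q. Q (fst q) (snd q)"] show ?thesis using assms by simp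
qed

lemma regular_at_noncritical_left:
  assumes Q: "isCont (\<lambda>q. Q (fst q) (snd q)) (x0, y0)" and "poly (pderiv P1) x0 \<noteq> 0"
  shows "regular_at P1 P2 Q x0 y0"
  by (rule regular_at_swap, rule regular_at_noncritical_right) (intro isCont_swap[OF Q] assms)+

lemma eventually_nhds_norm_fst:
  fixes x0 y0 :: complex
  assumes "e > 0" shows "\<forall>\<^sub>F q in nhds (x0, y0). norm (fst q - x0) < e"
proof -
  have "((\<lambda>q. fst q) \<longlongrightarrow> fst (x0, y0)) (nhds (x0, y0))" by (intro tendsto_intros filterlim_ident)
  from tendstoD[OF this assms] show ?thesis by (simp add: dist_norm)
qed

lemma pderiv_power_form:
  "poly (pderiv ([:p0:] + [:-x0, 1:] ^ Suc j * U)) x = (x - x0) ^ j * (of_nat (Suc j) * poly U x + (x - x0) * poly (pderiv U) x)"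
  for x :: complex
proof -
  define X where "X = [:-x0, 1:] ^ Suc j"
  have X: "poly X x = (x - x0) ^ Suc j" unfolding X_def poly_power by simp
  have dX: "poly (pderiv X) x = of_nat (Suc j) * (x - x0) ^ j"
    unfolding X_def pderiv_power_Suc by (simp add: pderiv_pCons)
  have "poly (pderiv ([:p0:] + X * U)) x = poly X x * poly (pderiv U) x + poly U x * poly (pderiv X) x"
    by (simp add: pderiv_add pderiv_mult)
  also have "\<dots> = (x - x0) ^ j * (of_nat (Suc j) * poly U x + (x - x0) * poly (pderiv U) x)"
    unfolding X dX by (simp add: algebra_simps)
  finally show ?thesis by (simp only: X_def)
qed

lemma pderiv_power_form_lower:
  fixes x0 y0 :: complex
  assumes P: "P = [:p0:] + [:-y0, 1:] ^ Suc j * U" and U: "poly U y0 \<noteq> 0"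
  shows "\<forall>\<^sub>F q in nhds (x0, y0). norm (snd q - y0) ^ j * (norm (poly U y0) / 2) \<le> norm (poly (pderiv P) (snd q))"
proof -
  define W where "W = smult (of_nat (Suc j)) U + [:-y0, 1:] * pderiv U"
  have W0: "poly W y0 = of_nat (Suc j) * poly U y0" by (simp add: W_def)
  then have "poly W y0 \<noteq> 0" using U by (simp del: of_nat_Suc)
  then have "\<forall>\<^sub>F q in nhds (x0, y0). norm (poly W (snd q)) \<ge> norm (poly W y0) / 2"
    using isCont_imp_eventually_nhds_ge[OF isCont_poly_snd[where p = W and ?q0.0 = "(x0, y0)"]] by simp
  then show ?thesis
  proof eventually_elim
    case (elim q)
    have "norm (poly U y0) = 1 * norm (poly U y0)" by simp
    also have "\<dots> \<le> real (Suc j) * norm (poly U y0)" by (intro mult_right_mono) auto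
    also have "\<dots> = norm (poly W y0)" by (simp only: W0 norm_mult norm_of_nat)
    finally have "norm (poly U y0) / 2 \<le> norm (poly W (snd q))" using elim by simp
    then have "norm (snd q - y0) ^ j * (norm (poly U y0) / 2) \<le> norm (snd q - y0) ^ j * norm (poly W (snd q))"
      by (intro mult_left_mono) auto
    moreover have "poly (pderiv P) (snd q) = (snd q - y0) ^ j * poly W (snd q)"
      unfolding P pderiv_power_form by (simp add: W_def algebra_simps)
    ultimately show ?case by (simp only: norm_mult norm_power)
  qed
qed

lemma regular_at_linear_right:
  assumes P2: "P2 = [:p0:] + [:-y0, 1:] ^ 2 * V" and V: "poly V y0 \<noteq> 0"
    and Q: "\<forall>\<^sub>F q in nhds (x0, y0). poly P1 (fst q) = poly P2 (snd q) \<longrightarrow> norm (Q (fst q) (snd q)) \<le> K * norm (snd q - y0)"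
  shows "regular_at P1 P2 Q x0 y0"
proof (rule regular_at_right)
  define b where "b = norm (poly V y0) / 2"
  have b: "b > 0" using V by (simp add: b_def)
  have "\<forall>\<^sub>F q in nhds (x0, y0). norm (snd q - y0) * b \<le> norm (poly (pderiv P2) (snd q))"
    using pderiv_power_form_lower[of P2 p0 y0 1 V x0] P2 V by (simp add: b_def numeral_2_eq_2)
  with Q show "\<forall>\<^sub>F q in nhds (x0, y0). poly P1 (fst q) = poly P2 (snd q) \<longrightarrow>
     norm (Q (fst q) (snd q)) \<le> \<bar>K\<bar> / b * norm (poly (pderiv P2) (snd q))"
  proof eventually_elim
    case (elim q)
    show ?case
    proof
      assume "poly P1 (fst q) = poly P2 (snd q)"
      then have "norm (Q (fst q) (snd q)) \<le> K * norm (snd q - y0)" using elim by blast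
      also have "\<dots> \<le> \<bar>K\<bar> * norm (snd q - y0)" by (intro mult_right_mono) auto
      also have "\<dots> \<le> \<bar>K\<bar> * (norm (poly (pderiv P2) (snd q)) / b)"
        using elim(2) b by (intro mult_left_mono) (auto simp: field_simps)
      finally show "norm (Q (fst q) (snd q)) \<le> \<bar>K\<bar> / b * norm (poly (pderiv P2) (snd q))" by simp
    qed
  qed
qed

lemma regular_at_linear_left:
  assumes P1: "P1 = [:p0:] + [:-x0, 1:] ^ 2 * U" and U: "poly U x0 \<noteq> 0"
    and Q: "\<forall>\<^sub>F q in nhds (x0, y0). poly P1 (fst q) = poly P2 (snd q) \<longrightarrow> norm (Q (fst q) (snd q)) \<le> K * norm (fst q - x0)"
  shows "regular_at P1 P2 Q x0 y0"
proof (rule regular_at_swap, rule regular_at_linear_right[OF P1 U])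
  show "\<forall>\<^sub>F q in nhds (y0, x0). poly P2 (fst q) = poly P1 (snd q) \<longrightarrow> norm (Q (snd q) (fst q)) \<le> K * norm (snd q - x0)"
    using eventually_nhds_swap[OF Q] by eventually_elim simp
qed

text \<open>The moduli of the two sides of \<open>(x - x0)^j U = (y - y0)^l V\<close> are compared.
  The constant is taken at least 1 so that \<open>C \<le> C ^ j\<close> is available when roots are
  extracted.\<close>

lemma curve_power_compare:
  fixes x0 y0 :: complex
  assumes P1: "P1 = [:p0:] + [:-x0, 1:] ^ j * U" and U: "poly U x0 \<noteq> 0"
    and P2: "P2 = [:p0:] + [:-y0, 1:] ^ l * V"
  obtains C where "C \<ge> 1" "\<forall>\<^sub>F q in nhds (x0, y0). poly P1 (fst q) = poly P2 (snd q) \<longrightarrow>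
     norm (fst q - x0) ^ j \<le> C * norm (snd q - y0) ^ l"
proof -
  define u v where "u = norm (poly U x0) / 2" and "v = norm (poly V y0) + 1"
  have u: "u > 0" using U by (simp add: u_def)
  have v: "v > 0" by (simp add: v_def add_nonneg_pos)
  have 1: "\<forall>\<^sub>F q in nhds (x0, y0). norm (poly U (fst q)) \<ge> u"
    using isCont_imp_eventually_nhds_ge[OF isCont_poly_fst[where p = U and ?q0.0 = "(x0, y0)"]] U
    by (simp add: u_def)
  have 2: "\<forall>\<^sub>F q in nhds (x0, y0). norm (poly V (snd q)) \<le> v"
    using isCont_imp_eventually_nhds_le[OF isCont_poly_snd[where p = V and ?q0.0 = "(x0, y0)"]]
    by (simp add: v_def)
  have "\<forall>\<^sub>F q in nhds (x0, y0). poly P1 (fst q) = poly P2 (snd q) \<longrightarrow>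
     norm (fst q - x0) ^ j \<le> max 1 (v / u) * norm (snd q - y0) ^ l"
    using 1 2
  proof eventually_elim
    case (elim q)
    show ?case
    proof
      assume "poly P1 (fst q) = poly P2 (snd q)"
      then have eq: "(fst q - x0) ^ j * poly U (fst q) = (snd q - y0) ^ l * poly V (snd q)"
        by (simp add: P1 P2 algebra_simps)
      have "norm (fst q - x0) ^ j * u \<le> norm (fst q - x0) ^ j * norm (poly U (fst q))"
        using elim by (intro mult_left_mono) auto
      also have "\<dots> = norm ((fst q - x0) ^ j * poly U (fst q))" by (simp add: norm_mult norm_power)
      also have "\<dots> = norm (snd q - y0) ^ l * norm (poly V (snd q))"
        unfolding eq by (simp add: norm_mult norm_power)
      also have "\<dots> \<le> norm (snd q - y0) ^ l * v" using elim by (intro mult_left_mono) auto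
      finally have "norm (fst q - x0) ^ j \<le> v / u * norm (snd q - y0) ^ l" using u by (simp add: field_simps)
      also have "\<dots> \<le> max 1 (v / u) * norm (snd q - y0) ^ l" by (intro mult_right_mono) auto
      finally show "norm (fst q - x0) ^ j \<le> max 1 (v / u) * norm (snd q - y0) ^ l" .
    qed
  qed
  then show ?thesis by (rule that[rotated]) simp
qed

lemma curve_same_power_compare:
  fixes x0 y0 :: complex
  assumes P1: "P1 = [:p0:] + [:-x0, 1:] ^ j * U" and U: "poly U x0 \<noteq> 0"
    and P2: "P2 = [:p0:] + [:-y0, 1:] ^ j * V" and j: "j > 0"
  obtains C where "C \<ge> 1" "\<forall>\<^sub>F q in nhds (x0, y0). poly P1 (fst q) = poly P2 (snd q) \<longrightarrow>
     norm (fst q - x0) \<le> C * norm (snd q - y0)"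
proof -
  obtain C where C: "C \<ge> 1" "\<forall>\<^sub>F q in nhds (x0, y0). poly P1 (fst q) = poly P2 (snd q) \<longrightarrow>
     norm (fst q - x0) ^ j \<le> C * norm (snd q - y0) ^ j"
    using curve_power_compare[OF P1 U P2] by blast
  have "\<forall>\<^sub>F q in nhds (x0, y0). poly P1 (fst q) = poly P2 (snd q) \<longrightarrow>
     norm (fst q - x0) \<le> C * norm (snd q - y0)"
    using C(2)
  proof eventually_elim
    case (elim q)
    have "C ^ 1 \<le> C ^ j" using C j by (intro power_increasing) auto
    then have "C * norm (snd q - y0) ^ j \<le> (C * norm (snd q - y0)) ^ j"
      by (simp add: power_mult_distrib mult_right_mono)
    then have "poly P1 (fst q) = poly P2 (snd q) \<longrightarrow> norm (fst q - x0) ^ j \<le> (C * norm (snd q - y0)) ^ j"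
      using elim by auto
    then show ?case using C j by (auto intro: power_le_imp_le_base[where n = "j - 1"] simp: Suc_diff_1)
  qed
  with C that show thesis by blast
qed

text \<open>On both branches of a node \<open>x - x0\<close> is bounded by a multiple of
  \<open>y - y0\<close>, and \<open>P2'\<close> is comparable to \<open>y - y0\<close>. Vanishing of
  \<open>Q\<close> at the node is therefore enough, and the branches need not be separated.\<close>

lemma regular_at_node:
  assumes P1: "P1 = [:p0:] + [:-x0, 1:] ^ 2 * U" and U: "poly U x0 \<noteq> 0"
    and P2: "P2 = [:p0:] + [:-y0, 1:] ^ 2 * V" and V: "poly V y0 \<noteq> 0"
    and Q: "\<forall>\<^sub>F q in nhds (x0, y0). poly P1 (fst q) = poly P2 (snd q) \<longrightarrow> norm (Q (fst q) (snd q)) \<le> K * (norm (fst q - x0) + norm (snd q - y0))"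
  shows "regular_at P1 P2 Q x0 y0"
proof -
  obtain C where C: "C \<ge> 1" "\<forall>\<^sub>F q in nhds (x0, y0). poly P1 (fst q) = poly P2 (snd q) \<longrightarrow>
     norm (fst q - x0) \<le> C * norm (snd q - y0)"
    using curve_same_power_compare[OF P1 U P2] by auto
  have "\<forall>\<^sub>F q in nhds (x0, y0). poly P1 (fst q) = poly P2 (snd q) \<longrightarrow> norm (Q (fst q) (snd q)) \<le> (\<bar>K\<bar> * (C + 1)) * norm (snd q - y0)"
    using Q C(2)
  proof eventually_elim
    case (elim q)
    show ?case
    proof
      assume "poly P1 (fst q) = poly P2 (snd q)"
      then have 1: "norm (Q (fst q) (snd q)) \<le> K * (norm (fst q - x0) + norm (snd q - y0))"
        and 2: "norm (fst q - x0) \<le> C * norm (snd q - y0)" using elim by auto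
      note 1
      also have "K * (norm (fst q - x0) + norm (snd q - y0)) \<le> \<bar>K\<bar> * (norm (fst q - x0) + norm (snd q - y0))"
        by (intro mult_right_mono) auto
      also have "\<dots> \<le> \<bar>K\<bar> * (C * norm (snd q - y0) + norm (snd q - y0))"
        using 2 by (intro mult_left_mono) auto
      finally show "norm (Q (fst q) (snd q)) \<le> (\<bar>K\<bar> * (C + 1)) * norm (snd q - y0)" by (simp add: algebra_simps)
    qed
  qed
  then show ?thesis by (rule regular_at_linear_right[OF P2 V])
qed

text \<open>Here \<open>x\<close>, \<open>h\<close> stand for \<open>f z - x0\<close>,
  \<open>g z - y0\<close>, and \<open>f\<close>, \<open>g\<close> for the two derivatives, so the
  fraction is the derivative of the cusp parameter. The bracket on the right tends to
  \<open>3 A / (2 U) - A / U = A / (2 U)\<close>, which is nonzero because the exponents 3 and 2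
  differ.\<close>

lemma cusp_identity:
  fixes x h s2 s3 u a f g :: complex
  assumes rel: "x^2 * s3 * f = h * s2 * g" and eq: "x^3 * a = h^2 * u"
    and nz: "x \<noteq> 0" "h \<noteq> 0" "s2 \<noteq> 0" "u \<noteq> 0"
  shows "h * ((g * x - h * f) / x^2) = f * x * (s3 / s2 - a / u)"
proof -
  have "(h * (g * x - h * f)) * (s2 * u) = (f * x * (s3 * u - a * s2)) * x^2"
    using rel eq by algebra
  then have "(h * (g * x - h * f)) / x^2 = (f * x * (s3 * u - a * s2)) / (s2 * u)"
    using nz by (simp add: frac_eq_eq)
  moreover have "s3 / s2 - a / u = (s3 * u - a * s2) / (s2 * u)"
    using nz by (simp add: diff_frac_eq)
  ultimately show ?thesis by simp
qed

text \<open>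
  At a cusp \<open>(x - x0)\<^sup>3 A = (y - y0)\<^sup>2 U\<close> the quotient \<open>(y - y0) / (x - x0)\<close> is a local
  parameter; its derivative controls the form.
\<close>

lemma regular_at_cusp:
  assumes P1: "P1 = [:p0:] + [:-x0, 1:] ^ 3 * A" and A: "poly A x0 \<noteq> 0"
    and P2: "P2 = [:p0:] + [:-y0, 1:] ^ 2 * U" and U: "poly U y0 \<noteq> 0"
    and Q: "\<forall>\<^sub>F q in nhds (x0, y0). norm (Q (fst q) (snd q)) \<le> K * (norm (fst q - x0) + norm (snd q - y0))"
  shows "regular_at P1 P2 Q x0 y0"
proof -
  define S3 where "S3 = smult 3 A + [:-x0, 1:] * pderiv A"
  define S2 where "S2 = smult 2 U + [:-y0, 1:] * pderiv U"
  have S3x: "poly S3 x = 3 * poly A x + (x - x0) * poly (pderiv A) x" for x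
    by (simp add: S3_def algebra_simps)
  have S2x: "poly S2 y = 2 * poly U y + (y - y0) * poly (pderiv U) y" for y
    by (simp add: S2_def algebra_simps)
  have exps: "Suc 2 = 3" "Suc 1 = 2" by simp_all
  have "P1 = [:p0:] + [:-x0, 1:] ^ Suc 2 * A" "P2 = [:p0:] + [:-y0, 1:] ^ Suc 1 * U"
    unfolding exps by (fact P1, fact P2)
  then have dP1: "poly (pderiv P1) x = (x - x0)^2 * poly S3 x"
    and dP2: "poly (pderiv P2) y = (y - y0) * poly S2 y" for x y
    by (simp_all only: pderiv_power_form S3x S2x of_nat_Suc) simp_all
  have S20: "poly S2 y0 = 2 * poly U y0" and S30: "poly S3 x0 = 3 * poly A x0" by (simp_all add: S2_def S3_def)
  define k where "k = (\<lambda>q. poly S3 (fst q) / poly S2 (snd q) - poly A (fst q) / poly U (snd q))"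
  have k0: "k (x0, y0) = poly A x0 / (2 * poly U y0)" using U by (simp add: k_def S20 S30 field_simps)
  define \<kappa> where "\<kappa> = norm (k (x0, y0)) / 2"
  have \<kappa>: "\<kappa> > 0" using A U by (simp add: \<kappa>_def k0)
  have "isCont k (x0, y0)" unfolding k_def
    by (intro isCont_diff isCont_divide isCont_poly_fst isCont_poly_snd) (use U S20 in auto)
  then have k: "\<forall>\<^sub>F q in nhds (x0, y0). norm (k q) \<ge> \<kappa>"
    using isCont_imp_eventually_nhds_ge[of "(x0, y0)" k] \<kappa> by (auto simp: \<kappa>_def)
  define u where "u = norm (poly U y0) / 2"
  have u: "u > 0" using U by (simp add: u_def)
  have evU: "\<forall>\<^sub>F q in nhds (x0, y0). norm (poly U (snd q)) \<ge> u"
    using isCont_imp_eventually_nhds_ge[OF isCont_poly_snd[where p = U and ?q0.0 = "(x0, y0)"]] U by (simp add: u_def)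
  have evS: "\<forall>\<^sub>F q in nhds (x0, y0). norm (poly S2 (snd q)) \<ge> 2 * u"
    using isCont_imp_eventually_nhds_ge[OF isCont_poly_snd[where p = S2 and ?q0.0 = "(x0, y0)"]] U
    by (simp add: u_def S20 norm_mult)
  obtain C where C: "C \<ge> 1" "\<forall>\<^sub>F q in nhds (y0, x0). poly P2 (fst q) = poly P1 (snd q) \<longrightarrow>
     norm (fst q - y0) ^ 2 \<le> C * norm (snd q - x0) ^ 3"
    using curve_power_compare[OF P2 U P1] by blast
  have evC: "\<forall>\<^sub>F q in nhds (x0, y0). poly P2 (snd q) = poly P1 (fst q) \<longrightarrow> norm (snd q - y0) ^ 2 \<le> C * norm (fst q - x0) ^ 3"
    by (rule eventually_nhds_swap[of "\<lambda>y x. poly P2 y = poly P1 x \<longrightarrow> norm (y - y0) ^ 2 \<le> C * norm (x - x0) ^ 3", OF C(2)])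
  define R where "R = (\<lambda>x y. norm (k (x, y)) \<ge> \<kappa> \<and> norm (poly U y) \<ge> u \<and> norm (poly S2 y) \<ge> 2 * u \<and>
      (poly P2 y = poly P1 x \<longrightarrow> norm (y - y0) ^ 2 \<le> C * norm (x - x0) ^ 3) \<and>
      norm (Q x y) \<le> K * (norm (x - x0) + norm (y - y0)) \<and> norm (x - x0) < 1)"
  have "\<forall>\<^sub>F q in nhds (x0, y0). R (fst q) (snd q)"
    using k evU evS evC Q eventually_nhds_norm_fst[OF zero_less_one, of x0 y0] unfolding R_def by eventually_elim simp
  then obtain \<epsilon> where \<epsilon>: "\<epsilon> > 0" and R: "\<And>x y. x \<in> ball x0 \<epsilon> \<Longrightarrow> y \<in> ball y0 \<epsilon> \<Longrightarrow> R x y"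
    by (rule eventually_nhds_PairD) (rule that; blast)
  note near = R[unfolded R_def]
  show ?thesis unfolding regular_at_def
  proof (rule exI[of _ \<epsilon>], rule conjI, rule \<epsilon>, rule exI[of _ "\<bar>K\<bar> * (1 + C) * (2 * C) / (\<kappa> * (2 * u))"], intro allI impI)
    fix z \<rho> f g
    assume \<rho>: "0 < (\<rho>::real)" and f: "f holomorphic_on ball z \<rho>" and g: "g holomorphic_on ball z \<rho>"
      and v: "\<forall>w\<in>ball z \<rho>. f w \<in> ball x0 \<epsilon> \<and> g w \<in> ball y0 \<epsilon> \<and> poly P1 (f w) = poly P2 (g w)"
      and nz: "poly (pderiv P1) (f z) \<noteq> 0" "poly (pderiv P2) (g z) \<noteq> 0"
    have z: "z \<in> ball z \<rho>" using \<rho> by simp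
    define \<xi> \<eta> where "\<xi> = f z - x0" and "\<eta> = g z - y0"
    have \<xi>0: "\<xi> \<noteq> 0" and \<eta>0: "\<eta> \<noteq> 0" and S2z: "poly S2 (g z) \<noteq> 0"
      using nz by (auto simp: dP1 dP2 \<xi>_def \<eta>_def)
    \<comment> \<open>The square of \<open>g w - y0\<close> is at most \<open>C\<close> times the
      cube of \<open>f w - x0\<close>. The latter is below 1 in modulus, so one of its powers can be
      given away, which shows that the quotient \<open>\<tau>\<close> is bounded.\<close>
    have le: "norm (g w - y0) \<le> C * norm (f w - x0)" if "w \<in> ball z \<rho>" for w
    proof (rule power2_le_imp_le)
      have 1: "norm (g w - y0) ^ 2 \<le> C * norm (f w - x0) ^ 3" and 2: "norm (f w - x0) < 1"
        using near[of "f w" "g w"] v that by auto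
      note 1
      also have "C * norm (f w - x0) ^ 3 \<le> C * norm (f w - x0) ^ 2"
        using 2 C(1) by (intro mult_left_mono power_decreasing) auto
      also have "\<dots> \<le> C ^ 2 * norm (f w - x0) ^ 2"
        using C(1) by (intro mult_right_mono) (auto simp: power2_eq_square)
      finally show "(norm (g w - y0))\<^sup>2 \<le> (C * norm (f w - x0))\<^sup>2" by (simp add: power_mult_distrib)
    qed (use C(1) in auto)
    define \<tau> where "\<tau> = (\<lambda>w. (g w - y0) / (f w - x0))"
    define T where "T = remove_sings \<tau>"
    have \<tau>C: "norm (\<tau> w) \<le> C" if "w \<in> ball z \<rho>" for w
    proof (cases "f w = x0")
      case False
      then show ?thesis using le[OF that] by (simp add: \<tau>_def norm_divide divide_le_eq)
    qed (use C in \<open>simp add: \<tau>_def\<close>)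
    have \<tau>: "\<tau> meromorphic_on ball z \<rho>" unfolding \<tau>_def
      using f g by (intro meromorphic_intros analytic_on_imp_meromorphic_on) (auto simp: analytic_on_open)
    have inb: "\<forall>\<^sub>\<approx>w\<in>ball z \<rho>. w \<in> ball z \<rho>" by (rule eventually_in_cosparse) auto
    then have "\<forall>\<^sub>\<approx>w\<in>ball z \<rho>. norm (\<tau> w) \<le> C" by eventually_elim (rule \<tau>C)
    then have T: "T holomorphic_on ball z \<rho>" unfolding T_def
      by (intro meromorphic_locally_bounded_removable[OF \<tau>]) (auto simp: eventually_cosparse_open_eq)
    have "\<forall>\<^sub>\<approx>w\<in>ball z \<rho>. T w \<in> cball 0 C"
      using inb eventually_remove_sings_eq[OF \<tau>] by eventually_elim (use \<tau>C in \<open>auto simp: T_def\<close>)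
    then have TC: "T w \<in> cball 0 C" if "w \<in> ball z \<rho>" for w
      by (rule continuous_cosparse_closed[rotated 2])
         (use that T in \<open>auto intro: holomorphic_on_imp_continuous_on\<close>)
    have dT: "norm (deriv T z) \<le> 2 * C / \<rho>"
      by (rule deriv_bound_ball[OF T \<rho>]) (use TC in auto)
    have fz: "(f has_field_derivative deriv f z) (at z)" and gz: "(g has_field_derivative deriv g z) (at z)"
      using f g z by (auto intro: holomorphic_derivI)
    have "f analytic_on {z}" "g analytic_on {z}" using f g z analytic_at by blast+
    then have "\<tau> analytic_on {z}" unfolding \<tau>_def using \<xi>0 by (intro analytic_intros) (auto simp: \<xi>_def)
    then have "deriv T z = deriv \<tau> z" unfolding T_def by simp
    also have "\<dots> = (deriv g z * \<xi> - \<eta> * deriv f z) / \<xi>^2"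
      unfolding \<tau>_def using \<xi>0
      by (intro DERIV_imp_deriv) (auto intro!: derivative_eq_intros fz gz simp: \<xi>_def \<eta>_def power2_eq_square)
    finally have dT': "deriv T z = (deriv g z * \<xi> - \<eta> * deriv f z) / \<xi>^2" .
    have rel: "\<xi>^2 * poly S3 (f z) * deriv f z = \<eta> * poly S2 (g z) * deriv g z"
      using curve_relation_deriv[OF f g \<rho>, of P1 P2] v by (simp add: dP1 dP2 \<xi>_def \<eta>_def)
    have eq: "\<xi>^3 * poly A (f z) = \<eta>^2 * poly U (g z)"
    proof -
      have "poly P1 (f z) = poly P2 (g z)" using v z by blast
      then show ?thesis by (simp add: P1 P2 \<xi>_def \<eta>_def algebra_simps)
    qed
    have nr: "norm (k (f z, g z)) \<ge> \<kappa>" "norm (poly U (g z)) \<ge> u" "norm (poly S2 (g z)) \<ge> 2 * u"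
      "norm (Q (f z) (g z)) \<le> K * (norm \<xi> + norm \<eta>)"
      using near[of "f z" "g z"] v z by (auto simp: \<xi>_def \<eta>_def)
    have Uz: "poly U (g z) \<noteq> 0" using nr(2) u by auto
    \<comment> \<open>Because \<open>k\<close> stays away from 0, \<open>deriv f z * \<xi>\<close>
      is at most a multiple of \<open>\<eta> / \<rho>\<close>. The form supplies a factor of size
      \<open>\<xi>\<close>, and \<open>P2'\<close> has the size of \<open>\<eta>\<close>.\<close>
    have "\<eta> * deriv T z = deriv f z * \<xi> * k (f z, g z)"
      unfolding dT' k_def fst_conv snd_conv by (rule cusp_identity[OF rel eq \<xi>0 \<eta>0 S2z Uz])
    then have "norm (deriv f z) * norm \<xi> * norm (k (f z, g z)) = norm \<eta> * norm (deriv T z)"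
      by (metis norm_mult)
    moreover have "norm (deriv f z) * norm \<xi> * \<kappa> \<le> norm (deriv f z) * norm \<xi> * norm (k (f z, g z))"
      using nr(1) by (intro mult_left_mono) auto
    moreover have "norm \<eta> * norm (deriv T z) \<le> norm \<eta> * (2 * C / \<rho>)"
      using dT by (intro mult_left_mono) auto
    ultimately have "norm (deriv f z) * norm \<xi> * \<kappa> \<le> norm \<eta> * (2 * C / \<rho>)" by linarith
    then have 1: "norm (deriv f z) * norm \<xi> \<le> norm \<eta> * (2 * C / \<rho>) / \<kappa>"
      by (simp only: pos_le_divide_eq[OF \<kappa>])
    have "norm (Q (f z) (g z)) \<le> \<bar>K\<bar> * (norm \<xi> + norm \<eta>)"
      using nr(4) by (rule order_trans) (intro mult_right_mono, auto)
    also have "\<dots> \<le> \<bar>K\<bar> * ((1 + C) * norm \<xi>)"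
      using le[OF z] by (intro mult_left_mono) (auto simp: \<xi>_def \<eta>_def algebra_simps)
    finally have "norm (Q (f z) (g z)) * norm (deriv f z) \<le> \<bar>K\<bar> * ((1 + C) * norm \<xi>) * norm (deriv f z)"
      by (intro mult_right_mono) auto
    then have "norm (Q (f z) (g z) * deriv f z) \<le> \<bar>K\<bar> * (1 + C) * (norm (deriv f z) * norm \<xi>)"
      by (simp only: norm_mult mult_ac)
    also have "\<dots> \<le> \<bar>K\<bar> * (1 + C) * (norm \<eta> * (2 * C / \<rho>) / \<kappa>)"
      using 1 C(1) by (intro mult_left_mono) auto
    finally have "\<rho> * norm (Q (f z) (g z) * deriv f z) \<le> \<rho> * (\<bar>K\<bar> * (1 + C) * (norm \<eta> * (2 * C / \<rho>) / \<kappa>))"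
      using \<rho> by (intro mult_left_mono) auto
    also have "\<dots> = \<bar>K\<bar> * (1 + C) * (2 * C) / \<kappa> * norm \<eta>" using \<rho> by simp
    also have "norm \<eta> \<le> norm (poly (pderiv P2) (g z)) / (2 * u)"
    proof -
      have "norm \<eta> * (2 * u) \<le> norm \<eta> * norm (poly S2 (g z))" using nr(3) by (intro mult_left_mono) auto
      moreover have "0 < 2 * u" using u by simp
      ultimately show ?thesis by (simp only: pos_le_divide_eq dP2 norm_mult \<eta>_def)
    qed
    finally show "\<rho> * norm (Q (f z) (g z) * deriv f z) \<le> \<bar>K\<bar> * (1 + C) * (2 * C) / (\<kappa> * (2 * u)) * norm (poly (pderiv P2) (g z))"
      using C(1) \<kappa> by (simp add: mult_left_mono divide_right_mono)
  qed
qed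

section \<open>Behaviour at infinity and the degree bound\<close>

lemma poly_growth:
  fixes p :: "complex poly"
  assumes "p \<noteq> 0"
  shows "\<exists>M\<ge>1. \<exists>l>0. \<exists>u>0. \<forall>x. norm x \<ge> M \<longrightarrow> l * norm x ^ degree p \<le> norm (poly p x) \<and> norm (poly p x) \<le> u * norm x ^ degree p"
  using assms
proof (induction p)
  case 0
  then show ?case by simp
next
  case (pCons a p)
  show ?case
  proof (cases "p = 0")
    case True
    then have "a \<noteq> 0" using pCons.prems by auto
    then show ?thesis using True by (intro exI[of _ 1] conjI exI[of _ "norm a"]) auto
  next
    case False
    then obtain M l u where M: "M \<ge> 1" "l > 0" "u > 0" and
      b: "\<And>x. norm x \<ge> M \<Longrightarrow> l * norm x ^ degree p \<le> norm (poly p x) \<and> norm (poly p x) \<le> u * norm x ^ degree p"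
      using pCons.IH by blast
    have deg: "degree (pCons a p) = Suc (degree p)" using False by simp
    define N where "N = max M (2 * norm a / l)"
    have b': "l/2 * norm x ^ Suc (degree p) \<le> norm (poly (pCons a p) x) \<and> norm (poly (pCons a p) x) \<le> (norm a + u) * norm x ^ Suc (degree p)"
      if x: "norm x \<ge> N" for x
    proof
      have xM: "norm x \<ge> M" "norm x \<ge> 1" using x M by (auto simp: N_def)
      have p1: "1 \<le> norm x ^ degree p" using xM by simp
      have "norm a \<le> l/2 * norm x" using x M by (simp add: N_def field_simps)
      also have "\<dots> \<le> l/2 * norm x * norm x ^ degree p"
        using mult_left_mono[OF p1, of "l/2 * norm x"] M by simp
      finally have 1: "norm a \<le> l/2 * norm x ^ Suc (degree p)" by simp
      have "norm x * (l * norm x ^ degree p) \<le> norm x * norm (poly p x)" using b[OF xM(1)] by (intro mult_left_mono) auto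
      then have "l * norm x ^ Suc (degree p) \<le> norm (x * poly p x)" by (simp add: norm_mult mult_ac)
      also have "\<dots> \<le> norm (a + x * poly p x) + norm a"
        using norm_triangle_ineq4[of "a + x * poly p x" a] by simp
      finally have "l * norm x ^ Suc (degree p) - l/2 * norm x ^ Suc (degree p) \<le> norm (a + x * poly p x)" using 1 by linarith
      then show "l/2 * norm x ^ Suc (degree p) \<le> norm (poly (pCons a p) x)" by (simp add: algebra_simps)
      have "norm (poly (pCons a p) x) \<le> norm a + norm x * norm (poly p x)"
        using norm_triangle_ineq[of a "x * poly p x"] by (simp add: norm_mult)
      also have "\<dots> \<le> norm a * norm x ^ Suc (degree p) + norm x * (u * norm x ^ degree p)"
      proof (intro add_mono mult_left_mono)
        have "1 \<le> norm x ^ Suc (degree p)" by (rule one_le_power) (rule xM)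
        from mult_left_mono[OF this, of "norm a"] show "norm a \<le> norm a * norm x ^ Suc (degree p)" by simp
      qed (use b[OF xM(1)] in auto)
      finally show "norm (poly (pCons a p) x) \<le> (norm a + u) * norm x ^ Suc (degree p)" by (simp add: algebra_simps)
    qed
    show ?thesis unfolding deg
    proof (rule exI[of _ N], rule conjI)
      show "N \<ge> 1" using M by (simp add: N_def)
      show "\<exists>l>0. \<exists>u>0. \<forall>x. N \<le> norm x \<longrightarrow> l * norm x ^ Suc (degree p) \<le> norm (poly (pCons a p) x) \<and> norm (poly (pCons a p) x) \<le> u * norm x ^ Suc (degree p)"
        by (rule exI[of _ "l/2"], rule conjI, use M in simp, rule exI[of _ "norm a + u"], rule conjI, use M in \<open>simp add: add_nonneg_pos\<close>) (use b' in blast)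
    qed
  qed
qed

text \<open>Equal degrees give \<open>norm x \<le> c * norm y\<close> far out on the curve. Then
  \<open>x^2 * Q\<close> has order at most \<open>norm y ^ (d + 2)\<close> and \<open>P2'\<close>
  has order \<open>norm y ^ (n - 1)\<close>, so \<open>d \<le> n - 3\<close> is the condition at
  infinity.\<close>

lemma regular_formI:
  assumes P1: "degree P1 = n" and P2: "degree P2 = n" and d: "d + 3 \<le> n"
    and reg: "\<And>x y. poly P1 x = poly P2 y \<Longrightarrow> regular_at P1 P2 Q x y"
    and mero: "\<And>f g A. f meromorphic_on A \<Longrightarrow> g meromorphic_on A \<Longrightarrow> (\<lambda>z. Q (f z) (g z)) meromorphic_on A"
    and K: "\<And>x y. norm (Q x y) \<le> K * (1 + norm x + norm y) ^ d"
  shows "regular_form P1 P2 Q"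
proof -
  have n: "n > 0" using d by simp
  have "P1 \<noteq> 0" "P2 \<noteq> 0" using P1 P2 n by auto
  then obtain M1 l1 u1 where 1: "M1 \<ge> 1" "l1 > 0" and b1: "\<And>x. norm x \<ge> M1 \<Longrightarrow> l1 * norm x ^ n \<le> norm (poly P1 x)"
    using poly_growth[of P1] P1 by metis
  obtain M2 u2 where 2: "M2 \<ge> 1" "u2 > 0" and b2: "\<And>x. norm x \<ge> M2 \<Longrightarrow> norm (poly P2 x) \<le> u2 * norm x ^ n"
    using poly_growth[of P2] P2 \<open>P2 \<noteq> 0\<close> by metis
  have dp: "degree (pderiv P2) = n - 1" by (simp add: degree_pderiv P2)
  have "pderiv P2 \<noteq> 0" using n P2 by (simp add: pderiv_eq_0_iff)
  then obtain M3 l3 where 3: "M3 \<ge> 1" "l3 > 0" and b3: "\<And>x. norm x \<ge> M3 \<Longrightarrow> l3 * norm x ^ (n - 1) \<le> norm (poly (pderiv P2) x)"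
    using poly_growth[of "pderiv P2"] dp by metis
  define N where "N = max M2 M3"
  have "compact (poly P2 ` cball 0 N)" by (intro compact_continuous_image continuous_intros) auto
  then obtain B where B: "\<And>y. norm y \<le> N \<Longrightarrow> norm (poly P2 y) \<le> B"
    by (force dest!: compact_imp_bounded simp: bounded_iff)
  define M where "M = max M1 ((\<bar>B\<bar> + 1) / l1)"
  define c where "c = max 1 (u2 / l1)"
  have c: "c \<ge> 1" by (simp add: c_def)
  have "norm x ^ 2 * norm (Q x y) \<le> c^2 * (\<bar>K\<bar> * (3 * c) ^ d) / l3 * norm (poly (pderiv P2) y)"
    if eq: "poly P1 x = poly P2 y" and x: "norm x \<ge> M" for x y
  proof -
    have xM1: "norm x \<ge> M1" and x1: "norm x \<ge> 1" using x 1 by (auto simp: M_def)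
    have "norm x ^ 1 \<le> norm x ^ n" using x1 n by (intro power_increasing) auto
    then have "l1 * norm x \<le> l1 * norm x ^ n" using 1 by simp
    moreover have "\<bar>B\<bar> + 1 \<le> l1 * norm x" using x 1 by (simp add: M_def field_simps)
    ultimately have "norm (poly P2 y) > B" using b1[OF xM1] eq by auto
    then have y: "norm y > N" using B[of y] by force
    then have yM: "norm y \<ge> M2" "norm y \<ge> M3" "norm y \<ge> 1" using 2 by (auto simp: N_def)
    have "l1 * norm x ^ n \<le> u2 * norm y ^ n" using b1[OF xM1] b2[OF yM(1)] eq by simp
    then have "norm x ^ n \<le> u2 / l1 * norm y ^ n" using 1 by (simp add: field_simps)
    also have "\<dots> \<le> c * norm y ^ n" by (intro mult_right_mono) (auto simp: c_def)
    also have "\<dots> \<le> c ^ n * norm y ^ n"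
      using power_increasing[of 1 n c] c n by (intro mult_right_mono) auto
    finally have "norm x ^ n \<le> (c * norm y) ^ n" by (simp add: power_mult_distrib)
    then have xy: "norm x \<le> c * norm y"
      using c n by (auto intro: power_le_imp_le_base[where n = "n - 1"])
    have cy: "norm y \<le> c * norm y" using c by (simp add: mult_le_cancel_right1)
    have "norm (Q x y) \<le> K * (1 + norm x + norm y) ^ d" by (rule K)
    also have "\<dots> \<le> \<bar>K\<bar> * (1 + norm x + norm y) ^ d" by (intro mult_right_mono) auto
    also have "\<dots> \<le> \<bar>K\<bar> * (3 * (c * norm y)) ^ d"
      using xy cy yM(3) by (intro mult_left_mono power_mono) auto
    finally have Q: "norm (Q x y) \<le> \<bar>K\<bar> * (3 * (c * norm y)) ^ d" .
    have "norm x ^ 2 * norm (Q x y) \<le> (c * norm y) ^ 2 * (\<bar>K\<bar> * (3 * (c * norm y)) ^ d)"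
      by (rule mult_mono[OF _ Q]) (use xy in \<open>auto intro: power_mono\<close>)
    also have "\<dots> = c^2 * (\<bar>K\<bar> * (3 * c) ^ d) * norm y ^ (2 + d)"
      by (simp add: power_mult_distrib power_add power2_eq_square mult_ac)
    also have "\<dots> \<le> c^2 * (\<bar>K\<bar> * (3 * c) ^ d) * norm y ^ (n - 1)"
      using yM(3) d c by (intro mult_left_mono power_increasing) auto
    also have "\<dots> \<le> c^2 * (\<bar>K\<bar> * (3 * c) ^ d) * (norm (poly (pderiv P2) y) / l3)"
      using b3[OF yM(2)] 3 c by (intro mult_left_mono) (auto simp: field_simps)
    finally show ?thesis by simp
  qed
  then show ?thesis unfolding regular_form_def using P2 n reg mero by blast
qed

section \<open>Critical points, lines and coincidences of roots under affine maps\<close>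

lemma coprime_powers_eq_1:
  fixes t :: complex
  assumes "t ^ k = 1" "t ^ m = 1" "coprime k m" "k > 0"
  shows "t = 1"
proof -
  obtain u v where uv: "k * u = m * v + 1"
    using bezout_nat[of k m] assms(3,4) by (auto simp: coprime_iff_gcd_eq_1)
  have "t ^ (k * u) = 1" by (simp add: power_mult assms(1))
  moreover have "t ^ (m * v + 1) = t" by (simp add: power_mult power_add assms(2))
  ultimately show ?thesis using uv by simp
qed

lemma simple_critical_point_form:
  fixes P :: "complex poly"
  assumes "poly (pderiv P) x0 = 0" "poly (pderiv (pderiv P)) x0 \<noteq> 0"
  obtains U where "P = [:poly P x0:] + [:-x0, 1:] ^ 2 * U" "poly U x0 \<noteq> 0"
proof -
  have "poly (P - [:poly P x0:]) x0 = 0" by simp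
  then obtain q where q: "P - [:poly P x0:] = [:-x0, 1:] * q" by (metis poly_eq_0_iff_dvd dvdE)
  have dP: "pderiv P = [:-x0, 1:] * pderiv q + q"
  proof -
    have "pderiv P = pderiv (P - [:poly P x0:])" by (simp add: pderiv_diff)
    also have "\<dots> = pderiv ([:-x0, 1:] * q)" by (simp only: q)
    also have "\<dots> = [:-x0, 1:] * pderiv q + q * pderiv [:-x0, 1:]" by (rule pderiv_mult)
    also have "pderiv [:-x0, 1:] = 1" by (simp add: pderiv_pCons)
    finally show ?thesis by simp
  qed
  then have "poly q x0 = 0" using assms(1) by simp
  then obtain U where U: "q = [:-x0, 1:] * U" by (metis poly_eq_0_iff_dvd dvdE)
  have P: "P = [:poly P x0:] + [:-x0, 1:] ^ 2 * U"
    using q unfolding U by (simp only: power2_eq_square mult.assoc diff_eq_eq add.commute)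
  have dq: "poly (pderiv q) x0 = poly U x0"
    unfolding U pderiv_mult by (simp add: pderiv_pCons)
  have "poly (pderiv (pderiv P)) x0 = 2 * poly U x0"
    unfolding dP pderiv_add pderiv_mult by (simp add: pderiv_pCons dq)
  with P assms(2) that show thesis by auto
qed

lemma line_through_two_points:
  fixes S :: "(complex \<times> complex) set"
  assumes "finite S" "card S \<le> 2"
  obtains p q s where "p \<noteq> 0 \<or> q \<noteq> 0" "\<And>x y. (x, y) \<in> S \<Longrightarrow> p * x + q * y + s = 0"
proof -
  obtain x1 y1 x2 y2 where S: "S \<subseteq> {(x1, y1), (x2, y2)}"
  proof -
    consider "card S = 0" | "card S = 1" | "card S = 2" using assms(2) by linarith
    then show thesis
    proof cases
      case 1
      then show thesis using assms(1) that by simp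
    next
      case 2
      then obtain u where "S = {u}" by (auto simp: card_1_singleton_iff)
      then show thesis using that[of "fst u" "snd u"] by auto
    next
      case 3
      then obtain u v where "S = {u, v}" by (auto simp: card_2_iff)
      then show thesis using that[of "fst u" "snd u" "fst v" "snd v"] by auto
    qed
  qed
  show thesis
  proof (cases "(x1, y1) = (x2, y2)")
    case True
    have "x = x1" if "(x, y) \<in> S" for x y using that S True by blast
    then show thesis by (intro that[of 1 0 "-x1"]) auto
  next
    case False
    show thesis
    proof (rule that[of "y2 - y1" "x1 - x2" "-((y2 - y1) * x1 + (x1 - x2) * y1)"])
      show "y2 - y1 \<noteq> 0 \<or> x1 - x2 \<noteq> 0" using False by auto
      fix x y assume "(x, y) \<in> S"
      then consider "x = x1" "y = y1" | "x = x2" "y = y2" using S by blast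
      then show "(y2 - y1) * x + (x1 - x2) * y + -((y2 - y1) * x1 + (x1 - x2) * y1) = 0"
        by cases (simp_all add: algebra_simps)
    qed
  qed
qed

text \<open>
  Two distinct circles meet in at most two points: the \<open>k\<close>-th roots of \<open>\<kappa>\<close> lie on the circle of
  radius \<open>norm v0\<close> about the origin, and \<open>v \<mapsto> c * v + d\<close> moves the centre.
\<close>
lemma card_common_roots_affine:
  fixes c d \<kappa> :: complex
  assumes c: "c \<noteq> 0" and d: "d \<noteq> 0" and k: "k > 0"
  shows "finite {v. v ^ k = \<kappa> \<and> (c * v + d) ^ k = \<kappa>} \<and> card {v. v ^ k = \<kappa> \<and> (c * v + d) ^ k = \<kappa>} \<le> 2"
proof (cases "{v. v ^ k = \<kappa> \<and> (c * v + d) ^ k = \<kappa>} = {}")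
  case True
  then show ?thesis by (simp only:) simp
next
  case False
  define S where "S = {v. v ^ k = \<kappa> \<and> (c * v + d) ^ k = \<kappa>}"
  obtain v0 where v0: "v0 \<in> S" using False by (auto simp: S_def)
  define R where "R = v0 * cnj v0"
  \<comment> \<open>If \<open>v\<close> and \<open>c * v + d\<close> both have squared modulus
    \<open>R\<close>, multiplying the second equation by \<open>v\<close> and replacing
    \<open>v * cnj v\<close> by \<open>R\<close> removes the conjugate of \<open>v\<close>. What
    remains is this quadratic in \<open>v\<close>, with leading coefficient
    \<open>c * cnj d\<close>.\<close>
  define q where "q = [:d * cnj c * R, c * cnj c * R + d * cnj d - R, c * cnj d:]"
  have nrm: "u * cnj u = R" if "u ^ k = \<kappa>" for u
  proof -
    have "norm u ^ k = norm v0 ^ k" using that v0 by (simp add: S_def norm_power[symmetric])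
    then have "norm u = norm v0" using k by (metis norm_ge_zero power_eq_imp_eq_base)
    then show ?thesis by (simp add: R_def complex_norm_square[symmetric])
  qed
  have "S \<subseteq> {x. poly q x = 0}"
  proof
    fix v assume "v \<in> S"
    then have 1: "v * cnj v = R" and 2: "(c * v + d) * (cnj c * cnj v + cnj d) = R"
      using nrm[of v] nrm[of "c * v + d"] by (auto simp: S_def)
    have "poly q v = (c * v + d) * (cnj c * R + cnj d * v) - R * v"
      by (simp add: q_def algebra_simps)
    also have "\<dots> = ((c * v + d) * (cnj c * cnj v + cnj d) - R) * v"
      by (simp add: 1[symmetric] algebra_simps)
    finally show "v \<in> {x. poly q x = 0}" using 2 by simp
  qed
  moreover have q0: "q \<noteq> 0" using c d by (simp add: q_def)
  moreover have "degree q \<le> 2" unfolding q_def by (simp add: degree_pCons_eq_if)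
  ultimately have "finite S" "card S \<le> 2"
    using finite_subset[OF _ poly_roots_finite[OF q0], of S] card_mono[OF poly_roots_finite[OF q0], of S]
      card_poly_roots_bound[OF q0] by simp_all
  then show ?thesis by (simp add: S_def)
qed

lemma cube_roots_triple:
  fixes p q r :: complex
  assumes "p ^ 3 = q ^ 3" "p ^ 3 = r ^ 3" "p \<noteq> q" "p \<noteq> r" "q \<noteq> r"
  shows "p + q + r = 0" "p^2 + p * q + q^2 = 0"
proof -
  have "(p - q) * (p^2 + p * q + q^2) = 0" using assms(1) by algebra
  then show 1: "p^2 + p * q + q^2 = 0" using assms(3) by simp
  have "(p - r) * (p^2 + p * r + r^2) = 0" using assms(2) by algebra
  then have 2: "p^2 + p * r + r^2 = 0" using assms(4) by simp
  have "(q - r) * (p + q + r) = 0" using 1 2 by algebra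
  then show "p + q + r = 0" using assms(5) by simp
qed

text \<open>The map \<open>v \<mapsto> c * v + d\<close> preserves angles. The points 0,
  \<open>p\<close>, \<open>q\<close> are the centre and two vertices of an equilateral triangle,
  with an angle of 120 degrees at 0, whose image \<open>d\<close> is a vertex. Three vertices would
  have angles of 60 degrees; and if the centre is among the image points, the wide angle sits there
  and not at \<open>d\<close>.\<close>

lemma affine_image_center_two_cube_roots:
  fixes c d p q \<kappa> :: complex
  assumes c: "c \<noteq> 0" and d: "d \<noteq> 0" and \<kappa>: "\<kappa> \<noteq> 0" and p: "p ^ 3 = \<kappa>" and q: "q ^ 3 = \<kappa>" and pq: "p \<noteq> q"
    and d3: "d ^ 3 = \<kappa>" and ip: "c * p + d = 0 \<or> (c * p + d) ^ 3 = \<kappa>" and iq: "c * q + d = 0 \<or> (c * q + d) ^ 3 = \<kappa>"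
  shows False
proof -
  have p0: "p \<noteq> 0" and q0: "q \<noteq> 0" using p q \<kappa> by auto
  have "p ^ 3 = q ^ 3" using p q by simp
  then have "(p - q) * (p^2 + p * q + q^2) = 0" by algebra
  then have e: "p^2 + p * q + q^2 = 0" using pq by simp
  have aux: False if "x^2 + x * y + y^2 = 0" "x \<noteq> 0" "y \<noteq> 0" "x \<noteq> y" "x ^ 3 = \<kappa>" "c * x + d = 0" "c * y + d = 0 \<or> (c * y + d) ^ 3 = \<kappa>" for x y
  proof -
    have dx: "d = - (c * x)" using that(6) by (simp add: eq_neg_iff_add_eq_0 add.commute)
    have "c * y + d \<noteq> 0" using c that(4) by (simp add: dx)
    then have "(c * y + d) ^ 3 = d ^ 3" using that(7) d3 by simp
    then have "c ^ 3 * ((y - x) ^ 3 + x ^ 3) = 0" unfolding dx by algebra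
    then have "(y - x) ^ 3 + x ^ 3 = 0" using c by simp
    then have "y * (2 * x + 3 * y) * x = 0 * x" using that(1) by algebra
    then have "2 * x = - 3 * y" using that(2,3) by (simp add: eq_neg_iff_add_eq_0)
    then have "7 * y^2 = 0" using that(1) by algebra
    then show False using that(3) by simp
  qed
  show False
  proof (cases "c * p + d = 0 \<or> c * q + d = 0")
    case True
    then show False using aux[of p q] aux[of q p] e p0 q0 pq p q ip iq by (auto simp: algebra_simps)
  next
    case False
    then have i: "(c * p + d) ^ 3 = \<kappa>" "(c * q + d) ^ 3 = \<kappa>" using ip iq by auto
    have ne: "d \<noteq> c * p + d" "d \<noteq> c * q + d" "c * p + d \<noteq> c * q + d" using c p0 q0 pq by auto
    have s: "d + (c * p + d) + (c * q + d) = 0" and t: "d^2 + d * (c * p + d) + (c * p + d)^2 = 0"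
      using cube_roots_triple[of d "c * p + d" "c * q + d"] i d3 ne by auto
    have "c^2 * (p * q) = 0" using s t e by algebra
    then show False using c p0 q0 by simp
  qed
qed

lemma card_le_2I:
  assumes "finite S" "\<And>x y z. x \<in> S \<Longrightarrow> y \<in> S \<Longrightarrow> z \<in> S \<Longrightarrow> x \<noteq> y \<Longrightarrow> x \<noteq> z \<Longrightarrow> y \<noteq> z \<Longrightarrow> False"
  shows "card S \<le> 2"
proof (rule ccontr)
  assume "\<not> card S \<le> 2"
  then obtain T where "T \<subseteq> S" "card T = 3" using obtain_subset_with_card_n[of 3 S] by auto
  then show False using assms(2) by (auto simp: card_3_iff)
qed

text \<open>If three points and their images both have sum 0, then \<open>3 * d = 0\<close>. For
  \<open>k = 2\<close> the set \<open>V\<close> is 0 with two opposite points, so its only triple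
  has sum 0. For \<open>k = 3\<close> the angles exclude 0 from the triple and, by the inverse map,
  from its image; both then consist of all three cube roots.\<close>

lemma card_affine_small:
  fixes c d \<kappa> :: complex
  assumes c: "c \<noteq> 0" and d: "d \<noteq> 0" and \<kappa>: "\<kappa> \<noteq> 0" and k: "k = 2 \<or> k = 3"
    and V: "V = {v. v = 0 \<or> v ^ k = \<kappa>}"
  shows "finite {v \<in> V. c * v + d \<in> V} \<and> card {v \<in> V. c * v + d \<in> V} \<le> 2"
proof -
  have "finite {v. v ^ k = \<kappa>}"
  proof -
    have "monom 1 k - [:\<kappa>:] \<noteq> 0" using k by (auto simp: poly_eq_iff coeff_pCons split: nat.splits intro!: exI[of _ k])
    from poly_roots_finite[OF this] show ?thesis by (simp add: poly_monom)
  qed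
  then have "finite V" unfolding V by (simp add: Collect_disj_eq)
  then have fin: "finite {v \<in> V. c * v + d \<in> V}" by simp
  moreover have "card {v \<in> V. c * v + d \<in> V} \<le> 2"
  proof (rule card_le_2I[OF fin])
    fix x y z assume in1: "x \<in> {v \<in> V. c * v + d \<in> V}" "y \<in> {v \<in> V. c * v + d \<in> V}" "z \<in> {v \<in> V. c * v + d \<in> V}"
      and ne: "x \<noteq> y" "x \<noteq> z" "y \<noteq> z"
    define x' y' z' where "x' = c * x + d" and "y' = c * y + d" and "z' = c * z + d"
    have inV: "x \<in> V" "y \<in> V" "z \<in> V" "x' \<in> V" "y' \<in> V" "z' \<in> V" using in1 by (auto simp: x'_def y'_def z'_def)
    have ne': "x' \<noteq> y'" "x' \<noteq> z'" "y' \<noteq> z'" using ne c by (auto simp: x'_def y'_def z'_def)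
    have contr: False if "x + y + z = 0" "x' + y' + z' = 0"
    proof -
      have "3 * d = 0" using that unfolding x'_def y'_def z'_def by algebra
      then show False using d by simp
    qed
    show False
    proof (cases "k = 2")
      case True
      have sum0: "u + v + w = 0" if "u \<in> V" "v \<in> V" "w \<in> V" "u \<noteq> v" "u \<noteq> w" "v \<noteq> w" for u v w
      proof -
        note V3 = that
        have opp: "r + s = 0" if "r^2 = \<kappa>" "s^2 = \<kappa>" "r \<noteq> s" for r s :: complex
        proof -
          have "r^2 = s^2" using that by simp
          then have "(r - s) * (r + s) = 0" by algebra
          then show ?thesis using that(3) by simp
        qed
        have m: "r = 0 \<or> r^2 = \<kappa>" if "r \<in> V" for r using that True by (simp add: V)
        consider "u = 0" | "v = 0" | "w = 0" | "u^2 = \<kappa>" "v^2 = \<kappa>" "w^2 = \<kappa>"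
          using m[OF V3(1)] m[OF V3(2)] m[OF V3(3)] by blast
        then show ?thesis
        proof cases
          case 1
          then show ?thesis using opp[of v w] m[OF V3(2)] m[OF V3(3)] V3 by simp
        next
          case 2
          then show ?thesis using opp[of u w] m[OF V3(1)] m[OF V3(3)] V3 by simp
        next
          case 3
          then show ?thesis using opp[of u v] m[OF V3(1)] m[OF V3(2)] V3 by simp
        next
          case 4
          then have "u + v = 0" "u + w = 0" using opp V3 by auto
          then show ?thesis using V3(6) by (simp add: add_eq_0_iff)
        qed
      qed
      show False using contr sum0 inV ne ne' by blast
    next
      case False
      then have k3: "k = 3" using k by simp
      have noncenter: False if "u = 0" "u \<in> V" "v \<in> V" "w \<in> V" "c' * u + d' \<in> V" "c' * v + d' \<in> V" "c' * w + d' \<in> V"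
          "u \<noteq> v" "u \<noteq> w" "v \<noteq> w" "c' \<noteq> 0" "d' \<noteq> 0" for u v w c' d'
        by (rule affine_image_center_two_cube_roots[of c' d' \<kappa> v w]) (use that \<kappa> k3 in \<open>auto simp: V\<close>)
      have inv: "(1 / c) * (c * w + d) + (- d / c) = w" for w using c by (simp add: field_simps)
      have inv': "(1 / c) * x' + (- d / c) = x" "(1 / c) * y' + (- d / c) = y" "(1 / c) * z' + (- d / c) = z"
        by (simp_all only: x'_def y'_def z'_def inv)
      have c': "1 / c \<noteq> 0" "- d / c \<noteq> 0" using c d by auto
      have n1: "x \<noteq> 0" "y \<noteq> 0" "z \<noteq> 0"
        using noncenter[of x y z c d] noncenter[of y x z c d] noncenter[of z x y c d] inV ne c d
        unfolding x'_def y'_def z'_def by blast+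
      have n2: "x' \<noteq> 0" "y' \<noteq> 0" "z' \<noteq> 0"
        using noncenter[of x' y' z' "1/c" "-d/c"] noncenter[of y' x' z' "1/c" "-d/c"] noncenter[of z' x' y' "1/c" "-d/c"]
          inV ne' c' unfolding inv' by blast+
      have "x + y + z = 0" by (rule cube_roots_triple) (use inV n1 ne k3 in \<open>auto simp: V\<close>)
      moreover have "x' + y' + z' = 0" by (rule cube_roots_triple) (use inV n2 ne' k3 in \<open>auto simp: V\<close>)
      ultimately show False by (rule contr)
    qed
  qed
  ultimately show ?thesis by blast
qed

subsection \<open>Forms on trinomial curves\<close>

lemma meromorphic_poly_nonzero_cosparse:
  assumes "f meromorphic_on UNIV" "\<not> (\<exists>k. \<forall>\<^sub>\<approx>z. f z = k)" "p \<noteq> 0"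
  shows "\<forall>\<^sub>\<approx>z. poly p (f z) \<noteq> 0"
  using meromorphic_imp_constant_or_avoid[OF meromorphic_on_poly[OF assms(1), of p], of 0]
    meromorphic_poly_eq_0_imp_const[OF assms(1,3)] assms(2) by auto

locale trinomial =
  fixes a b :: complex and n m k :: nat
  assumes a0: "a \<noteq> 0" and m1: "m \<ge> 1" and k2: "k \<ge> 2" and nmk: "n = m + k" and cop: "coprime k m"
begin

definition T :: "complex poly" where "T = monom 1 n + monom a m + [:b:]"

text \<open>At a critical point \<open>y\<close> this is the critical value minus \<open>b\<close>,
  with \<open>y ^ k\<close> eliminated by the critical equation.\<close>

definition v :: "complex \<Rightarrow> complex" where "v y = y ^ m * (a * of_nat k / of_nat n)"

text \<open>All nonzero critical points have the same \<open>k\<close>-th power, and so have their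
  values under \<open>v\<close>; this is the latter.\<close>

definition \<kappa> :: complex where "\<kappa> = (- of_nat m * a / of_nat n) ^ m * (a * of_nat k / of_nat n) ^ k"

lemma poly_T: "poly T x = x ^ n + a * x ^ m + b"
  by (simp add: T_def poly_monom)

lemma n_pos: "n > 0" "n \<ge> 3" using m1 k2 nmk by auto

lemma degree_T: "degree T = n"
proof -
  have "degree (monom a m + [:b:]) < n"
    using m1 k2 nmk by (intro degree_add_less) (auto intro: le_less_trans[OF degree_monom_le])
  then have "degree (monom 1 n + (monom a m + [:b:])) = degree (monom (1::complex) n)"
    by (intro degree_add_eq_left) (simp add: degree_monom_eq)
  then show ?thesis by (simp add: T_def degree_monom_eq add.assoc)
qed

lemma pderiv_T: "pderiv T = monom 1 (m - 1) * (monom (of_nat n) k + [:of_nat m * a:])"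
proof -
  have "pderiv T = monom (of_nat n) (n - 1) + monom (of_nat m * a) (m - 1)"
    by (simp add: T_def pderiv_add pderiv_monom)
  also have "n - 1 = (m - 1) + k" using m1 nmk by simp
  finally show ?thesis by (simp add: distrib_left mult_monom monom_0[symmetric])
qed

lemma poly_pderiv_T: "poly (pderiv T) x = x ^ (m - 1) * (of_nat n * x ^ k + of_nat m * a)"
  by (simp add: pderiv_T poly_monom)

lemma critical_nonzero_iff: "x \<noteq> 0 \<Longrightarrow> poly (pderiv T) x = 0 \<longleftrightarrow> x ^ k = - of_nat m * a / of_nat n"
proof -
  assume "x \<noteq> 0"
  then have "poly (pderiv T) x = 0 \<longleftrightarrow> of_nat n * x ^ k + of_nat m * a = 0"
    by (simp only: poly_pderiv_T mult_eq_0_iff power_eq_0_iff) simp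
  also have "\<dots> \<longleftrightarrow> x ^ k = - of_nat m * a / of_nat n"
    using n_pos(1) by (simp add: field_simps eq_neg_iff_add_eq_0)
  finally show ?thesis .
qed

lemma critical_value:
  assumes "poly (pderiv T) x = 0"
  shows "poly T x = b + v x"
proof (cases "x = 0")
  case True
  then show ?thesis using m1 n_pos(1) by (simp add: poly_T v_def power_0_left)
next
  case False
  then have xk: "x ^ k = - of_nat m * a / of_nat n" using critical_nonzero_iff assms by blast
  have "x ^ n + a * x ^ m = x ^ m * (x ^ k + a)" by (simp add: nmk power_add algebra_simps)
  also have "x ^ k + a = a * of_nat k / of_nat n"
  proof -
    have "(of_nat n :: complex) = of_nat m + of_nat k" by (simp add: nmk)
    then have "of_nat n * a - of_nat m * a = a * of_nat k" by (simp add: algebra_simps)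
    moreover have "x ^ k + a = (of_nat n * a - of_nat m * a) / of_nat n"
      using n_pos(1) by (simp add: xk diff_divide_distrib)
    ultimately show ?thesis by simp
  qed
  finally show ?thesis by (simp add: poly_T v_def)
qed

lemma v_eq_0_iff: "v x = 0 \<longleftrightarrow> x = 0"
  using m1 k2 a0 n_pos by (auto simp: v_def)

lemma kappa_nonzero: "\<kappa> \<noteq> 0"
  using m1 k2 a0 n_pos by (simp add: \<kappa>_def)

lemma v_power:
  assumes "poly (pderiv T) x = 0" "x \<noteq> 0" shows "v x ^ k = \<kappa>"
proof -
  have "v x ^ k = (x ^ k) ^ m * (a * of_nat k / of_nat n) ^ k"
    unfolding v_def power_mult_distrib by (simp only: power_mult[symmetric] mult.commute[of k m])
  then show ?thesis using critical_nonzero_iff[OF assms(2)] assms(1) by (simp add: \<kappa>_def)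
qed

text \<open>Nonzero critical points with equal values have a ratio whose \<open>k\<close>-th and
  \<open>m\<close>-th powers are 1, and coprimality leaves ratio 1. So \<open>T\<close> separates
  its critical points, and for \<open>c = 1\<close> the singular points of the curve lie on the
  diagonal.\<close>

lemma v_inj:
  assumes "poly (pderiv T) x = 0" "poly (pderiv T) y = 0" "v x = v y"
  shows "x = y"
proof (cases "x = 0 \<or> y = 0")
  case True
  then show ?thesis using assms(3) v_eq_0_iff by metis
next
  case False
  then have "x ^ k = y ^ k" using assms critical_nonzero_iff by simp
  moreover have "x ^ m = y ^ m" using assms(3) a0 k2 n_pos by (simp add: v_def)
  ultimately have "(x / y) ^ k = 1" "(x / y) ^ m = 1" using False by (simp_all add: power_divide)
  then have "x / y = 1" by (rule coprime_powers_eq_1[OF _ _ cop]) (use k2 in simp)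
  then show ?thesis using False by simp
qed

lemma critical_form:
  assumes "poly (pderiv T) x = 0" "x \<noteq> 0"
  obtains U where "T = [:poly T x:] + [:-x, 1:] ^ 2 * U" "poly U x \<noteq> 0"
proof (rule simple_critical_point_form[OF assms(1)])
  have z: "of_nat n * x ^ k + of_nat m * a = 0"
    using assms by (simp add: poly_pderiv_T)
  have "poly (pderiv (pderiv T)) x = x ^ (m - 1) * (of_nat n * (of_nat k * x ^ (k - 1)))"
    using z by (simp add: pderiv_T pderiv_mult pderiv_add pderiv_monom poly_monom pderiv_pCons mult_ac)
  then show "poly (pderiv (pderiv T)) x \<noteq> 0" using assms(2) n_pos k2 by simp
qed (use that in blast)

lemma zero_form: "T = [:b:] + [:-0, 1:] ^ m * (monom 1 k + [:a:])" "poly (monom 1 k + [:a:]) 0 \<noteq> 0"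
proof -
  have "[:-0, 1:] ^ m = monom (1::complex) m" by (simp add: monom_altdef)
  moreover have "monom 1 n = monom 1 m * monom (1::complex) k" by (simp add: mult_monom nmk)
  ultimately show "T = [:b:] + [:-0, 1:] ^ m * (monom 1 k + [:a:])"
    by (simp add: T_def distrib_left smult_monom)
  show "poly (monom 1 k + [:a:]) 0 \<noteq> 0" using a0 k2 by (simp add: poly_monom power_0_left)
qed

lemma smult_form:
  fixes P :: "complex poly"
  assumes "P = [:p0:] + [:-x, 1:] ^ j * U" "poly U x \<noteq> 0" "c \<noteq> 0"
  shows "smult c P = [:c * p0:] + [:-x, 1:] ^ j * smult c U" "poly (smult c U) x \<noteq> 0"
  using assms by (simp_all add: smult_add_right)

text \<open>With \<open>d\<close> the degree of \<open>Q\<close>, \<open>d + 4 \<le> n\<close>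
  leaves room for both \<open>Q\<close> and \<open>x * Q\<close> under the bound
  \<open>n - 3\<close>; for functions meromorphic on the sphere \<open>Q\<close> alone has to
  fit.\<close>

definition large :: "nat \<Rightarrow> (complex \<Rightarrow> complex) \<Rightarrow> (complex \<Rightarrow> complex) \<Rightarrow> bool" where
  "large d f g \<longleftrightarrow> d + 4 \<le> n \<or> d + 3 \<le> n \<and> (\<lambda>z. f (inverse z)) meromorphic_on UNIV \<and> (\<lambda>z. g (inverse z)) meromorphic_on UNIV"

text \<open>Regularity is asked for only where both coordinates are critical, at the singular points
  of \<open>T(x) = c T(y)\<close>; elsewhere one coordinate is a local parameter. The factor
  \<open>deriv f\<close> drops out because \<open>f\<close> is not constant.\<close>

lemma form_vanishes:
  assumes c: "c \<noteq> 0" and large: "large d f g"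
    and f: "f meromorphic_on UNIV" "\<not> (\<exists>k. \<forall>\<^sub>\<approx>z. f z = k)"
    and g: "g meromorphic_on UNIV" "\<not> (\<exists>k. \<forall>\<^sub>\<approx>z. g z = k)"
    and rel: "\<forall>\<^sub>\<approx>z. poly T (f z) = c * poly T (g z)"
    and cont: "\<And>x y. isCont (\<lambda>q. Q (fst q) (snd q)) (x, y)"
    and mero: "\<And>f g A. f meromorphic_on A \<Longrightarrow> g meromorphic_on A \<Longrightarrow> (\<lambda>z. Q (f z) (g z)) meromorphic_on A"
    and K: "\<And>x y. norm (Q x y) \<le> K * (1 + norm x + norm y) ^ d"
    and crit: "\<And>x y. poly (pderiv T) x = 0 \<Longrightarrow> poly (pderiv T) y = 0 \<Longrightarrow> poly T x = c * poly T y \<Longrightarrow>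
       regular_at T (smult c T) Q x y"
  shows "\<forall>\<^sub>\<approx>z. Q (f z) (g z) = 0"
proof -
  have dc: "pderiv (smult c T) = smult c (pderiv T)" by (rule pderiv_smult)
  have dT0: "pderiv T \<noteq> 0" using degree_T n_pos by (simp add: pderiv_eq_0_iff)
  have reg: "regular_at T (smult c T) Q x y" if "poly T x = poly (smult c T) y" for x y
  proof -
    consider "poly (pderiv T) x \<noteq> 0" | "poly (pderiv T) y \<noteq> 0" | "poly (pderiv T) x = 0" "poly (pderiv T) y = 0" by blast
    then show ?thesis
    proof cases
      case 1
      then show ?thesis by (intro regular_at_noncritical_left cont)
    next
      case 2
      then show ?thesis using c by (intro regular_at_noncritical_right cont) (simp add: dc)
    next
      case 3
      then show ?thesis using that by (intro crit) auto
    qed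
  qed
  have degs: "degree T = n" "degree (smult c T) = n" using degree_T c by auto
  have cm: "curve_map T (smult c T) f g UNIV"
    unfolding curve_map_def
  proof (intro conjI f g)
    show "\<forall>\<^sub>\<approx>w. poly T (f w) = poly (smult c T) (g w) \<and> poly (pderiv T) (f w) \<noteq> 0 \<and> poly (pderiv (smult c T)) (g w) \<noteq> 0"
      using rel meromorphic_poly_nonzero_cosparse[OF f dT0] meromorphic_poly_nonzero_cosparse[OF g dT0]
      by eventually_elim (use c in \<open>simp add: dc\<close>)
  qed
  have "\<forall>\<^sub>\<approx>z. Q (f z) (g z) * deriv f z = 0"
    using large unfolding large_def
  proof
    assume d: "d + 4 \<le> n"
    have "regular_form T (smult c T) Q"
      by (rule regular_formI[OF degs _ reg mero K]) (use d in auto)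
    moreover have "regular_form T (smult c T) (\<lambda>x y. x * Q x y)"
    proof (rule regular_formI[OF degs])
      show "Suc d + 3 \<le> n" using d by simp
      show "norm (x * Q x y) \<le> \<bar>K\<bar> * (1 + norm x + norm y) ^ Suc d" for x y
      proof -
        have "norm (Q x y) \<le> \<bar>K\<bar> * (1 + norm x + norm y) ^ d"
          by (rule order_trans[OF K]) (intro mult_right_mono, auto)
        then have "norm x * norm (Q x y) \<le> (1 + norm x + norm y) * (\<bar>K\<bar> * (1 + norm x + norm y) ^ d)"
          by (intro mult_mono) auto
        then show ?thesis by (simp only: norm_mult power_Suc mult_ac)
      qed
    qed (auto intro!: regular_at_times reg mero meromorphic_intros)
    ultimately show ?thesis by (rule regular_forms_vanish_meromorphic[OF _ _ cm])
  next
    assume *: "d + 3 \<le> n \<and> (\<lambda>z. f (inverse z)) meromorphic_on UNIV \<and> (\<lambda>z. g (inverse z)) meromorphic_on UNIV"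
    have "regular_form T (smult c T) Q"
      by (rule regular_formI[OF degs _ reg mero K]) (use * in auto)
    then show ?thesis by (rule regular_form_vanishes_rational[OF _ cm]) (use * in auto)
  qed
  then have "(\<forall>\<^sub>\<approx>z. Q (f z) (g z) = 0) \<or> (\<forall>\<^sub>\<approx>z. deriv f z = 0)"
    by (rule meromorphic_mult_eq_0_cosparse[rotated 4]) (auto intro!: meromorphic_intros mero f g)
  then show ?thesis using meromorphic_deriv_eq_0_imp_const[OF f(1)] f(2) by blast
qed

text \<open>The singular points are nodes \<open>(y, y)\<close> and, for \<open>m \<ge> 2\<close>,
  the origin, where \<open>T - b\<close> vanishes to order \<open>m\<close>. The factor
  \<open>x - y\<close> vanishes at all of them, and \<open>y ^ (m - 2)\<close> raises the order at
  the origin to \<open>m - 1\<close>, that of \<open>pderiv T\<close>. As \<open>Q\<close> also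
  vanishes on the diagonal, itself a component of the curve, \<open>Q (f z) (g z) = 0\<close> is no
  contradiction but the conclusion, \<open>g\<close> being nonzero.\<close>

lemma unique_of_gap_ge_3:
  assumes k3: "k \<ge> 3"
    and large: "n \<ge> 5 \<or> n = 4 \<and> (\<lambda>z. f (inverse z)) meromorphic_on UNIV \<and> (\<lambda>z. g (inverse z)) meromorphic_on UNIV"
    and f: "f meromorphic_on UNIV" "\<not> (\<exists>k. \<forall>\<^sub>\<approx>z. f z = k)"
    and g: "g meromorphic_on UNIV" "\<not> (\<exists>k. \<forall>\<^sub>\<approx>z. g z = k)"
    and rel: "\<forall>\<^sub>\<approx>z. poly T (f z) = poly T (g z)"
  shows "\<forall>\<^sub>\<approx>z. f z = g z"
proof -
  define Q where "Q = (\<lambda>x y::complex. (x - y) * y ^ (m - 2))"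
  have "\<forall>\<^sub>\<approx>z. Q (f z) (g z) = 0"
  \<comment> \<open>\<open>Suc (m - 2)\<close> is \<open>m - 1\<close>, except that truncated
    subtraction makes it 1 for \<open>m = 1\<close>, where \<open>Q\<close> is \<open>x - y\<close>.
    That case is the one that asks for \<open>n \<ge> 5\<close>, or for \<open>n = 4\<close> and
    rational functions.\<close>
  proof (rule form_vanishes[of 1 "Suc (m - 2)" f g Q 1])
    show "large (Suc (m - 2)) f g"
      using large k3 nmk m1 unfolding large_def by auto
    show "\<forall>\<^sub>\<approx>z. poly T (f z) = 1 * poly T (g z)" using rel by simp
    show "isCont (\<lambda>q. Q (fst q) (snd q)) (x, y)" for x y unfolding Q_def by (intro continuous_intros)
    show "(\<lambda>z. Q (f z) (g z)) meromorphic_on A" if "f meromorphic_on A" "g meromorphic_on A" for f g A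
      unfolding Q_def by (intro meromorphic_intros that)
    show "norm (Q x y) \<le> 1 * (1 + norm x + norm y) ^ Suc (m - 2)" for x y
    proof -
      have "norm (x - y) \<le> 1 + norm x + norm y" using norm_triangle_ineq4[of x y] by simp
      moreover have "norm y ^ (m - 2) \<le> (1 + norm x + norm y) ^ (m - 2)" by (intro power_mono) auto
      ultimately have "norm (x - y) * norm y ^ (m - 2) \<le> (1 + norm x + norm y) * (1 + norm x + norm y) ^ (m - 2)"
        by (intro mult_mono) auto
      then show ?thesis by (simp add: Q_def norm_mult norm_power)
    qed
    fix x y assume x: "poly (pderiv T) x = 0" and y: "poly (pderiv T) y = 0" and "poly T x = 1 * poly T y"
    then have "v x = v y" using critical_value by simp
    then have xy: "x = y" using v_inj x y by blast
    show "regular_at T (smult 1 T) Q x y"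
    proof (cases "y = 0")
      case True
      have m2: "m \<ge> 2"
      proof (rule ccontr)
        assume "\<not> m \<ge> 2"
        then have "m - 1 = 0" by simp
        then show False using y True a0 m1 k2 poly_pderiv_T[of y] by (simp add: power_0_left)
      qed
      define u where "u = norm (poly (monom 1 k + [:a:]) 0) / 2"
      have u: "u > 0" using zero_form(2) by (simp add: u_def)
      have "m > 0" using m1 by simp
      then obtain C where C: "C \<ge> 1" and c1: "\<forall>\<^sub>F q in nhds (0, 0). poly T (fst q) = poly T (snd q) \<longrightarrow>
         norm (fst q - 0) \<le> C * norm (snd q - 0)"
        using curve_same_power_compare[OF zero_form zero_form(1)] by blast
      have "T = [:b:] + [:-0, 1:] ^ Suc (m - 1) * (monom 1 k + [:a:])" using zero_form(1) m1 by simp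
      from pderiv_power_form_lower[OF this zero_form(2), of 0]
      have c2: "\<forall>\<^sub>F q in nhds (0::complex, 0::complex). norm (snd q) ^ (m - 1) * u \<le> norm (poly (pderiv T) (snd q))"
        by (simp add: u_def)
      have "\<forall>\<^sub>F q in nhds (0, 0). poly T (fst q) = poly T (snd q) \<longrightarrow>
          norm (Q (fst q) (snd q)) \<le> (C + 1) / u * norm (poly (pderiv T) (snd q))"
        using c1 c2
      proof eventually_elim
        case (elim q)
        show ?case
        proof
          assume "poly T (fst q) = poly T (snd q)"
          then have "norm (fst q) \<le> C * norm (snd q)" using elim by simp
          then have "norm (fst q - snd q) \<le> (C + 1) * norm (snd q)"
            using norm_triangle_ineq4[of "fst q" "snd q"] by (simp add: algebra_simps)
          then have "norm (Q (fst q) (snd q)) \<le> (C + 1) * norm (snd q) * norm (snd q) ^ (m - 2)"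
            by (simp add: Q_def norm_mult norm_power mult_right_mono)
          also have "\<dots> = (C + 1) * norm (snd q) ^ (m - 1)"
          proof -
            have "m - 1 = Suc (m - 2)" using m2 by simp
            then show ?thesis by (simp only: power_Suc mult.assoc)
          qed
          also have "\<dots> \<le> (C + 1) * (norm (poly (pderiv T) (snd q)) / u)"
            using elim(2) C u by (intro mult_left_mono) (auto simp: field_simps)
          finally show "norm (Q (fst q) (snd q)) \<le> (C + 1) / u * norm (poly (pderiv T) (snd q))" by simp
        qed
      qed
      then have "regular_at T T Q 0 0" by (rule regular_at_right)
      then show ?thesis using True xy by simp
    next
      case False
      obtain U where U: "T = [:poly T y:] + [:-y, 1:] ^ 2 * U" "poly U y \<noteq> 0"
        using critical_form[OF y False] by blast
      define K where "K = norm (y ^ (m - 2)) + 1"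
      have "isCont (\<lambda>q::complex \<times> complex. snd q ^ (m - 2)) (y, y)" by (intro continuous_intros)
      from isCont_imp_eventually_nhds_le[OF this]
      have "\<forall>\<^sub>F q in nhds (y, y). norm (snd q ^ (m - 2)) \<le> K" by (simp add: K_def)
      then have "\<forall>\<^sub>F q in nhds (y, y). poly T (fst q) = poly T (snd q) \<longrightarrow>
          norm (Q (fst q) (snd q)) \<le> K * (norm (fst q - y) + norm (snd q - y))"
      proof eventually_elim
        case (elim q)
        have "norm (fst q - snd q) \<le> norm (fst q - y) + norm (snd q - y)"
          using norm_triangle_ineq4[of "fst q - y" "snd q - y"] by simp
        then have "norm (fst q - snd q) * norm (snd q ^ (m - 2)) \<le> (norm (fst q - y) + norm (snd q - y)) * K"
          using elim by (intro mult_mono) auto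
        then show ?case by (simp add: Q_def norm_mult norm_power mult.commute)
      qed
      then have "regular_at T T Q y y" by (rule regular_at_node[OF U U])
      then show ?thesis using xy by simp
    qed
  qed (use f g in auto)
  then have "\<forall>\<^sub>\<approx>z. (f z - g z) * g z ^ (m - 2) = 0" by (simp add: Q_def)
  then have "(\<forall>\<^sub>\<approx>z. f z - g z = 0) \<or> (\<forall>\<^sub>\<approx>z. g z ^ (m - 2) = 0)"
    by (rule meromorphic_mult_eq_0_cosparse[rotated 4]) (auto intro!: meromorphic_intros f g)
  then show ?thesis
  proof
    assume "\<forall>\<^sub>\<approx>z. g z ^ (m - 2) = 0"
    then have "\<forall>\<^sub>\<approx>z. g z = 0" by eventually_elim (auto simp: power_eq_0_iff)
    then show ?thesis using g(2) by blast
  qed (auto elim: eventually_mono)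
qed

text \<open>Substituting \<open>g = \<mu> + \<beta> * f\<close> yields a polynomial identity. Since
  \<open>k \<ge> 2\<close>, \<open>T\<close> has no term of degree \<open>n - 1\<close>, which
  forces \<open>\<mu> = 0\<close>; the constant terms then give \<open>b = c * b\<close>.\<close>

lemma no_affine_relation:
  assumes c: "c \<noteq> 1" "c \<noteq> 0" and b0: "b \<noteq> 0" and pq: "p \<noteq> 0 \<or> q \<noteq> 0"
    and f: "f meromorphic_on UNIV" "\<not> (\<exists>k. \<forall>\<^sub>\<approx>z. f z = k)"
    and g: "g meromorphic_on UNIV" "\<not> (\<exists>k. \<forall>\<^sub>\<approx>z. g z = k)"
    and rel: "\<forall>\<^sub>\<approx>z. poly T (f z) = c * poly T (g z)"
  shows "\<not> (\<forall>\<^sub>\<approx>z. p * f z + q * g z + s = 0)"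
proof
  assume L: "\<forall>\<^sub>\<approx>z. p * f z + q * g z + s = 0"
  have q: "q \<noteq> 0"
  proof
    assume "q = 0"
    then have "\<forall>\<^sub>\<approx>z. f z = - s / p" using L pq by (auto elim!: eventually_mono simp: field_simps eq_neg_iff_add_eq_0)
    then show False using f(2) by blast
  qed
  have p: "p \<noteq> 0"
  proof
    assume "p = 0"
    then have "\<forall>\<^sub>\<approx>z. g z = - s / q" using L q by (auto elim!: eventually_mono simp: field_simps eq_neg_iff_add_eq_0)
    then show False using g(2) by blast
  qed
  define \<beta> \<mu> where "\<beta> = - p / q" and "\<mu> = - s / q"
  have \<beta>: "\<beta> \<noteq> 0" using p q by (simp add: \<beta>_def)
  define R where "R = T - smult c ([:\<mu>, \<beta>:] ^ n + smult a ([:\<mu>, \<beta>:] ^ m) + [:b:])"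
  have "\<forall>\<^sub>\<approx>z. poly R (f z) = 0"
    using L rel
  proof eventually_elim
    case (elim z)
    have "g z = \<mu> + f z * \<beta>" using elim(1) q by (simp add: \<beta>_def \<mu>_def field_simps eq_neg_iff_add_eq_0)
    then show ?case using elim(2) by (simp add: R_def poly_T poly_power)
  qed
  then have R0: "R = 0" using meromorphic_poly_eq_0_imp_const[OF f(1)] f(2) by blast
  have "n - 1 \<noteq> n" "n - 1 \<noteq> m" "n - 1 \<noteq> 0" using nmk k2 m1 by linarith+
  then have "coeff T (n - 1) = 0" by (auto simp: T_def coeff_pCons split: nat.splits)
  moreover have "coeff ([:\<mu>, \<beta>:] ^ n) (n - 1) = of_nat (n choose (n - 1)) * \<beta> ^ (n - 1) * \<mu>"
    using coeff_linear_poly_power[of "n - 1" n \<mu> \<beta>] n_pos by simp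
  moreover have "coeff ([:\<mu>, \<beta>:] ^ m) (n - 1) = 0"
  proof (rule coeff_eq_0)
    have "degree ([:\<mu>, \<beta>:] ^ m) \<le> degree [:\<mu>, \<beta>:] * m" by (rule degree_power_le)
    also have "\<dots> \<le> 1 * m" by (intro mult_right_mono) auto
    finally show "degree ([:\<mu>, \<beta>:] ^ m) < n - 1" using nmk k2 by simp
  qed
  moreover have "coeff [:b:] (n - 1) = 0" using n_pos by (auto simp: coeff_pCons split: nat.splits)
  ultimately have "coeff R (n - 1) = - c * (of_nat (n choose (n - 1)) * \<beta> ^ (n - 1) * \<mu>)"
    by (simp add: R_def)
  moreover have "n choose (n - 1) \<noteq> 0" by simp
  ultimately have \<mu>: "\<mu> = 0" using R0 c \<beta> by simp
  have "poly R 0 = b - c * b" using \<mu> n_pos m1 by (simp add: R_def poly_T poly_power power_0_left)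
  then show False using R0 c b0 by simp
qed

end

section \<open>The hyperelliptic curve for gap 2\<close>

definition geom_poly :: "nat \<Rightarrow> complex poly" where "geom_poly j = (\<Sum>i<j. monom 1 i)"

lemma geom_poly_mult: "[:-1, 1:] * geom_poly j = monom 1 j - 1"
proof (induction j)
  case 0
  then show ?case by (simp add: geom_poly_def)
next
  case (Suc j)
  have "[:-1, 1:] * geom_poly (Suc j) = [:-1, 1:] * geom_poly j + [:-1, 1:] * monom 1 j"
    by (simp add: geom_poly_def distrib_left)
  also have "[:-1, 1:] * monom 1 j = monom 1 (Suc j) - monom (1::complex) j"
    by (simp add: monom_Suc)
  finally show ?case using Suc by simp
qed

lemma poly_geom_poly_mult: "(x - 1) * poly (geom_poly j) x = x ^ j - 1"
  using arg_cong[OF geom_poly_mult[of j], of "\<lambda>p. poly p x"] by (simp add: poly_monom algebra_simps)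

lemma geom_poly_root:
  assumes "poly (geom_poly j) x = 0" "j > 0"
  shows "x ^ j = 1" "x \<noteq> 1" "poly (pderiv (geom_poly j)) x \<noteq> 0"
proof -
  show xj: "x ^ j = 1" using poly_geom_poly_mult[of x j] assms by simp
  show x1: "x \<noteq> 1" using assms by (auto simp: geom_poly_def poly_sum poly_monom)
  have "pderiv ([:-1, 1:] * geom_poly j) = pderiv (monom 1 j - 1)" by (simp only: geom_poly_mult)
  then have "poly ([:-1, 1:] * pderiv (geom_poly j) + geom_poly j * pderiv [:-1, 1:]) x = poly (monom (of_nat j) (j - 1)) x"
    by (simp only: pderiv_mult) (simp add: pderiv_diff pderiv_monom)
  then have "(x - 1) * poly (pderiv (geom_poly j)) x = of_nat j * x ^ (j - 1)"
    using assms(1) by (simp add: poly_monom pderiv_pCons algebra_simps)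
  moreover have "x \<noteq> 0" using xj assms(2) by (auto simp: power_0_left)
  ultimately show "poly (pderiv (geom_poly j)) x \<noteq> 0" using assms(2) by auto
qed

lemma degree_geom_poly: "j > 0 \<Longrightarrow> degree (geom_poly j) = j - 1"
proof -
  assume j: "j > 0"
  have "[:-1, 1:] * geom_poly j \<noteq> 0"
  proof
    assume "[:-1, 1:] * geom_poly j = 0"
    then have "poly (monom (1::complex) j - 1) 2 = 0" by (simp only: geom_poly_mult) simp
    then have "(2::complex) ^ j = 1" by (simp add: poly_monom)
    then have "norm ((2::complex) ^ j) = 1" by simp
    then have "(2::real) ^ j = 1" by (simp add: norm_power)
    then show False using one_less_power[of "2::real" j] j by simp
  qed
  then have ne: "geom_poly j \<noteq> 0" by auto
  have "degree (monom (1::complex) j - 1) = j"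
    using j degree_add_eq_left[of "-1" "monom (1::complex) j"] by (simp add: degree_monom_eq)
  then have "degree ([:-1, 1:] * geom_poly j) = j" by (simp only: geom_poly_mult)
  moreover have "degree ([:-1, 1:] * geom_poly j) = degree [:-1, 1::complex:] + degree (geom_poly j)"
    using ne by (intro degree_mult_eq) auto
  ultimately show ?thesis by simp
qed

text \<open>Up to the factor 2 in \<open>P2' = 2 y\<close>, these are the differentials
  \<open>dx / y\<close> and \<open>x dx / y\<close> of a curve of genus at least 2. Simple roots of
  \<open>S\<close> exclude singular points. At infinity degree 6 bounds \<open>norm x ^ 3\<close> by
  a multiple of \<open>norm y\<close>, just what the growth clause demands of the second
  form.\<close>

lemma regular_form_hyperelliptic:
  fixes S :: "complex poly"
  assumes deg: "degree S \<ge> 6" and sqf: "\<And>x. poly S x = 0 \<Longrightarrow> poly (pderiv S) x \<noteq> 0"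
  shows "regular_form S (monom 1 2) (\<lambda>x y. 1)" "regular_form S (monom 1 2) (\<lambda>x y. x * 1)"
proof -
  have d2: "pderiv (monom (1::complex) 2) = monom 2 1" by (simp add: pderiv_monom)
  have reg: "regular_at S (monom 1 2) (\<lambda>x y. 1) x y" if "poly S x = poly (monom 1 2) y" for x y
  proof (cases "y = 0")
    case True
    then show ?thesis using that by (intro regular_at_noncritical_left sqf) (auto simp: poly_monom)
  next
    case False
    then show ?thesis by (intro regular_at_noncritical_right) (simp_all add: d2 poly_monom)
  qed
  have "S \<noteq> 0" using deg by auto
  then obtain M l where M: "M \<ge> 1" "l > 0" and l: "\<And>x. norm x \<ge> M \<Longrightarrow> l * norm x ^ degree S \<le> norm (poly S x)"
    using poly_growth[of S] by metis
  have big: "norm x ^ 3 \<le> 1 / (2 * sqrt l) * norm (poly (pderiv (monom 1 2)) y)"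
    if eq: "poly S x = poly (monom 1 2) y" and x: "norm x \<ge> M" for x y
  proof -
    have "(sqrt l * norm x ^ 3) ^ 2 = l * norm x ^ 6"
      using M by (simp add: power_mult_distrib flip: power_mult)
    also have "\<dots> \<le> l * norm x ^ degree S"
      using x M deg by (intro mult_left_mono power_increasing) auto
    also have "\<dots> \<le> norm y ^ 2" using l[OF x] eq by (simp add: poly_monom norm_power)
    finally have "sqrt l * norm x ^ 3 \<le> norm y" by (rule power2_le_imp_le) simp
    then show ?thesis using M by (simp add: d2 poly_monom norm_mult field_simps)
  qed
  have d: "0 < degree (monom (1::complex) 2)" by (simp add: degree_monom_eq)
  have big2: "norm x ^ 2 \<le> 1 / (2 * sqrt l) * norm (poly (pderiv (monom 1 2)) y)"
    if eq: "poly S x = poly (monom 1 2) y" and x: "norm x \<ge> M" for x y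
  proof -
    have "norm x ^ 2 \<le> norm x ^ 3" using x M by (intro power_increasing) auto
    also note big[OF that]
    finally show ?thesis .
  qed
  have "\<exists>M C. \<forall>x y. poly S x = poly (monom 1 2) y \<longrightarrow> M \<le> norm x \<longrightarrow>
      norm x ^ 2 * norm (1::complex) \<le> C * norm (poly (pderiv (monom 1 2)) y)"
    by (rule exI[of _ M], rule exI[of _ "1 / (2 * sqrt l)"]) (use big2 in auto)
  then show "regular_form S (monom 1 2) (\<lambda>x y. 1)"
    unfolding regular_form_def using d reg by auto
  have "norm x ^ 2 * norm (x * 1) = norm x ^ 3" for x :: complex
    by (simp add: power3_eq_cube power2_eq_square)
  then have "\<exists>M C. \<forall>x y. poly S x = poly (monom 1 2) y \<longrightarrow> M \<le> norm x \<longrightarrow>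
      norm x ^ 2 * norm (x * 1) \<le> C * norm (poly (pderiv (monom 1 2)) y)"
    by (simp only:) (rule exI[of _ M], rule exI[of _ "1 / (2 * sqrt l)"], use big in blast)
  then show "regular_form S (monom 1 2) (\<lambda>x y. x * 1)"
    unfolding regular_form_def using d regular_at_times[OF reg] by auto
qed

context trinomial
begin

text \<open>Here \<open>(x - y) * y ^ (m - 2)\<close> has degree \<open>n - 3\<close>, which leaves
  no room for a second form. Dividing the equation by \<open>(h - 1) * g ^ m\<close> instead gives
  \<open>g^2 * B(h) = - a * A(h)\<close>, so \<open>y = g * B(h)\<close> satisfies
  \<open>y^2 = - a * A(h) * B(h)\<close>. Coprimality makes the right side squarefree, and its
  degree \<open>2 * n - 4\<close> is at least 6 exactly for \<open>n \<ge> 5\<close>.\<close>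

lemma unique_of_gap_2:
  assumes k: "k = 2" and n5: "n \<ge> 5"
    and f: "f meromorphic_on UNIV" "\<not> (\<exists>k. \<forall>\<^sub>\<approx>z. f z = k)"
    and g: "g meromorphic_on UNIV" "\<not> (\<exists>k. \<forall>\<^sub>\<approx>z. g z = k)"
    and rel: "\<forall>\<^sub>\<approx>z. poly T (f z) = poly T (g z)"
  shows "\<forall>\<^sub>\<approx>z. f z = g z"
proof (rule ccontr)
  assume "\<not> ?thesis"
  then have "\<not> (\<forall>\<^sub>\<approx>z. f z - g z = 0)" by (auto elim: eventually_mono)
  then have fg: "\<forall>\<^sub>\<approx>z. f z - g z \<noteq> 0"
    using meromorphic_imp_constant_or_avoid[of "\<lambda>z. f z - g z" UNIV 0] f g by (auto intro!: meromorphic_intros)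
  have g0: "\<forall>\<^sub>\<approx>z. g z \<noteq> 0" using meromorphic_poly_nonzero_cosparse[OF g, of "[:0,1:]"] by simp
  define A B where "A = geom_poly m" and "B = geom_poly n"
  have A: "(x - 1) * poly A x = x ^ m - 1" and B: "(x - 1) * poly B x = x ^ n - 1" for x
    by (simp_all add: A_def B_def poly_geom_poly_mult)
  have AB: False if "poly A x = 0" "poly B x = 0" for x
  proof -
    have x: "x ^ m = 1" "x \<noteq> 1" "x ^ n = 1"
      using geom_poly_root[of m x] geom_poly_root[of n x] that m1 n5 by (auto simp: A_def B_def)
    then have "x ^ k = 1" by (simp add: nmk power_add)
    then show False using coprime_powers_eq_1[OF _ x(1) cop] k x(2) by simp
  qed
  define h where "h = (\<lambda>z. f z / g z)"
  have h: "h meromorphic_on UNIV" unfolding h_def by (intro meromorphic_intros f g)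
  have h1: "\<forall>\<^sub>\<approx>z. h z \<noteq> 1" using fg g0 by eventually_elim (simp add: h_def)
  have key: "\<forall>\<^sub>\<approx>z. g z ^ 2 * poly B (h z) + a * poly A (h z) = 0"
    using fg g0 rel
  proof eventually_elim
    case (elim z)
    have fh: "f z = h z * g z" using elim by (simp add: h_def)
    have "f z ^ n + a * f z ^ m = g z ^ n + a * g z ^ m" using elim(3) by (simp add: poly_T)
    then have "g z ^ m * (g z ^ 2 * (h z ^ n - 1) + a * (h z ^ m - 1)) = 0"
      unfolding fh by (simp add: nmk k power_add power_mult_distrib power2_eq_square algebra_simps)
    then have "g z ^ 2 * ((h z - 1) * poly B (h z)) + a * ((h z - 1) * poly A (h z)) = 0"
      using elim(2) by (simp add: A B)
    then have "(h z - 1) * (g z ^ 2 * poly B (h z) + a * poly A (h z)) = 0" by (simp add: algebra_simps)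
    moreover have "h z - 1 \<noteq> 0" using elim(1,2) by (simp add: h_def)
    ultimately show ?case by simp
  qed
  have hnc: "\<not> (\<exists>k. \<forall>\<^sub>\<approx>z. h z = k)"
  proof
    assume "\<exists>k. \<forall>\<^sub>\<approx>z. h z = k"
    then obtain \<zeta> where \<zeta>: "\<forall>\<^sub>\<approx>z. h z = \<zeta>" by blast
    define p where "p = [:a * poly A \<zeta>, 0, poly B \<zeta>:]"
    have "\<forall>\<^sub>\<approx>z. poly p (g z) = 0"
      using \<zeta> key by eventually_elim (simp add: p_def power2_eq_square algebra_simps)
    then have "p = 0" using meromorphic_poly_eq_0_imp_const[OF g(1)] g(2) by blast
    then show False using AB[of \<zeta>] a0 by (simp add: p_def)
  qed
  define S where "S = smult (- a) (A * B)"
  have "A \<noteq> 0" "B \<noteq> 0" using geom_poly_root(2)[of m 1] geom_poly_root(2)[of n 1] m1 n5 by (auto simp: A_def B_def)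
  then have "degree S = degree A + degree B" using a0 by (simp add: S_def degree_mult_eq)
  also have "\<dots> = (m - 1) + (n - 1)" using m1 n5 by (simp add: A_def B_def degree_geom_poly)
  finally have degS: "degree S \<ge> 6" using n5 nmk k by simp
  have dS: "poly (pderiv S) x = - a * (poly A x * poly (pderiv B) x + poly B x * poly (pderiv A) x)" for x
    unfolding S_def pderiv_smult pderiv_mult by simp
  have sqf: "poly (pderiv S) x \<noteq> 0" if "poly S x = 0" for x
  proof (cases "poly A x = 0")
    case True
    then show ?thesis using AB[of x] geom_poly_root(3)[of m x] a0 m1 by (auto simp: dS A_def)
  next
    case False
    then have "poly B x = 0" using that a0 by (simp add: S_def)
    then show ?thesis using False geom_poly_root(3)[of n x] a0 n5 by (auto simp: dS B_def)
  qed
  define y where "y = (\<lambda>z. g z * poly B (h z))"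
  have y: "y meromorphic_on UNIV" unfolding y_def by (intro meromorphic_intros g h)
  have "pderiv S \<noteq> 0" using degS by (auto simp: pderiv_eq_0_iff)
  then have "\<forall>\<^sub>\<approx>z. poly (pderiv S) (h z) \<noteq> 0" "\<forall>\<^sub>\<approx>z. poly B (h z) \<noteq> 0"
    using meromorphic_poly_nonzero_cosparse[OF h hnc] \<open>B \<noteq> 0\<close> by blast+
  with key g0 have "\<forall>\<^sub>\<approx>z. poly S (h z) = poly (monom 1 2) (y z) \<and> poly (pderiv S) (h z) \<noteq> 0 \<and>
      poly (pderiv (monom 1 2)) (y z) \<noteq> 0"
  proof eventually_elim
    case (elim z)
    have e: "a * poly A (h z) = - (g z ^ 2 * poly B (h z))"
      using elim(1) by (simp add: eq_neg_iff_add_eq_0 add.commute)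
    have "poly S (h z) = - (a * poly A (h z)) * poly B (h z)" by (simp add: S_def)
    also have "\<dots> = y z ^ 2" by (simp add: e y_def power2_eq_square)
    finally show ?case using elim by (simp add: poly_monom pderiv_monom y_def)
  qed
  then have cm: "curve_map S (monom 1 2) h y UNIV" by (simp add: curve_map_def h y)
  have "\<forall>\<^sub>\<approx>z. 1 * deriv h z = 0"
    by (rule regular_forms_vanish_meromorphic[OF regular_form_hyperelliptic[OF degS sqf] cm])
  then show False using meromorphic_deriv_eq_0_imp_const[OF h] hnc by simp
qed

section \<open>Singular points and forms for a factor other than 1\<close>

lemma critical_pair_shift:
  assumes "poly (pderiv T) x = 0" "poly (pderiv T) y = 0" "poly T x = c * poly T y"
  shows "v x = c * v y + (c - 1) * b"
  using assms by (simp add: critical_value algebra_simps)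

text \<open>The affine relation between \<open>v x\<close> and \<open>v y\<close>, together with
  injectivity of \<open>v\<close> on critical points, determines a pair from \<open>v y\<close>.
  Counting singular points thus becomes counting the critical values that an affine map sends to
  critical values, all reduced by \<open>b\<close>; its translation part \<open>(c - 1) * b\<close>
  is nonzero when \<open>c \<noteq> 1\<close> and \<open>b \<noteq> 0\<close>.\<close>

lemma inj_on_critical_pairs:
  "inj_on (\<lambda>q. v (snd q)) {q. poly (pderiv T) (fst q) = 0 \<and> poly (pderiv T) (snd q) = 0 \<and> poly T (fst q) = c * poly T (snd q)}"
proof (rule inj_onI)
  fix q q' assume *: "q \<in> {q. poly (pderiv T) (fst q) = 0 \<and> poly (pderiv T) (snd q) = 0 \<and> poly T (fst q) = c * poly T (snd q)}"
     "q' \<in> {q. poly (pderiv T) (fst q) = 0 \<and> poly (pderiv T) (snd q) = 0 \<and> poly T (fst q) = c * poly T (snd q)}"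
     "v (snd q) = v (snd q')"
  then have "snd q = snd q'" using v_inj by auto
  moreover have "v (fst q) = v (fst q')"
    using * critical_pair_shift[of "fst q" "snd q" c] critical_pair_shift[of "fst q'" "snd q'" c] by simp
  then have "fst q = fst q'" using * v_inj by auto
  ultimately show "q = q'" by (simp add: prod_eq_iff)
qed

lemma nodes_collinear:
  assumes c: "c \<noteq> 0" "c \<noteq> 1" and b0: "b \<noteq> 0"
  obtains p q s where "p \<noteq> 0 \<or> q \<noteq> 0" "\<And>x y. x \<noteq> 0 \<Longrightarrow> y \<noteq> 0 \<Longrightarrow> poly (pderiv T) x = 0 \<Longrightarrow>
     poly (pderiv T) y = 0 \<Longrightarrow> poly T x = c * poly T y \<Longrightarrow> p * x + q * y + s = 0"
proof -
  define N where "N = {q. fst q \<noteq> 0 \<and> snd q \<noteq> 0 \<and> poly (pderiv T) (fst q) = 0 \<and> poly (pderiv T) (snd q) = 0 \<and> poly T (fst q) = c * poly T (snd q)}"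
  define V where "V = {u. u ^ k = \<kappa> \<and> (c * u + (c - 1) * b) ^ k = \<kappa>}"
  have V: "finite V" "card V \<le> 2"
    using card_common_roots_affine[OF c(1), of "(c - 1) * b" k \<kappa>] c b0 k2 by (auto simp: V_def)
  have inj: "inj_on (\<lambda>q. v (snd q)) N"
    by (rule inj_on_subset[OF inj_on_critical_pairs[of c]]) (auto simp: N_def)
  have sub: "(\<lambda>q. v (snd q)) ` N \<subseteq> V"
  proof
    fix u assume "u \<in> (\<lambda>q. v (snd q)) ` N"
    then obtain q where q: "q \<in> N" "u = v (snd q)" by blast
    then have "v (fst q) = c * u + (c - 1) * b" using critical_pair_shift[of "fst q" "snd q" c] by (auto simp: N_def)
    moreover have "v (fst q) ^ k = \<kappa>" "u ^ k = \<kappa>" using q v_power by (auto simp: N_def)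
    ultimately show "u \<in> V" by (simp add: V_def)
  qed
  have "finite N" "card N \<le> 2"
    using inj_on_finite[OF inj sub V(1)] card_inj_on_le[OF inj sub V(1)] V(2) by auto
  then obtain p q s where "p \<noteq> 0 \<or> q \<noteq> 0" "\<And>x y. (x, y) \<in> N \<Longrightarrow> p * x + q * y + s = 0"
    by (rule line_through_two_points) (rule that; blast)
  then show thesis by (intro that[of p q s]) (auto simp: N_def)
qed

text \<open>This includes the singular points on the coordinate axes. For \<open>m = 1\<close> there
  are none, as 0 is not critical. Otherwise \<open>k\<close> is 2 or 3, and adjoining 0 to the
  \<open>k\<close>-th roots of \<open>\<kappa>\<close> still leaves at most two
  coincidences.\<close>

lemma critical_pairs_collinear:
  assumes c: "c \<noteq> 0" "c \<noteq> 1" and b0: "b \<noteq> 0" and small: "m = 1 \<or> k = 2 \<or> k = 3"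
  obtains p q s where "p \<noteq> 0 \<or> q \<noteq> 0" "\<And>x y. poly (pderiv T) x = 0 \<Longrightarrow>
     poly (pderiv T) y = 0 \<Longrightarrow> poly T x = c * poly T y \<Longrightarrow> p * x + q * y + s = 0"
proof (cases "m = 1")
  case True
  have nz: "x \<noteq> 0" if "poly (pderiv T) x = 0" for x
    using that True a0 k2 poly_pderiv_T[of x] by (auto simp: power_0_left)
  obtain p q s where "p \<noteq> 0 \<or> q \<noteq> 0" "\<And>x y. x \<noteq> 0 \<Longrightarrow> y \<noteq> 0 \<Longrightarrow> poly (pderiv T) x = 0 \<Longrightarrow>
     poly (pderiv T) y = 0 \<Longrightarrow> poly T x = c * poly T y \<Longrightarrow> p * x + q * y + s = 0"
    by (rule nodes_collinear[OF c b0]) (rule that; blast)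
  then show thesis using nz by (intro that[of p q s]) auto
next
  case False
  define N where "N = {q. poly (pderiv T) (fst q) = 0 \<and> poly (pderiv T) (snd q) = 0 \<and> poly T (fst q) = c * poly T (snd q)}"
  define V where "V = {u. u = 0 \<or> u ^ k = \<kappa>}"
  define W where "W = {u \<in> V. c * u + (c - 1) * b \<in> V}"
  have W: "finite W" "card W \<le> 2"
    using card_affine_small[OF c(1) _ kappa_nonzero _ V_def, of "(c - 1) * b"] c b0 small False by (auto simp: W_def)
  have inj: "inj_on (\<lambda>q. v (snd q)) N"
    using inj_on_critical_pairs[of c] by (simp add: N_def)
  have sub: "(\<lambda>q. v (snd q)) ` N \<subseteq> W"
  proof
    fix u assume "u \<in> (\<lambda>q. v (snd q)) ` N"
    then obtain q where q: "q \<in> N" "u = v (snd q)" by blast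
    then have 1: "v (fst q) = c * u + (c - 1) * b" using critical_pair_shift[of "fst q" "snd q" c] by (auto simp: N_def)
    have inV: "v x \<in> V" if "poly (pderiv T) x = 0" for x
      using v_power[OF that] v_eq_0_iff[of x] by (auto simp: V_def)
    have "v (fst q) \<in> V" "u \<in> V" using q inV by (auto simp: N_def)
    then show "u \<in> W" using 1 by (simp add: W_def)
  qed
  have "finite N" "card N \<le> 2"
    using inj_on_finite[OF inj sub W(1)] card_inj_on_le[OF inj sub W(1)] W(2) by auto
  then obtain p q s where "p \<noteq> 0 \<or> q \<noteq> 0" "\<And>x y. (x, y) \<in> N \<Longrightarrow> p * x + q * y + s = 0"
    by (rule line_through_two_points) (rule that; blast)
  then show thesis by (intro that[of p q s]) (auto simp: N_def)
qed

lemma affine_bound: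
  fixes p q s :: complex
  assumes "p * x0 + q * y0 + s = 0"
  shows "norm (p * x + q * y + s) \<le> (norm p + norm q) * (norm (x - x0) + norm (y - y0))"
proof -
  have "p * x + q * y + s = p * (x - x0) + q * (y - y0)" using assms by (simp add: algebra_simps eq_neg_iff_add_eq_0)
  then have "norm (p * x + q * y + s) \<le> norm p * norm (x - x0) + norm q * norm (y - y0)"
    using norm_triangle_ineq[of "p * (x - x0)" "q * (y - y0)"] by (simp add: norm_mult)
  also have "\<dots> \<le> (norm p + norm q) * (norm (x - x0) + norm (y - y0))" by (simp add: algebra_simps)
  finally show ?thesis .
qed

lemma affine_growth:
  fixes p q s :: complex
  shows "norm (p * x + q * y + s) \<le> (norm p + norm q + norm s) * (1 + norm x + norm y)"
proof -
  have "norm (p * x + q * y + s) \<le> norm p * norm x + norm q * norm y + norm s"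
    using norm_triangle_ineq[of "p * x + q * y" s] norm_triangle_ineq[of "p * x" "q * y"] by (simp add: norm_mult)
  also have "\<dots> \<le> (norm p + norm q + norm s) * (1 + norm x + norm y)" by (simp add: algebra_simps)
  finally show ?thesis .
qed

text \<open>Every singular point is a double point here. A zero coordinate is critical only for
  \<open>m \<ge> 2\<close>; then \<open>n = 5\<close>, and the gap leaves \<open>m = 2\<close>, a
  node, or \<open>m = 3\<close>, a cusp, since the other coordinate is a simple critical point. A
  line through all of them is enough.\<close>

lemma strong_small:
  assumes c: "c \<noteq> 0" "c \<noteq> 1" and b0: "b \<noteq> 0" and small: "m = 1 \<or> n = 5"
    and large: "n \<ge> 5 \<or> n = 4 \<and> (\<lambda>z. f (inverse z)) meromorphic_on UNIV \<and> (\<lambda>z. g (inverse z)) meromorphic_on UNIV"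
    and f: "f meromorphic_on UNIV" "\<not> (\<exists>k. \<forall>\<^sub>\<approx>z. f z = k)"
    and g: "g meromorphic_on UNIV" "\<not> (\<exists>k. \<forall>\<^sub>\<approx>z. g z = k)"
    and rel: "\<forall>\<^sub>\<approx>z. poly T (f z) = c * poly T (g z)"
  shows False
proof -
  have "m = 1 \<or> k = 2 \<or> k = 3" using small nmk k2 m1 by linarith
  then obtain p q s where pq: "p \<noteq> 0 \<or> q \<noteq> 0" and L: "\<And>x y. poly (pderiv T) x = 0 \<Longrightarrow>
     poly (pderiv T) y = 0 \<Longrightarrow> poly T x = c * poly T y \<Longrightarrow> p * x + q * y + s = 0"
    by (rule critical_pairs_collinear[OF c b0]) (rule that; blast)
  define Q where "Q = (\<lambda>x y. p * x + q * y + s)"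
  have "\<forall>\<^sub>\<approx>z. Q (f z) (g z) = 0"
  proof (rule form_vanishes[OF c(1) _ f g rel, of 1 Q "norm p + norm q + norm s"])
    show "large 1 f g" using large unfolding large_def by auto
    show "isCont (\<lambda>q. Q (fst q) (snd q)) (x, y)" for x y unfolding Q_def by (intro continuous_intros)
    show "(\<lambda>z. Q (f z) (g z)) meromorphic_on A" if "f meromorphic_on A" "g meromorphic_on A" for f g A
      unfolding Q_def by (intro meromorphic_intros that)
    show "norm (Q x y) \<le> (norm p + norm q + norm s) * (1 + norm x + norm y) ^ 1" for x y
      using affine_growth[of p x q y s] by (simp add: Q_def)
    fix x y assume x: "poly (pderiv T) x = 0" and y: "poly (pderiv T) y = 0" and eq: "poly T x = c * poly T y"
    have Qb: "norm (Q (fst u) (snd u)) \<le> (norm p + norm q) * (norm (fst u - x) + norm (snd u - y))" for u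
      unfolding Q_def by (rule affine_bound[OF L[OF x y eq]])
    have m23: "m = 2 \<or> m = 3" if "x = 0 \<or> y = 0"
    proof -
      have "m \<noteq> 1" using that x y a0 k2 poly_pderiv_T[of x] poly_pderiv_T[of y] by (auto simp: power_0_left)
      then show ?thesis using small nmk k2 m1 by linarith
    qed
    note z1 = zero_form
    have xf: "\<exists>j U. T = [:poly T x:] + [:-x, 1:] ^ j * U \<and> poly U x \<noteq> 0 \<and> (j = 2 \<or> j = 3) \<and> (x \<noteq> 0 \<longrightarrow> j = 2)"
      if x: "poly (pderiv T) x = 0" and m: "x = 0 \<Longrightarrow> m = 2 \<or> m = 3" for x
    proof (cases "x = 0")
      case True
      have "poly T 0 = b" using n_pos m1 by (simp add: poly_T power_0_left)
      then show ?thesis using z1 m[OF True] True by (intro exI[of _ m] exI[of _ "monom 1 k + [:a:]"]) auto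
    next
      case False
      obtain U where "T = [:poly T x:] + [:-x, 1:] ^ 2 * U" "poly U x \<noteq> 0" using critical_form[OF x False] by blast
      then show ?thesis using False by blast
    qed
    obtain j U where U: "T = [:poly T x:] + [:-x, 1:] ^ j * U" "poly U x \<noteq> 0" "j = 2 \<or> j = 3" "x \<noteq> 0 \<longrightarrow> j = 2"
      using xf[OF x] m23 by blast
    obtain l W where W: "T = [:poly T y:] + [:-y, 1:] ^ l * W" "poly W y \<noteq> 0" "l = 2 \<or> l = 3" "y \<noteq> 0 \<longrightarrow> l = 2"
      using xf[OF y] m23 by blast
    have W': "smult c T = [:poly T x:] + [:-y, 1:] ^ l * smult c W" "poly (smult c W) y \<noteq> 0"
      using smult_form[OF W(1,2) c(1)] unfolding eq[symmetric] .
    have "poly T 0 = b" using n_pos m1 by (simp add: poly_T power_0_left)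
    \<comment> \<open>At the origin the equation would read \<open>b = c * b\<close>. This rules out
      the exponents 3 and 3, a triple point, for which a line would not do.\<close>
    then have "\<not> (x = 0 \<and> y = 0)" using eq c b0 by auto
    then consider "j = 2" "l = 2" | "j = 3" "l = 2" | "j = 2" "l = 3" using U W by blast
    then show "regular_at T (smult c T) Q x y"
    proof cases
      case 1
      show ?thesis
        by (rule regular_at_node[where K = "norm p + norm q", OF U(1)[unfolded 1] U(2) W'(1)[unfolded 1] W'(2)])
           (intro always_eventually allI impI Qb)
    next
      case 2
      show ?thesis
        by (rule regular_at_cusp[where K = "norm p + norm q", OF U(1)[unfolded 2] U(2) W'(1)[unfolded 2] W'(2)])
           (intro always_eventually allI Qb)
    next
      case 3
      have Qb': "norm (Q (snd u) (fst u)) \<le> (norm p + norm q) * (norm (fst u - y) + norm (snd u - x))" for u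
        using Qb[of "(snd u, fst u)"] by (simp add: add.commute)
      show ?thesis
        by (rule regular_at_swap, rule regular_at_cusp[where K = "norm p + norm q", OF W'(1)[unfolded 3] W'(2) U(1)[unfolded 3] U(2)])
           (intro always_eventually allI Qb')
    qed
  qed
  then show False using no_affine_relation[OF c(2,1) b0 pq f g rel] by (simp add: Q_def)
qed

text \<open>As \<open>T\<close> separates its critical points, each axis carries at most one
  singular point, \<open>(0, ya)\<close> or \<open>(xb, 0)\<close>. Its nonzero coordinate is a
  simple critical point, so a linear factor in that coordinate makes the form regular whatever the
  order \<open>m\<close> in the other one. With the line the degree is 3, which fits under
  \<open>n - 4\<close> from \<open>n = 7\<close> on.\<close>

lemma strong_large:
  assumes c: "c \<noteq> 0" "c \<noteq> 1" and b0: "b \<noteq> 0" and n7: "n \<ge> 7"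
    and f: "f meromorphic_on UNIV" "\<not> (\<exists>k. \<forall>\<^sub>\<approx>z. f z = k)"
    and g: "g meromorphic_on UNIV" "\<not> (\<exists>k. \<forall>\<^sub>\<approx>z. g z = k)"
    and rel: "\<forall>\<^sub>\<approx>z. poly T (f z) = c * poly T (g z)"
  shows False
proof -
  obtain p q s where pq: "p \<noteq> 0 \<or> q \<noteq> 0" and L: "\<And>x y. x \<noteq> 0 \<Longrightarrow> y \<noteq> 0 \<Longrightarrow> poly (pderiv T) x = 0 \<Longrightarrow>
     poly (pderiv T) y = 0 \<Longrightarrow> poly T x = c * poly T y \<Longrightarrow> p * x + q * y + s = 0"
    by (rule nodes_collinear[OF c b0]) (rule that; blast)
  have T0: "poly T 0 = b" using n_pos m1 by (simp add: poly_T power_0_left)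
  \<comment> \<open>Only uniqueness is asserted: if no singular point has \<open>x = 0\<close>, any
    \<open>ya\<close> will do.\<close>
  obtain ya where ya: "\<And>y. poly (pderiv T) y = 0 \<Longrightarrow> poly T 0 = c * poly T y \<Longrightarrow> y = ya"
  proof -
    have "y = y'" if "poly (pderiv T) y = 0" "poly T 0 = c * poly T y" "poly (pderiv T) y' = 0" "poly T 0 = c * poly T y'" for y y'
    proof (rule v_inj)
      have "poly T y = poly T y'" using that(2,4) c by simp
      then show "v y = v y'" using critical_value[OF that(1)] critical_value[OF that(3)] by simp
    qed (use that in auto)
    then show thesis using that by blast
  qed
  obtain xb where xb: "\<And>x. poly (pderiv T) x = 0 \<Longrightarrow> poly T x = c * poly T 0 \<Longrightarrow> x = xb"
  proof -
    have "x = x'" if "poly (pderiv T) x = 0" "poly T x = c * poly T 0" "poly (pderiv T) x' = 0" "poly T x' = c * poly T 0" for x x'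
    proof (rule v_inj)
      have "b + v x = b + v x'"
        using critical_value[OF that(1), symmetric] critical_value[OF that(3), symmetric] that(2,4) by (simp only:)
      then show "v x = v x'" by simp
    qed (use that in auto)
    then show thesis using that by blast
  qed
  define Q where "Q = (\<lambda>x y. (y - ya) * (x - xb) * (p * x + q * y + s))"
  have bounded: "\<exists>B. \<forall>\<^sub>F u in nhds u0. norm (h u) \<le> B" if "isCont h u0" for h :: "complex \<times> complex \<Rightarrow> complex" and u0
    using isCont_imp_eventually_nhds_le[OF that] by blast
  have "\<forall>\<^sub>\<approx>z. Q (f z) (g z) = 0"
  proof (rule form_vanishes[OF c(1) _ f g rel, of 3 Q "(1 + norm ya) * (1 + norm xb) * (norm p + norm q + norm s)"])
    show "large 3 f g" using n7 unfolding large_def by auto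
    show "isCont (\<lambda>q. Q (fst q) (snd q)) (x, y)" for x y unfolding Q_def by (intro continuous_intros)
    show "(\<lambda>z. Q (f z) (g z)) meromorphic_on A" if "f meromorphic_on A" "g meromorphic_on A" for f g A
      unfolding Q_def by (intro meromorphic_intros that)
    show "norm (Q x y) \<le> (1 + norm ya) * (1 + norm xb) * (norm p + norm q + norm s) * (1 + norm x + norm y) ^ 3" for x y
    proof -
      define r where "r = 1 + norm x + norm y"
      have "norm (y - ya) \<le> (1 + norm ya) * r" "norm (x - xb) \<le> (1 + norm xb) * r"
        "norm (p * x + q * y + s) \<le> (norm p + norm q + norm s) * r"
        using affine_growth[of 0 x 1 y "-ya"] affine_growth[of 1 x 0 y "-xb"] affine_growth[of p x q y s]
        by (simp_all add: r_def)
      moreover have "r \<ge> 0" by (simp add: r_def)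
      ultimately have "norm (y - ya) * norm (x - xb) * norm (p * x + q * y + s) \<le>
        ((1 + norm ya) * r) * ((1 + norm xb) * r) * ((norm p + norm q + norm s) * r)"
        by (intro mult_mono) auto
      then show ?thesis by (simp add: Q_def norm_mult r_def[symmetric] power3_eq_cube mult_ac)
    qed
    fix x y assume x: "poly (pderiv T) x = 0" and y: "poly (pderiv T) y = 0" and eq: "poly T x = c * poly T y"
    have "\<not> (x = 0 \<and> y = 0)" using eq c b0 T0 by auto
    then consider "x \<noteq> 0" "y \<noteq> 0" | "x = 0" "y \<noteq> 0" | "x \<noteq> 0" "y = 0" by blast
    then show "regular_at T (smult c T) Q x y"
    proof cases
      case 1
      obtain U where U: "T = [:poly T x:] + [:-x, 1:] ^ 2 * U" "poly U x \<noteq> 0" using critical_form[OF x 1(1)] by blast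
      obtain W where W: "T = [:poly T y:] + [:-y, 1:] ^ 2 * W" "poly W y \<noteq> 0" using critical_form[OF y 1(2)] by blast
      have W': "smult c T = [:poly T x:] + [:-y, 1:] ^ 2 * smult c W" "poly (smult c W) y \<noteq> 0"
        using smult_form[OF W c(1)] unfolding eq[symmetric] .
      obtain B where B: "\<forall>\<^sub>F u in nhds (x, y). norm ((snd u - ya) * (fst u - xb)) \<le> B"
        using bounded[of "(x, y)" "\<lambda>u. (snd u - ya) * (fst u - xb)"] by (auto intro!: continuous_intros)
      then have "\<forall>\<^sub>F u in nhds (x, y). poly T (fst u) = poly (smult c T) (snd u) \<longrightarrow> norm (Q (fst u) (snd u)) \<le>
          (B * (norm p + norm q)) * (norm (fst u - x) + norm (snd u - y))"
      proof eventually_elim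
        case (elim u)
        have "norm ((snd u - ya) * (fst u - xb)) * norm (p * fst u + q * snd u + s) \<le>
            B * ((norm p + norm q) * (norm (fst u - x) + norm (snd u - y)))"
        proof (rule mult_mono[OF elim affine_bound[OF L[OF 1 x y eq]]])
          show "0 \<le> B" using norm_ge_zero elim by (rule order_trans)
        qed auto
        then show ?case by (simp add: Q_def norm_mult mult_ac)
      qed
      then show ?thesis by (rule regular_at_node[OF U W'])
    next
      case 2
      obtain W where W: "T = [:poly T y:] + [:-y, 1:] ^ 2 * W" "poly W y \<noteq> 0" using critical_form[OF y 2(2)] by blast
      note W' = smult_form[OF W c(1)]
      have y': "y = ya" using ya y eq 2 by simp
      obtain B where B: "\<forall>\<^sub>F u in nhds (x, y). norm ((fst u - xb) * (p * fst u + q * snd u + s)) \<le> B"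
        using bounded[of "(x, y)" "\<lambda>u. (fst u - xb) * (p * fst u + q * snd u + s)"] by (auto intro!: continuous_intros)
      then have "\<forall>\<^sub>F u in nhds (x, y). poly T (fst u) = poly (smult c T) (snd u) \<longrightarrow> norm (Q (fst u) (snd u)) \<le> B * norm (snd u - y)"
      proof eventually_elim
        case (elim u)
        then have "norm ((fst u - xb) * (p * fst u + q * snd u + s)) * norm (snd u - y) \<le> B * norm (snd u - y)"
          by (intro mult_right_mono) auto
        then show ?case by (simp add: Q_def norm_mult y' mult_ac)
      qed
      then show ?thesis by (rule regular_at_linear_right[OF W'])
    next
      case 3
      obtain U where U: "T = [:poly T x:] + [:-x, 1:] ^ 2 * U" "poly U x \<noteq> 0" using critical_form[OF x 3(1)] by blast
      have x': "x = xb" using xb x eq 3 by simp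
      obtain B where B: "\<forall>\<^sub>F u in nhds (x, y). norm ((snd u - ya) * (p * fst u + q * snd u + s)) \<le> B"
        using bounded[of "(x, y)" "\<lambda>u. (snd u - ya) * (p * fst u + q * snd u + s)"] by (auto intro!: continuous_intros)
      then have "\<forall>\<^sub>F u in nhds (x, y). poly T (fst u) = poly (smult c T) (snd u) \<longrightarrow> norm (Q (fst u) (snd u)) \<le> B * norm (fst u - x)"
      proof eventually_elim
        case (elim u)
        then have "norm ((snd u - ya) * (p * fst u + q * snd u + s)) * norm (fst u - x) \<le> B * norm (fst u - x)"
          by (intro mult_right_mono) auto
        then show ?case by (simp add: Q_def norm_mult x' mult_ac)
      qed
      then show ?thesis by (rule regular_at_linear_left[OF U])
    qed
  qed
  then have "\<forall>\<^sub>\<approx>z. (g z - ya) * ((f z - xb) * (p * f z + q * g z + s)) = 0" by (simp add: Q_def mult.assoc)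
  then have "(\<forall>\<^sub>\<approx>z. g z - ya = 0) \<or> (\<forall>\<^sub>\<approx>z. (f z - xb) * (p * f z + q * g z + s) = 0)"
    by (rule meromorphic_mult_eq_0_cosparse[rotated 4]) (auto intro!: meromorphic_intros f g)
  then show False
  proof
    assume "\<forall>\<^sub>\<approx>z. g z - ya = 0"
    then have "\<forall>\<^sub>\<approx>z. g z = ya" by eventually_elim simp
    then show False using g(2) by blast
  next
    assume "\<forall>\<^sub>\<approx>z. (f z - xb) * (p * f z + q * g z + s) = 0"
    then have "(\<forall>\<^sub>\<approx>z. f z - xb = 0) \<or> (\<forall>\<^sub>\<approx>z. p * f z + q * g z + s = 0)"
      by (rule meromorphic_mult_eq_0_cosparse[rotated 4]) (auto intro!: meromorphic_intros f g)
    then show False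
    proof
      assume "\<forall>\<^sub>\<approx>z. f z - xb = 0"
      then have "\<forall>\<^sub>\<approx>z. f z = xb" by eventually_elim simp
      then show False using f(2) by blast
    qed (use no_affine_relation[OF c(2,1) b0 pq f g rel] in blast)
  qed
qed

theorem unique:
  assumes large: "n \<ge> 5 \<or> n = 4 \<and> (\<lambda>z. f (inverse z)) meromorphic_on UNIV \<and> (\<lambda>z. g (inverse z)) meromorphic_on UNIV"
    and f: "f meromorphic_on UNIV" "\<not> (\<exists>k. \<forall>\<^sub>\<approx>z. f z = k)"
    and g: "g meromorphic_on UNIV" "\<not> (\<exists>k. \<forall>\<^sub>\<approx>z. g z = k)"
    and rel: "\<forall>\<^sub>\<approx>z. poly T (f z) = poly T (g z)"
  shows "\<forall>\<^sub>\<approx>z. f z = g z"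
proof (cases "k \<ge> 3")
  case True
  then show ?thesis using unique_of_gap_ge_3[OF _ large f g rel] by blast
next
  case False
  then have k: "k = 2" using k2 by simp
  have "n \<noteq> 4"
  proof
    assume "n = 4"
    then have "m = 2" using nmk k by simp
    then show False using cop k by simp
  qed
  then show ?thesis using unique_of_gap_2[OF k _ f g rel] large by blast
qed

theorem strong_unique:
  assumes large: "n \<ge> 5 \<or> n = 4 \<and> (\<lambda>z. f (inverse z)) meromorphic_on UNIV \<and> (\<lambda>z. g (inverse z)) meromorphic_on UNIV"
    and f: "f meromorphic_on UNIV" "\<not> (\<exists>k. \<forall>\<^sub>\<approx>z. f z = k)"
    and g: "g meromorphic_on UNIV" "\<not> (\<exists>k. \<forall>\<^sub>\<approx>z. g z = k)"
    and rel: "\<forall>\<^sub>\<approx>z. poly T (f z) = c * poly T (g z)" and c0: "c \<noteq> 0" and b0: "b \<noteq> 0"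
  shows "c = 1"
proof (rule ccontr)
  assume c1: "c \<noteq> 1"
  have "n \<ge> 4" using large by auto
  then consider "n = 4" | "n = 5" | "n = 6" | "n \<ge> 7" by linarith
  then show False
  proof cases
    case 1
    have "m = 1"
    proof -
      have "m = 1 \<and> k = 3 \<or> m = 2 \<and> k = 2" using 1 nmk m1 k2 by linarith
      then show ?thesis using cop by auto
    qed
    then show False using strong_small[OF c0 c1 b0 _ large f g rel] by blast
  next
    case 2
    then show False using strong_small[OF c0 c1 b0 _ large f g rel] by blast
  next
    case 3
    have "m = 1"
    proof -
      have "m = 1 \<and> k = 5 \<or> m = 2 \<and> k = 4 \<or> m = 3 \<and> k = 3 \<or> m = 4 \<and> k = 2" using 3 nmk m1 k2 by linarith
      moreover have "\<not> (2 dvd k \<and> 2 dvd m)" "\<not> (3 dvd k \<and> 3 dvd m)"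
        using coprime_common_divisor[OF cop, of 2] coprime_common_divisor[OF cop, of 3] by auto
      ultimately show ?thesis by auto
    qed
    then show False using strong_small[OF c0 c1 b0 _ large f g rel] by blast
  next
    case 4
    then show False using strong_large[OF c0 c1 b0 _ f g rel] by blast
  qed
qed

end

subsection \<open>The quartic case\<close>

text \<open>The first coordinate of twice the point \<open>(t, y)\<close> on
  \<open>y^2 = t^3 + 1\<close>, that is, the square of the tangent slope
  \<open>3 * t^2 / (2 * y)\<close> minus \<open>2 * t\<close>.\<close>

definition duplication :: "complex \<Rightarrow> complex" where
  "duplication t = t * (t ^ 3 - 8) / (4 * (t ^ 3 + 1))"

lemma duplication_deriv:
  assumes "t ^ 3 + 1 \<noteq> 0"
  shows "(duplication has_field_derivative (t ^ 6 + 20 * t ^ 3 - 8) / (4 * (t ^ 3 + 1) ^ 2)) (at t)"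
proof -
  define N D where "N = (\<lambda>t::complex. t ^ 4 - 8 * t)" and "D = (\<lambda>t::complex. 4 * (t ^ 3 + 1))"
  have eq: "duplication = (\<lambda>t. N t / D t)"
    by (auto simp: duplication_def N_def D_def power3_eq_cube power4_eq_xxxx algebra_simps)
  have N: "(N has_field_derivative (4 * t ^ 3 - 8)) (at t)"
    unfolding N_def by (auto intro!: derivative_eq_intros)
  have D: "(D has_field_derivative (12 * t ^ 2)) (at t)"
    unfolding D_def by (auto intro!: derivative_eq_intros)
  have D0: "D t \<noteq> 0" unfolding D_def using assms by (subst mult_eq_0_iff) simp
  have "(duplication has_field_derivative ((4 * t ^ 3 - 8) * D t - N t * (12 * t ^ 2)) / (D t * D t)) (at t)"
    unfolding eq by (rule DERIV_divide[OF N D D0])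
  moreover have "((4 * t ^ 3 - 8) * D t - N t * (12 * t ^ 2)) / (D t * D t) = (t ^ 6 + 20 * t ^ 3 - 8) / (4 * (t ^ 3 + 1) ^ 2)"
  proof -
    have "((4 * t ^ 3 - 8) * D t - N t * (12 * t ^ 2)) * (4 * (t ^ 3 + 1) ^ 2) = (t ^ 6 + 20 * t ^ 3 - 8) * (D t * D t)"
      unfolding N_def D_def by algebra
    then show ?thesis using D0 assms by (simp add: frac_eq_eq)
  qed
  ultimately show ?thesis by simp
qed

text \<open>The squared quantity is the second coordinate of minus twice the point
  \<open>(t, q)\<close>. The negative is chosen because at \<open>t = 0\<close>,
  \<open>q = 1\<close> it equals 1, like \<open>q\<close>, so that both lie on the same branch of
  the square root.\<close>

lemma duplication_cubic:
  assumes "q ^ 2 = 1 + t ^ 3" "q \<noteq> 0"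
  shows "(- (t ^ 6 + 20 * t ^ 3 - 8) / (8 * q ^ 3)) ^ 2 = 1 + duplication t ^ 3"
proof -
  have q2: "t ^ 3 + 1 = q ^ 2" using assms(1) by simp
  have "duplication t = t * (t ^ 3 - 8) / (4 * q ^ 2)" by (simp add: duplication_def q2)
  moreover have "(4 * q ^ 2) ^ 3 = 64 * q ^ 6" by (simp add: power_mult_distrib flip: power_mult)
  ultimately have "duplication t ^ 3 = (t * (t ^ 3 - 8)) ^ 3 / (64 * q ^ 6)"
    by (simp only: power_divide)
  then have "1 + duplication t ^ 3 = (64 * q ^ 6 + (t * (t ^ 3 - 8)) ^ 3) / (64 * q ^ 6)"
    using assms(2) by (simp add: add_divide_distrib)
  moreover have "(t ^ 6 + 20 * t ^ 3 - 8) ^ 2 = 64 * q ^ 6 + (t * (t ^ 3 - 8)) ^ 3"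
    using q2 by algebra
  moreover have "(- (t ^ 6 + 20 * t ^ 3 - 8) / (8 * q ^ 3)) ^ 2 = (t ^ 6 + 20 * t ^ 3 - 8) ^ 2 / (64 * q ^ 6)"
    by (simp add: power_divide power_mult_distrib power2_commute flip: power_mult)
  ultimately show ?thesis by simp
qed

text \<open>
  The local inverse of the elliptic integral \<open>\<integral> dt / sqrt (1 + t\<^sup>3)\<close> parametrises
  \<open>y\<^sup>2 = x\<^sup>3 + 1\<close> with the 3-torsion point \<open>(0, 1)\<close> at the origin. As doubling maps that
  point to its negative, the duplication formula gives \<open>X (-2 z)\<close>, and its fixed point \<open>0\<close>
  is a point where \<open>X\<close> is regular.
\<close>

lemma elliptic_germ:
  obtains X r where "r > 0" "X holomorphic_on ball 0 r" "X 0 = 0"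
    "\<And>z. z \<in> ball 0 r \<Longrightarrow> deriv X z ^ 2 = X z ^ 3 + 1"
    "\<And>z. z \<in> ball 0 r \<Longrightarrow> X (- 2 * z) = duplication (X z)"
proof -
  define p where "p = (\<lambda>t::complex. csqrt (1 + t ^ 3))"
  have Re_pos: "Re (1 + t ^ 3) > 0" if "t \<in> ball 0 1" for t :: complex
  proof -
    have "norm (t ^ 3) < 1" using that by (simp add: norm_power power_less_one_iff)
    moreover have "\<bar>Re (t ^ 3)\<bar> \<le> norm (t ^ 3)" by (rule abs_Re_le_cmod)
    ultimately show ?thesis by simp
  qed
  then have nonneg: "1 + t ^ 3 \<notin> \<real>\<^sub>\<le>\<^sub>0" if "t \<in> ball 0 1" for t :: complex
    using that by (force simp: complex_nonpos_Reals_iff)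
  have p2: "p t ^ 2 = 1 + t ^ 3" for t by (simp add: p_def)
  have t0: "t ^ 3 + 1 \<noteq> 0" if "t \<in> ball 0 1" for t :: complex
    using Re_pos[OF that] by (metis add.commute less_irrefl zero_complex.simps(1))
  have p0: "p t \<noteq> 0" if "t \<in> ball 0 1" for t
    using t0[OF that] p2[of t] by (auto simp: add.commute)
  have p00: "p 0 = 1" by (simp add: p_def)
  have p: "p holomorphic_on ball 0 1" unfolding p_def
    by (intro holomorphic_intros nonneg) auto
  have "(\<lambda>t. 1 / p t) holomorphic_on ball 0 1" by (intro holomorphic_intros p p0)
  then obtain u0 where u0: "\<And>t. t \<in> ball 0 1 \<Longrightarrow> (u0 has_field_derivative 1 / p t) (at t within ball 0 1)"
    by (rule holomorphic_convex_primitive'[rotated 2]) auto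
  define u where "u = (\<lambda>t. u0 t - u0 0)"
  have du: "(u has_field_derivative 1 / p t) (at t)" if "t \<in> ball 0 1" for t
    using DERIV_diff[OF u0[OF that] DERIV_const[of "u0 0"]] that by (simp add: u_def at_within_open[OF that])
  have u00: "u 0 = 0" by (simp add: u_def)
  have u: "u holomorphic_on ball 0 1"
    unfolding holomorphic_on_open[OF open_ball] using du by blast
  have "deriv u 0 \<noteq> 0" using DERIV_imp_deriv[OF du[of 0]] by (simp add: p00)
  then obtain r0 where r0: "r0 > 0" "ball (0::complex) r0 \<subseteq> ball 0 1" "open (u ` ball 0 r0)" "inj_on u (ball 0 r0)"
    by (rule has_complex_derivative_locally_invertible[OF u centre_in_ball[THEN iffD2, OF zero_less_one] open_ball]) (rule that)
  define S where "S = ball (0::complex) r0"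
  have uS: "u holomorphic_on S" using u r0(2) holomorphic_on_subset by (auto simp: S_def)
  obtain X where X: "X holomorphic_on u ` S" "\<And>t. t \<in> S \<Longrightarrow> deriv u t * deriv X (u t) = 1" "\<And>t. t \<in> S \<Longrightarrow> X (u t) = t"
    using holomorphic_has_inverse[OF uS] r0 by (auto simp: S_def)
  have ode: "deriv X (u t) ^ 2 = X (u t) ^ 3 + 1" if "t \<in> S" for t
  proof -
    have tb: "t \<in> ball 0 1" using that r0 by (auto simp: S_def)
    have "deriv u t = 1 / p t" using DERIV_imp_deriv[OF du[OF tb]] .
    then have "deriv X (u t) / p t = 1" using X(2)[OF that] by simp
    then have "deriv X (u t) = p t" using p0[OF tb] by simp
    then show ?thesis using p2[of t] X(3)[OF that] by simp
  qed
  \<comment> \<open>The second coordinate of minus twice the point \<open>(t, p t)\<close>. Since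
    \<open>w 0 = 1\<close>, its real part is positive near 0, which identifies it with the principal
    root \<open>p (duplication t)\<close>.\<close>
  define w where "w = (\<lambda>t. - (t ^ 6 + 20 * t ^ 3 - 8) / (8 * p t ^ 3))"
  have contp: "isCont p 0" using holomorphic_on_imp_continuous_on[OF p] by (auto simp: continuous_on_eq_continuous_at)
  have "isCont w 0" unfolding w_def
    by (intro isCont_divide isCont_minus isCont_diff isCont_add isCont_mult isCont_power contp
        continuous_const continuous_ident) (simp add: p00)
  then have "(w \<longlongrightarrow> w 0) (nhds 0)" by (simp add: isCont_def tendsto_at_iff_tendsto_nhds)
  then have "((\<lambda>t. Re (w t)) \<longlongrightarrow> Re (w 0)) (nhds 0)" by (rule tendsto_Re)
  moreover have "Re (w 0) = 1" by (simp add: w_def p00)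
  ultimately have ev1: "\<forall>\<^sub>F t in nhds 0. Re (w t) > 0"
    by (intro order_tendstoD(1)[of _ "Re (w 0)"]) auto
  have contR: "isCont duplication 0" unfolding duplication_def by (intro continuous_intros) auto
  have R0: "duplication 0 = 0" by (simp add: duplication_def)
  have "\<forall>\<^sub>F t in nhds 0. duplication t \<in> S"
  proof -
    have "(duplication \<longlongrightarrow> duplication 0) (nhds 0)" using contR by (simp only: isCont_def tendsto_at_iff_tendsto_nhds)
    from topological_tendstoD[OF this, of S] show ?thesis using R0 r0(1) by (simp add: S_def)
  qed
  with ev1 have "\<forall>\<^sub>F t in nhds 0. Re (w t) > 0 \<and> duplication t \<in> S" by eventually_elim simp
  then obtain d0 where d0: "d0 > 0" "\<And>t. dist t 0 < d0 \<Longrightarrow> Re (w t) > 0 \<and> duplication t \<in> S"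
    unfolding eventually_nhds_metric by blast
  define \<delta> where "\<delta> = min d0 r0"
  have \<delta>: "\<delta> > 0" using d0 r0 by (simp add: \<delta>_def)
  have \<delta>S: "t \<in> S" "t \<in> ball 0 1" "Re (w t) > 0" "duplication t \<in> S" "duplication t \<in> ball 0 1" if "t \<in> ball 0 \<delta>" for t
    using that d0(2)[of t] r0(2) by (auto simp: \<delta>_def S_def subset_iff)
  \<comment> \<open>\<open>u\<close> is the elliptic integral. With the branch fixed by
    \<open>w\<close>, the differential \<open>dt / p t\<close> pulls back under duplication to its
    multiple by -2, and both sides vanish at 0. The inverse \<open>X\<close> of \<open>u\<close>
    inherits the equation.\<close>
  have fe: "u (duplication t) = - 2 * u t" if t: "t \<in> ball 0 \<delta>" for t
  proof -
    have "((\<lambda>t. u (duplication t) + 2 * u t) has_field_derivative 0) (at s)" if s: "s \<in> ball 0 \<delta>" for s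
    proof -
      have "(w s) ^ 2 = 1 + duplication s ^ 3" unfolding w_def by (rule duplication_cubic) (use p2 p0 \<delta>S[OF s] in auto)
      then have pR: "p (duplication s) = w s" unfolding p_def using \<delta>S(3)[OF s] by (intro csqrt_unique) auto
      have "((\<lambda>t. u (duplication t)) has_field_derivative (1 / p (duplication s)) * ((s ^ 6 + 20 * s ^ 3 - 8) / (4 * (s ^ 3 + 1) ^ 2))) (at s)"
        by (rule DERIV_chain2[OF du duplication_deriv]) (use \<delta>S[OF s] t0 in auto)
      then have "((\<lambda>t. u (duplication t) + 2 * u t) has_field_derivative
          (1 / p (duplication s)) * ((s ^ 6 + 20 * s ^ 3 - 8) / (4 * (s ^ 3 + 1) ^ 2)) + 2 * (1 / p s)) (at s)"
        by (rule DERIV_add[OF _ DERIV_cmult[OF du]]) (use \<delta>S[OF s] in auto)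
      moreover have "(1 / p (duplication s)) * ((s ^ 6 + 20 * s ^ 3 - 8) / (4 * (s ^ 3 + 1) ^ 2)) + 2 * (1 / p s) = 0"
      proof -
        define e where "e = s ^ 6 + 20 * s ^ 3 - 8"
        have ps: "p s \<noteq> 0" by (rule p0) (use \<delta>S[OF s] in auto)
        have w: "w s = - e / (8 * p s ^ 3)" by (simp add: w_def e_def)
        then have e: "e \<noteq> 0" using \<delta>S(3)[OF s] by auto
        have q: "s ^ 3 + 1 = p s ^ 2" using p2[of s] by simp
        have "1 / w s * (e / (4 * (p s ^ 2) ^ 2)) = - 2 * (1 / p s)"
          using ps e by (simp add: w field_simps power2_eq_square power3_eq_cube)
        then show ?thesis unfolding pR e_def[symmetric] q by simp
      qed
      ultimately show ?thesis by simp
    qed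
    then have "\<exists>c. \<forall>s\<in>ball 0 \<delta>. u (duplication s) + 2 * u s = c"
      by (intro has_field_derivative_zero_constant) (auto intro: has_field_derivative_at_within)
    then obtain c where c: "\<And>s. s \<in> ball 0 \<delta> \<Longrightarrow> u (duplication s) + 2 * u s = c" by blast
    have "c = 0" using c[of 0] \<delta> by (simp add: R0 u00)
    then show ?thesis using c[OF t] by (simp add: eq_neg_iff_add_eq_0)
  qed
  have 0: "0 \<in> S" using r0 by (simp add: S_def)
  then have X0: "X 0 = 0" using X(3)[of 0] u00 by simp
  have zS: "0 \<in> u ` S" using 0 u00 by force
  have op: "open (u ` S)" using r0 by (simp add: S_def)
  have "open (u ` S \<inter> X -` ball 0 \<delta>)"
    by (rule continuous_open_preimage[OF holomorphic_on_imp_continuous_on[OF X(1)] op]) auto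
  moreover have "0 \<in> u ` S \<inter> X -` ball 0 \<delta>" using zS X0 \<delta> by simp
  ultimately obtain r where r: "r > 0" "ball 0 r \<subseteq> u ` S \<inter> X -` ball 0 \<delta>"
    by (meson openE)
  show thesis
  proof (rule that[of r X])
    show "r > 0" "X 0 = 0" by (fact r(1), fact X0)
    show "X holomorphic_on ball 0 r" using X(1) r(2) holomorphic_on_subset by blast
    fix z :: complex assume z: "z \<in> ball 0 r"
    then obtain t where t: "t \<in> S" "z = u t" and Xd: "X z \<in> ball 0 \<delta>" using r(2) by blast
    show "deriv X z ^ 2 = X z ^ 3 + 1" using ode[OF t(1)] t(2) by simp
    have Xz: "X z = t" using X(3) t by simp
    then have td: "t \<in> ball 0 \<delta>" using Xd by simp
    have "X (- 2 * z) = X (u (duplication t))" using fe[OF td] t(2) by simp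
    also have "\<dots> = duplication t" using X(3) \<delta>S(4)[OF td] by simp
    finally show "X (- 2 * z) = duplication (X z)" using Xz by simp
  qed
qed

lemma meromorphic_duplication_iterate:
  "f meromorphic_on A \<Longrightarrow> (\<lambda>z. (duplication ^^ j) (f z)) meromorphic_on A"
proof (induction j)
  case (Suc j)
  then show ?case by (auto simp: duplication_def intro!: meromorphic_intros)
qed simp

text \<open>
  The functional equation extends the germ to the whole plane: on \<open>ball 0 (r * 2 ^ j)\<close> the
  function is the \<open>j\<close>-th iterate of the duplication map applied to \<open>X (z / (-2) ^ j)\<close>.
\<close>

lemma elliptic_function_exists:
  obtains X where "X meromorphic_on UNIV" "\<not> (\<exists>k. \<forall>\<^sub>\<approx>z. X z = k)" "\<forall>\<^sub>\<approx>z. deriv X z ^ 2 = X z ^ 3 + 1"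
proof -
  obtain X0 r where r: "r > 0" and hol: "X0 holomorphic_on ball 0 r" and X00: "X0 0 = 0"
    and ode: "\<And>z. z \<in> ball 0 r \<Longrightarrow> deriv X0 z ^ 2 = X0 z ^ 3 + 1"
    and fe: "\<And>z. z \<in> ball 0 r \<Longrightarrow> X0 (- 2 * z) = duplication (X0 z)"
  proof (rule elliptic_germ)
    fix X r
    assume *: "r > 0" "X holomorphic_on ball 0 r" "X 0 = 0"
      "\<And>z. z \<in> ball 0 r \<Longrightarrow> deriv X z ^ 2 = X z ^ 3 + 1"
      "\<And>z. z \<in> ball 0 r \<Longrightarrow> X (- 2 * z) = duplication (X z)"
    show thesis by (rule that[OF *])
  qed
  define F where "F = (\<lambda>j z. (duplication ^^ j) (X0 (z / (- 2) ^ j)))"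
  have FSuc: "F (Suc j) z = F j z" if "norm z < r * 2 ^ j" for j z
  proof -
    define w where "w = z / (- 2) ^ Suc j"
    have "norm w = norm z / 2 ^ Suc j" by (simp add: w_def norm_divide norm_mult norm_power)
    also have "\<dots> < r * 2 ^ Suc j / 2 ^ Suc j"
    proof (rule divide_strict_right_mono)
      have "r * 2 ^ j \<le> r * 2 ^ Suc j" using r by (intro mult_left_mono power_increasing) auto
      then show "norm z < r * 2 ^ Suc j" using that by linarith
    qed simp
    also have "\<dots> = r" by simp
    finally have "w \<in> ball 0 r" by simp
    then have "duplication (X0 w) = X0 (- 2 * w)" using fe by simp
    also have "- 2 * w = z / (- 2) ^ j" by (simp add: w_def)
    finally show ?thesis by (simp add: F_def w_def funpow_swap1)
  qed
  have Fle: "F (j + i) z = F j z" if "norm z < r * 2 ^ j" for i j z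
  proof (induction i)
    case (Suc i)
    have "r * 2 ^ j \<le> r * 2 ^ (j + i)" using r by (intro mult_left_mono power_increasing) auto
    then have "F (Suc (j + i)) z = F (j + i) z" using that by (intro FSuc) simp
    then show ?case using Suc by simp
  qed simp
  define X where "X = (\<lambda>z. F (LEAST j. norm z < r * 2 ^ j) z)"
  have XF: "X z = F j z" if "norm z < r * 2 ^ j" for z j
  proof -
    define l where "l = (LEAST j. norm z < r * 2 ^ j)"
    have "norm z < r * 2 ^ l" unfolding l_def using that by (rule LeastI)
    moreover have "l \<le> j" unfolding l_def using that by (rule Least_le)
    ultimately show ?thesis using Fle[of z l "j - l"] by (simp add: X_def l_def)
  qed
  have "X meromorphic_on {z}" for z
  proof -
    obtain j where j: "norm z / r < 2 ^ j" using real_arch_pow[of 2 "norm z / r"] by auto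
    then have zj: "norm z < r * 2 ^ j" using r by (simp add: field_simps)
    have "(\<lambda>z. X0 (z / (- 2) ^ j)) analytic_on {z}"
    proof -
      have "norm (z / (- 2) ^ j) < r" using zj by (simp add: norm_divide norm_power field_simps)
      then have "X0 analytic_on {z / (- 2) ^ j}" using hol by (auto simp: analytic_at intro!: exI[of _ "ball 0 r"])
      then have "(X0 \<circ> (\<lambda>z. z / (- 2) ^ j)) analytic_on {z}"
        by (intro analytic_on_compose) (auto intro!: analytic_intros)
      then show ?thesis by (simp add: o_def)
    qed
    then have "F j meromorphic_on {z}" unfolding F_def
      by (intro meromorphic_duplication_iterate analytic_on_imp_meromorphic_on)
    moreover have "\<forall>\<^sub>F w in at z. X w = F j w"
    proof -
      have "\<forall>\<^sub>F w in at z. w \<in> ball 0 (r * 2 ^ j)" using zj by (intro eventually_at_in_open') auto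
      then show ?thesis by eventually_elim (simp add: XF)
    qed
    then have "X meromorphic_on {z} \<longleftrightarrow> F j meromorphic_on {z}"
      by (intro meromorphic_on_cong) auto
    ultimately show ?thesis by simp
  qed
  then have X: "X meromorphic_on UNIV" by (subst meromorphic_on_meromorphic_at) blast
  have XX0: "X z = X0 z" if "z \<in> ball 0 r" for z
    using XF[of z 0] that by (simp add: F_def)
  have dX: "deriv X z = deriv X0 z" if "z \<in> ball 0 r" for z
  proof (rule deriv_cong_ev)
    have "\<forall>\<^sub>F w in nhds z. w \<in> ball 0 r" using that by (intro eventually_nhds_in_open) auto
    then show "\<forall>\<^sub>F w in nhds z. X w = X0 w" by eventually_elim (rule XX0)
  qed simp
  have near0: "\<forall>\<^sub>F z in at 0. z \<in> ball 0 r" using r by (intro eventually_at_in_open') auto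
  have "\<forall>\<^sub>\<approx>z. deriv X z ^ 2 - (X z ^ 3 + 1) = 0"
  proof -
    have "(\<lambda>z. deriv X z ^ 2 - (X z ^ 3 + 1)) meromorphic_on UNIV" by (intro meromorphic_intros X)
    \<comment> \<open>The defect of the differential equation is meromorphic on the plane and
      vanishes on the initial disc, so it cannot be nonzero off a sparse set.\<close>
    from meromorphic_imp_constant_or_avoid[OF this, of 0]
    consider "\<forall>\<^sub>\<approx>z. deriv X z ^ 2 - (X z ^ 3 + 1) = 0" | "\<forall>\<^sub>\<approx>z. deriv X z ^ 2 - (X z ^ 3 + 1) \<noteq> 0" by auto
    then show ?thesis
    proof cases
      case 2
      then have "\<forall>\<^sub>F z in at 0. deriv X z ^ 2 - (X z ^ 3 + 1) \<noteq> 0"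
        using eventually_cosparse_imp_eventually_at[of _ UNIV 0 UNIV] by simp
      with near0 have "\<forall>\<^sub>F z in at (0::complex). False" by eventually_elim (simp add: dX XX0 ode)
      then show ?thesis by simp
    qed
  qed
  then have odeX: "\<forall>\<^sub>\<approx>z. deriv X z ^ 2 = X z ^ 3 + 1" by eventually_elim simp
  have "\<not> (\<exists>k. \<forall>\<^sub>\<approx>z. X z = k)"
  proof
    assume "\<exists>k. \<forall>\<^sub>\<approx>z. X z = k"
    then obtain k where "\<forall>\<^sub>\<approx>z. X z = k" by blast
    then have "\<forall>\<^sub>\<approx>z\<in>ball 0 r. X z = k" by (rule cosparse_ball_mono) simp
    moreover have "\<forall>\<^sub>\<approx>z\<in>ball 0 r. z \<in> ball (0::complex) r" by (rule eventually_in_cosparse) auto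
    ultimately have "\<forall>\<^sub>\<approx>z\<in>ball 0 r. X0 z = k" by eventually_elim (simp add: XX0)
    then have k: "X0 z = k" if "z \<in> ball 0 r" for z
      by (rule continuous_cosparse_eq[rotated 3])
         (use that hol in \<open>auto intro: holomorphic_on_imp_continuous_on\<close>)
    have "deriv X0 0 = deriv (\<lambda>_. k) 0"
    proof (rule deriv_cong_ev)
      have "\<forall>\<^sub>F w in nhds 0. w \<in> ball (0::complex) r" using r by (intro eventually_nhds_in_open) auto
      then show "\<forall>\<^sub>F w in nhds 0. X0 w = k" by eventually_elim (rule k)
    qed simp
    then show False using ode[of 0] r X00 by simp
  qed
  with X odeX that show thesis by blast
qed

text \<open>Off the diagonal the equation reads \<open>(f + g) * (f^2 + g^2) + a = 0\<close>. With
  \<open>s = f + g\<close> and \<open>f - g = s * \<i> * y\<close> it becomes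
  \<open>s^3 * (1 - y^2) = - 2 * a\<close>, and \<open>s = \<sigma> / x\<close> with
  \<open>\<sigma>^3 = 2 * a\<close> turns this into \<open>y^2 = x^3 + 1\<close>, which is solved by
  \<open>y = deriv x\<close>.\<close>

lemma quartic_counterexample:
  assumes a: "a \<noteq> 0"
  obtains f g where "f meromorphic_on UNIV" "\<not> (\<exists>k. \<forall>\<^sub>\<approx>z. f z = k)"
    "g meromorphic_on UNIV" "\<not> (\<exists>k. \<forall>\<^sub>\<approx>z. g z = k)"
    "\<forall>\<^sub>\<approx>z. f z ^ 4 + a * f z = g z ^ 4 + a * g z" "\<not> (\<forall>\<^sub>\<approx>z. f z = g z)"
proof -
  obtain x where x: "x meromorphic_on UNIV" "\<not> (\<exists>k. \<forall>\<^sub>\<approx>z. x z = k)" and ode: "\<forall>\<^sub>\<approx>z. deriv x z ^ 2 = x z ^ 3 + 1"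
    by (rule elliptic_function_exists)
  define \<sigma> where "\<sigma> = exp (Ln (2 * a) / 3)"
  have \<sigma>: "\<sigma> ^ 3 = 2 * a" "\<sigma> \<noteq> 0" using a by (simp_all add: \<sigma>_def flip: exp_of_nat_mult)
  have x0: "\<forall>\<^sub>\<approx>z. x z \<noteq> 0" using meromorphic_poly_nonzero_cosparse[OF x, of "[:0,1:]"] by simp
  have x31: "\<forall>\<^sub>\<approx>z. x z ^ 3 + 1 \<noteq> 0"
    using meromorphic_poly_nonzero_cosparse[OF x, of "[:1, 0, 0, 1:]"]
    by (simp add: power3_eq_cube add.commute mult.assoc)
  define F where "F = (\<lambda>\<epsilon> z. \<sigma> * (1 + \<epsilon> * \<i> * deriv x z) / (2 * x z))"
  have F: "F \<epsilon> meromorphic_on UNIV" for \<epsilon> unfolding F_def by (intro meromorphic_intros x)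
  have nc: "\<not> (\<exists>k. \<forall>\<^sub>\<approx>z. F \<epsilon> z = k)" if \<epsilon>: "\<epsilon>^2 = 1" for \<epsilon>
  proof
    assume "\<exists>k. \<forall>\<^sub>\<approx>z. F \<epsilon> z = k"
    then obtain k where k: "\<forall>\<^sub>\<approx>z. F \<epsilon> z = k" by blast
    \<comment> \<open>A constant value \<open>k\<close> would give
      \<open>\<epsilon> * \<i> * deriv x z = l * x z - 1\<close>. Squaring and inserting the
      differential equation leaves a monic cubic satisfied by \<open>x\<close>, which would then be
      constant.\<close>
    define l where "l = 2 * k / \<sigma>"
    have "\<forall>\<^sub>\<approx>z. poly [:2, - 2 * l, l^2, 1:] (x z) = 0"
      using k x0 ode
    proof eventually_elim
      case (elim z)
      have "\<epsilon> * \<i> * deriv x z = l * x z - 1"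
        using elim(1,2) \<sigma>(2) by (auto simp: F_def l_def field_simps)
      then have "(\<epsilon> * \<i> * deriv x z)^2 = (l * x z - 1)^2" by simp
      then have "- (x z ^ 3 + 1) = (l * x z - 1)^2"
        using \<epsilon> elim(3) by (simp add: power_mult_distrib)
      then show ?case by (simp add: algebra_simps power2_eq_square power3_eq_cube eq_neg_iff_add_eq_0 neg_eq_iff_add_eq_0)
    qed
    then have "\<exists>k. \<forall>\<^sub>\<approx>z. x z = k" by (rule meromorphic_poly_eq_0_imp_const[OF x(1), rotated]) simp
    then show False using x(2) by blast
  qed
  show thesis
  proof (rule that[of "F 1" "F (-1)"])
    show "F 1 meromorphic_on UNIV" "F (-1) meromorphic_on UNIV" by (rule F)+
    show "\<not> (\<exists>k. \<forall>\<^sub>\<approx>z. F 1 z = k)" "\<not> (\<exists>k. \<forall>\<^sub>\<approx>z. F (-1) z = k)" by (rule nc; simp)+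
    show "\<forall>\<^sub>\<approx>z. F 1 z ^ 4 + a * F 1 z = F (-1) z ^ 4 + a * F (-1) z"
      using x0 ode
    proof eventually_elim
      case (elim z)
      define p q where "p = F 1 z" and "q = F (-1) z"
      have sum: "p + q = \<sigma> / x z" and diff: "p - q = (p + q) * (\<i> * deriv x z)"
        using elim(1) by (simp_all add: p_def q_def F_def field_simps)
      have "(p + q) ^ 3 * x z ^ 3 = 2 * a" using elim(1) \<sigma>(1) by (simp add: sum power_divide)
      moreover have "(\<i> * deriv x z) ^ 2 = - (x z ^ 3 + 1)" using elim(2) by (simp add: power_mult_distrib)
      ultimately have "2 * ((p + q) * (p^2 + q^2) + a) = 0" using diff by algebra
      then have "(p + q) * (p^2 + q^2) + a = 0" by (metis mult_eq_0_iff zero_neq_numeral)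
      then show ?case unfolding p_def[symmetric] q_def[symmetric] by algebra
    qed
    show "\<not> (\<forall>\<^sub>\<approx>z. F 1 z = F (-1) z)"
    proof
      assume "\<forall>\<^sub>\<approx>z. F 1 z = F (-1) z"
      with x0 x31 ode have "\<forall>\<^sub>\<approx>z::complex. False"
      proof eventually_elim
        case (elim z)
        have "deriv x z = 0" using elim(1,4) \<sigma>(2) by (simp add: F_def field_simps)
        then show ?case using elim(2,3) by simp
      qed
      then show False by simp
    qed
  qed
qed

subsection \<open>Rational functions as meromorphic functions\<close>

text \<open>Numerator and denominator are chosen arbitrarily, without reduction, so the function
  built from them has artificial values at common zeros. Identities for it are therefore stated off
  sparse sets.\<close>

definition fract_repr :: "complex poly fract \<Rightarrow> complex poly \<times> complex poly" where
  "fract_repr q = (SOME p. snd p \<noteq> 0 \<and> q = to_fract (fst p) / to_fract (snd p))"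

lemma fract_repr: "snd (fract_repr q) \<noteq> 0" "q = to_fract (fst (fract_repr q)) / to_fract (snd (fract_repr q))"
proof -
  obtain p1 p2 where "q = Fract p1 p2" "p2 \<noteq> 0" by (cases q)
  then have "snd (p1, p2) \<noteq> 0 \<and> q = to_fract (fst (p1, p2)) / to_fract (snd (p1, p2))"
    by (simp add: Fract_conv_to_fract)
  then have "snd (fract_repr q) \<noteq> 0 \<and> q = to_fract (fst (fract_repr q)) / to_fract (snd (fract_repr q))"
    unfolding fract_repr_def by (rule someI)
  then show "snd (fract_repr q) \<noteq> 0" "q = to_fract (fst (fract_repr q)) / to_fract (snd (fract_repr q))" by blast+
qed

definition rat_fun :: "complex poly fract \<Rightarrow> complex \<Rightarrow> complex" where
  "rat_fun q z = poly (fst (fract_repr q)) z / poly (snd (fract_repr q)) z"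

lemma poly_nonzero_cosparse:
  fixes p :: "complex poly"
  assumes "p \<noteq> 0" shows "\<forall>\<^sub>\<approx>z. poly p z \<noteq> 0"
proof -
  have "{z. poly p z = 0} sparse_in UNIV" using poly_roots_finite[OF assms] by (rule finite_imp_sparse)
  then show ?thesis by (simp add: eventually_cosparse)
qed

lemma rat_fun_fraction:
  assumes "p2 \<noteq> 0"
  shows "\<forall>\<^sub>\<approx>z. rat_fun (to_fract p1 / to_fract p2) z = poly p1 z / poly p2 z"
proof -
  define a b where "a = fst (fract_repr (to_fract p1 / to_fract p2))" and "b = snd (fract_repr (to_fract p1 / to_fract p2))"
  have b: "b \<noteq> 0" unfolding b_def by (rule fract_repr)
  have "to_fract p1 / to_fract p2 = to_fract a / to_fract b"
    unfolding a_def b_def by (rule fract_repr)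
  then have "to_fract (p1 * b) = to_fract (a * p2)" using b assms by (simp add: frac_eq_eq)
  then have eq: "p1 * b = a * p2" by (simp only: to_fract_eq_iff)
  show ?thesis using poly_nonzero_cosparse[OF b] poly_nonzero_cosparse[OF assms]
  proof eventually_elim
    case (elim z)
    have "poly p1 z * poly b z = poly a z * poly p2 z" using arg_cong[OF eq, of "\<lambda>p. poly p z"] by simp
    then show ?case using elim by (simp add: rat_fun_def a_def[symmetric] b_def[symmetric] frac_eq_eq)
  qed
qed

lemma fract_cases_to_fract:
  fixes q :: "complex poly fract"
  obtains p1 p2 where "q = to_fract p1 / to_fract p2" "p2 \<noteq> 0"
  by (rule that[OF fract_repr(2,1)])

lemma rat_fun_add: "\<forall>\<^sub>\<approx>z. rat_fun (x + y) z = rat_fun x z + rat_fun y z"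
proof -
  obtain p1 p2 where x: "x = to_fract p1 / to_fract p2" "p2 \<noteq> 0" by (rule fract_cases_to_fract)
  obtain q1 q2 where y: "y = to_fract q1 / to_fract q2" "q2 \<noteq> 0" by (rule fract_cases_to_fract)
  have eq: "x + y = to_fract (p1 * q2 + q1 * p2) / to_fract (p2 * q2)"
    using x y by (simp add: add_frac_eq)
  have "\<forall>\<^sub>\<approx>z. rat_fun (x + y) z = poly (p1 * q2 + q1 * p2) z / poly (p2 * q2) z"
    unfolding eq by (rule rat_fun_fraction) (use x y in simp)
  with rat_fun_fraction[OF x(2), of p1] rat_fun_fraction[OF y(2), of q1] poly_nonzero_cosparse[OF x(2)] poly_nonzero_cosparse[OF y(2)]
  show ?thesis unfolding x(1)[symmetric] y(1)[symmetric] by eventually_elim (simp add: add_frac_eq)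
qed

lemma rat_fun_mult: "\<forall>\<^sub>\<approx>z. rat_fun (x * y) z = rat_fun x z * rat_fun y z"
proof -
  obtain p1 p2 where x: "x = to_fract p1 / to_fract p2" "p2 \<noteq> 0" by (rule fract_cases_to_fract)
  obtain q1 q2 where y: "y = to_fract q1 / to_fract q2" "q2 \<noteq> 0" by (rule fract_cases_to_fract)
  have eq: "x * y = to_fract (p1 * q1) / to_fract (p2 * q2)" using x y by simp
  have "\<forall>\<^sub>\<approx>z. rat_fun (x * y) z = poly (p1 * q1) z / poly (p2 * q2) z"
    unfolding eq by (rule rat_fun_fraction) (use x y in simp)
  with rat_fun_fraction[OF x(2), of p1] rat_fun_fraction[OF y(2), of q1]
  show ?thesis unfolding x(1)[symmetric] y(1)[symmetric] by eventually_elim simp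
qed

lemma rat_fun_const: "\<forall>\<^sub>\<approx>z. rat_fun (rat_const c) z = c"
  using rat_fun_fraction[of 1 "[:c:]"] by (simp add: rat_const_def)

lemma to_fract_power: "to_fract (p ^ j) = to_fract p ^ j"
  by (induction j) simp_all

lemma rat_eval_0 [simp]: "rat_eval 0 f = 0"
  by (simp add: rat_eval_def)

lemma rat_const_0 [simp]: "rat_const 0 = 0" and rat_const_1 [simp]: "rat_const 1 = 1"
  by (simp_all add: rat_const_def one_pCons[symmetric])

lemma rat_const_add: "rat_const (x + y) = rat_const x + rat_const y"
  and rat_const_mult: "rat_const (x * y) = rat_const x * rat_const y"
  and rat_const_uminus: "rat_const (- x) = - rat_const x"
  by (simp_all add: rat_const_def flip: to_fract_add to_fract_mult to_fract_uminus)

lemma rat_const_power: "rat_const (x ^ j) = rat_const x ^ j"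
  by (induction j) (simp_all add: rat_const_mult)

lemma rat_eval_pCons [simp]: "rat_eval (pCons c p) f = rat_const c + f * rat_eval p f"
  by (cases "p = 0 \<and> c = 0") (auto simp: rat_eval_def map_poly_pCons)

lemma rat_eval_add: "rat_eval (p + q) f = rat_eval p f + rat_eval q f"
  by (induction p q rule: poly_induct2) (simp_all add: rat_const_add algebra_simps)

lemma rat_eval_smult: "rat_eval (smult c p) f = rat_const c * rat_eval p f"
  by (induction p) (simp_all add: rat_const_mult algebra_simps)

lemma rat_eval_mult: "rat_eval (p * q) f = rat_eval p f * rat_eval q f"
  by (induction p) (simp_all add: rat_eval_add rat_eval_smult algebra_simps)

lemma rat_eval_power: "rat_eval (p ^ j) f = rat_eval p f ^ j"
  by (induction j) (simp_all add: rat_eval_mult one_pCons)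

lemma rat_fun_rat_eval: "\<forall>\<^sub>\<approx>z. rat_fun (rat_eval P f) z = poly P (rat_fun f z)"
proof (induction P)
  case 0
  show ?case using rat_fun_const[of 0] by simp
next
  case (pCons c P)
  show ?case
    using pCons.IH rat_fun_const[of c] rat_fun_add[of "rat_const c" "f * rat_eval P f"] rat_fun_mult[of f "rat_eval P f"]
    by eventually_elim simp
qed

lemma rat_fun_eq_imp_eq:
  assumes "\<forall>\<^sub>\<approx>z. rat_fun x z = rat_fun y z" shows "x = y"
proof -
  obtain p1 p2 where x: "x = to_fract p1 / to_fract p2" "p2 \<noteq> 0" by (rule fract_cases_to_fract)
  obtain q1 q2 where y: "y = to_fract q1 / to_fract q2" "q2 \<noteq> 0" by (rule fract_cases_to_fract)
  have "p1 * q2 - q1 * p2 = 0"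
  proof (rule ccontr)
    assume "p1 * q2 - q1 * p2 \<noteq> 0"
    from poly_nonzero_cosparse[OF this] have "\<forall>\<^sub>\<approx>z. poly (p1 * q2 - q1 * p2) z \<noteq> 0" .
    with assms rat_fun_fraction[OF x(2), of p1] rat_fun_fraction[OF y(2), of q1]
      poly_nonzero_cosparse[OF x(2)] poly_nonzero_cosparse[OF y(2)]
    have "\<forall>\<^sub>\<approx>z::complex. False"
      unfolding x(1)[symmetric] y(1)[symmetric] by eventually_elim (simp add: frac_eq_eq)
    then show False by simp
  qed
  then have "to_fract (p1 * q2) = to_fract (q1 * p2)" by simp
  then show ?thesis using x y by (simp add: frac_eq_eq)
qed

lemma rat_fun_meromorphic: "rat_fun f meromorphic_on UNIV" "(\<lambda>z. rat_fun f (inverse z)) meromorphic_on UNIV"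
  unfolding rat_fun_def by (intro meromorphic_intros)+

lemma rat_fun_nonconstant:
  assumes "nonconstant_rational f" shows "\<not> (\<exists>k. \<forall>\<^sub>\<approx>z. rat_fun f z = k)"
proof
  assume "\<exists>k. \<forall>\<^sub>\<approx>z. rat_fun f z = k"
  then obtain k where "\<forall>\<^sub>\<approx>z. rat_fun f z = k" by blast
  then have "\<forall>\<^sub>\<approx>z. rat_fun f z = rat_fun (rat_const k) z" using rat_fun_const[of k] by eventually_elim simp
  then have "f = rat_const k" by (rule rat_fun_eq_imp_eq)
  then show False using assms by (auto simp: nonconstant_rational_def)
qed

lemma rat_fun_equation:
  assumes "rat_eval P f = rat_const c * rat_eval P g"
  shows "\<forall>\<^sub>\<approx>z. poly P (rat_fun f z) = c * poly P (rat_fun g z)"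
  using rat_fun_const[of c] rat_fun_rat_eval[of P f] rat_fun_rat_eval[of P g] rat_fun_mult[of "rat_const c" "rat_eval P g"]
  unfolding assms[symmetric] by eventually_elim simp

text \<open>Rational functions are among the meromorphic ones, so the rational pairs that prove
  necessity settle the meromorphic statements too, apart from \<open>n = 4\<close>.\<close>

lemma strong_uniqueness_meromorphic_imp_rational:
  assumes "strong_uniqueness_poly_meromorphic P" shows "strong_uniqueness_poly_rational P"
  unfolding strong_uniqueness_poly_rational_def
proof (intro allI impI)
  fix f g c
  assume "nonconstant_rational f" "nonconstant_rational g" "c \<noteq> 0" "rat_eval P f = rat_const c * rat_eval P g"
  then have "c = 1 \<and> (\<forall>\<^sub>\<approx>z. rat_fun f z = rat_fun g z)"
    using assms rat_fun_equation[of P f c g] rat_fun_nonconstant rat_fun_meromorphic(1)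
    unfolding strong_uniqueness_poly_meromorphic_def nonconstant_meromorphic_def by blast
  then show "c = 1 \<and> f = g" using rat_fun_eq_imp_eq by blast
qed

lemma uniqueness_meromorphic_imp_rational:
  assumes "uniqueness_poly_meromorphic P" shows "uniqueness_poly_rational P"
  unfolding uniqueness_poly_rational_def
proof (intro allI impI)
  fix f g
  assume "nonconstant_rational f" "nonconstant_rational g" "rat_eval P f = rat_eval P g"
  then have "\<forall>\<^sub>\<approx>z. rat_fun f z = rat_fun g z"
    using assms rat_fun_equation[of P f 1 g] rat_fun_nonconstant rat_fun_meromorphic(1)
    unfolding uniqueness_poly_meromorphic_def nonconstant_meromorphic_def by simp
  then show "f = g" by (rule rat_fun_eq_imp_eq)
qed

lemma strong_uniqueness_imp_uniqueness:
  "strong_uniqueness_poly_meromorphic P \<Longrightarrow> uniqueness_poly_meromorphic P"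
  "strong_uniqueness_poly_rational P \<Longrightarrow> uniqueness_poly_rational P"
proof -
  assume s: "strong_uniqueness_poly_meromorphic P"
  show "uniqueness_poly_meromorphic P"
    unfolding uniqueness_poly_meromorphic_def
  proof (intro allI impI)
    fix f g assume "nonconstant_meromorphic f" "nonconstant_meromorphic g" "\<forall>\<^sub>\<approx>z. poly P (f z) = poly P (g z)"
    then show "\<forall>\<^sub>\<approx>z. f z = g z"
      using s[unfolded strong_uniqueness_poly_meromorphic_def, rule_format, of f g 1] by simp
  qed
next
  assume s: "strong_uniqueness_poly_rational P"
  show "uniqueness_poly_rational P"
    unfolding uniqueness_poly_rational_def
  proof (intro allI impI)
    fix f g assume "nonconstant_rational f" "nonconstant_rational g" "rat_eval P f = rat_eval P g"
    then show "f = g"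
      using s[unfolded strong_uniqueness_poly_rational_def, rule_format, of f g 1] by simp
  qed
qed

lemma nonconstant_fraction:
  assumes "q \<noteq> 0" "\<And>k. p \<noteq> smult k q"
  shows "nonconstant_rational (rat_const c + to_fract p / to_fract q)"
  unfolding nonconstant_rational_def
proof
  assume "rat_const c + to_fract p / to_fract q \<in> range rat_const"
  then obtain k where "rat_const c + to_fract p / to_fract q = rat_const k" by auto
  then have "to_fract p / to_fract q = rat_const k - rat_const c" by (simp add: algebra_simps)
  also have "\<dots> = rat_const (k - c)"
    using rat_const_add[of k "- c"] by (simp add: rat_const_uminus)
  finally have "to_fract p = to_fract [:k - c:] * to_fract q"
    using assms(1) by (simp add: rat_const_def divide_eq_eq)
  then have "p = [:k - c:] * q" by (simp only: to_fract_eq_iff flip: to_fract_mult)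
  then have "p = smult (k - c) q" by simp
  then show False using assms(2) by blast
qed

section \<open>Necessity of the conditions by explicit pairs\<close>

locale shifted_trinomial =
  fixes P :: "complex poly" and \<alpha> a b :: complex and n m :: nat
  assumes m1: "1 \<le> m" and mn: "m \<le> n - 1"
    and P: "P = [:- \<alpha>, 1:] ^ n + smult a ([:- \<alpha>, 1:] ^ m) + [:b:]"
begin

lemma poly_P: "poly P x = (x - \<alpha>) ^ n + a * (x - \<alpha>) ^ m + b"
  by (simp add: P poly_power)

lemma rat_eval_P: "rat_eval P (rat_const \<alpha> + f) = f ^ n + rat_const a * f ^ m + rat_const b"
  by (simp add: P rat_eval_add rat_eval_smult rat_eval_power rat_const_uminus)

lemma uniqueness_contradiction:
  assumes "uniqueness_poly_rational P"
    and "nonconstant_rational (rat_const \<alpha> + f)" "nonconstant_rational (rat_const \<alpha> + g)"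
    and "f ^ n + rat_const a * f ^ m = g ^ n + rat_const a * g ^ m"
  shows "f = g"
proof -
  have "rat_const \<alpha> + f = rat_const \<alpha> + g"
    using assms(1)[unfolded uniqueness_poly_rational_def, rule_format, OF assms(2,3)] assms(4)
    by (simp add: rat_eval_P)
  then show ?thesis by simp
qed

definition X :: "complex poly fract" where "X = to_fract [:0, 1:]"

lemma linear_nonconstant: "c \<noteq> 0 \<Longrightarrow> nonconstant_rational (rat_const \<alpha> + rat_const c * X)"
  using nonconstant_fraction[of 1 "[:0, c:]" \<alpha>]
  by (simp add: X_def rat_const_def flip: to_fract_mult)

lemma linear_eq_iff: "rat_const c * X = X \<longleftrightarrow> c = 1"
  by (simp add: X_def rat_const_def flip: to_fract_mult)

lemma root_of_unity_exists:
  assumes "d \<ge> 2" obtains \<zeta> :: complex where "\<zeta> ^ d = 1" "\<zeta> \<noteq> 1"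
proof -
  have "degree (geom_poly d) > 0" using degree_geom_poly[of d] assms by simp
  then obtain \<zeta> where "poly (geom_poly d) \<zeta> = 0"
    using alg_closed_imp_poly_has_root by blast
  then show thesis using geom_poly_root[of d \<zeta>] assms that by auto
qed

text \<open>Scaling by \<open>\<zeta>\<close> leaves \<open>X ^ n + a * X ^ m\<close> unchanged, so
  the pair \<open>\<zeta> * X\<close>, \<open>X\<close> violates uniqueness unless
  \<open>\<zeta> = 1\<close>. One statement serves both \<open>a = 0\<close> and a common divisor of
  \<open>n\<close> and \<open>m\<close>.\<close>

lemma unique_imp_no_common_root:
  fixes \<zeta> :: complex
  assumes "uniqueness_poly_rational P" "\<zeta> ^ n = 1" "a = 0 \<or> \<zeta> ^ m = 1"
  shows "\<zeta> = 1"
proof -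
  have "\<zeta> \<noteq> 0" using assms(2) m1 mn by (auto simp: power_0_left split: if_splits)
  have "rat_const \<zeta> * X = X"
  proof (rule uniqueness_contradiction[OF assms(1) linear_nonconstant[OF \<open>\<zeta> \<noteq> 0\<close>]])
    show "nonconstant_rational (rat_const \<alpha> + X)" using linear_nonconstant[of 1] by simp
    show "(rat_const \<zeta> * X) ^ n + rat_const a * (rat_const \<zeta> * X) ^ m = X ^ n + rat_const a * X ^ m"
      using assms(2,3) by (auto simp: power_mult_distrib simp flip: rat_const_power)
  qed
  then show ?thesis by (simp only: linear_eq_iff)
qed

text \<open>For \<open>n = m + 1\<close>, prescribing the quotient of the two functions makes the
  equation linear: a nonzero \<open>f\<close> and \<open>X * f\<close> have the same value exactly
  when \<open>f * (1 - X ^ n) = a * (X ^ m - 1)\<close>. The solution is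
  \<open>N / D\<close>.\<close>

lemma unique_imp_gap:
  assumes u: "uniqueness_poly_rational P" and a: "a \<noteq> 0"
  shows "n - m \<ge> 2"
proof (rule ccontr)
  assume "\<not> n - m \<ge> 2"
  then have n: "n = Suc m" using m1 mn by simp
  define N D where "N = smult a (monom 1 m - 1)" and "D = 1 - monom (1::complex) n"
  have mm: "m \<noteq> 0" "n \<noteq> 0" "m \<noteq> n" using m1 n by auto
  have cN: "coeff N 0 = - a" "coeff N n = 0" "coeff N m = a" using mm by (simp_all add: N_def)
  have cD: "coeff D 0 = 1" "coeff D n = - 1" "coeff D m = 0" using mm by (simp_all add: D_def)
  have D0: "D \<noteq> 0" using cD by auto
  have nc1: "N \<noteq> smult k D" for k
  proof
    assume "N = smult k D"
    then have "coeff N m = k * coeff D m" by simp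
    then show False using cN cD a by simp
  qed
  have nc2: "[:0, 1:] * N \<noteq> smult k D" for k
  proof
    assume e: "[:0, 1:] * N = smult k D"
    have "coeff ([:0, 1:] * N) 0 = coeff (smult k D) 0" by (simp only: e)
    then have "k = 0" using cD by simp
    then have "[:0, 1:] * N = 0" using e by simp
    then show False using cN a by auto
  qed
  have key: "N + smult a D = [:0, 1:] ^ m * ([:0, 1:] * N + smult a D)"
  proof (rule poly_ext)
    fix x show "poly (N + smult a D) x = poly ([:0, 1:] ^ m * ([:0, 1:] * N + smult a D)) x"
      by (simp add: N_def D_def poly_monom poly_power n algebra_simps)
  qed
  define f where "f = to_fract N / to_fract D"
  have Xf: "X * f = to_fract ([:0, 1:] * N) / to_fract D"
    by (simp only: X_def f_def to_fract_mult times_divide_eq_right)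
  have "X * f = f"
  proof (rule uniqueness_contradiction[OF u])
    show "nonconstant_rational (rat_const \<alpha> + X * f)" unfolding Xf by (rule nonconstant_fraction[OF D0 nc2])
    show "nonconstant_rational (rat_const \<alpha> + f)" unfolding f_def by (rule nonconstant_fraction[OF D0 nc1])
    have ra: "to_fract (smult a D) = rat_const a * to_fract D" by (simp add: rat_const_def flip: to_fract_mult)
    have "to_fract (N + smult a D) = X ^ m * to_fract ([:0, 1:] * N + smult a D)"
      unfolding X_def by (subst key) (simp only: to_fract_mult to_fract_power)
    then have "to_fract N + rat_const a * to_fract D = X ^ m * (X * to_fract N + rat_const a * to_fract D)"
      by (simp only: to_fract_add to_fract_mult ra X_def)
    then have "f + rat_const a = X ^ m * (X * f + rat_const a)"
      using D0 by (simp add: f_def field_simps)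
    then have "f ^ m * (f + rat_const a) = f ^ m * (X ^ m * (X * f + rat_const a))" by simp
    then show "(X * f) ^ n + rat_const a * (X * f) ^ m = f ^ n + rat_const a * f ^ m"
      by (simp add: n power_mult_distrib algebra_simps)
  qed
  moreover have "f \<noteq> 0" using nc1[of 0] D0 by (simp add: f_def)
  ultimately have "X = 1" by simp
  then show False by (simp add: X_def one_pCons flip: to_fract_1)
qed

text \<open>After division by \<open>f - g\<close> the equation is the conic
  \<open>f^2 + f * g + g^2 + a = 0\<close>, and conics have rational parametrisations.\<close>

lemma unique_imp_not_cubic:
  assumes u: "uniqueness_poly_rational P" and a: "a \<noteq> 0" and n: "n = 3" "m = 1"
  shows False
proof -
  obtain \<omega> :: complex where \<omega>: "\<omega> ^ 3 = 1" "\<omega> \<noteq> 1" using root_of_unity_exists[of 3] by auto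
  have "(\<omega> - 1) * (\<omega>^2 + \<omega> + 1) = 0" using \<omega>(1) by algebra
  then have \<omega>2: "\<omega>^2 + \<omega> + 1 = 0" using \<omega>(2) by simp
  have \<omega>0: "\<omega> \<noteq> 0" using \<omega>(1) by auto
  have d0: "\<omega>^2 - \<omega> \<noteq> 0" using \<omega>0 \<omega>(2) by (simp add: power2_eq_square)
  \<comment> \<open>The quadratic part of the conic is
    \<open>(f - \<omega> * g) * (f - \<omega>^2 * g)\<close>. Setting the factors equal to
    \<open>x\<close> and \<open>- a / x\<close> and solving the linear system gives
    \<open>f = N1 / D\<close> and \<open>g = N2 / D\<close>.\<close>
  define N1 N2 D where "N1 = [:\<omega> * a, 0, \<omega>^2:]" and "N2 = [:a, 0, 1:]" and "D = [:0, \<omega>^2 - \<omega>:]"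
  have D0: "D \<noteq> 0" using d0 by (simp add: D_def)
  have key: "N1^2 + N1 * N2 + N2^2 + smult a (D^2) = 0"
  proof (rule poly_ext)
    fix x
    have "(\<omega> * a + \<omega>^2 * x^2)^2 + (\<omega> * a + \<omega>^2 * x^2) * (a + x^2) + (a + x^2)^2 + a * ((\<omega>^2 - \<omega>) * x)^2 = 0"
      using \<omega>2 by algebra
    then show "poly (N1^2 + N1 * N2 + N2^2 + smult a (D^2)) x = poly 0 x"
      by (simp add: N1_def N2_def D_def poly_power power2_eq_square algebra_simps)
  qed
  define f g where "f = to_fract N1 / to_fract D" and "g = to_fract N2 / to_fract D"
  have "f = g"
  proof (rule uniqueness_contradiction[OF u])
    show "nonconstant_rational (rat_const \<alpha> + f)" unfolding f_def
      by (rule nonconstant_fraction[OF D0]) (auto simp: N1_def D_def \<omega>0)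
    show "nonconstant_rational (rat_const \<alpha> + g)" unfolding g_def
      by (rule nonconstant_fraction[OF D0]) (auto simp: N2_def D_def)
    have "to_fract (N1^2 + N1 * N2 + N2^2 + [:a:] * D^2) = 0" using key by simp
    then have "to_fract N1^2 + to_fract N1 * to_fract N2 + to_fract N2^2 + rat_const a * to_fract D^2 = 0"
      by (simp add: power2_eq_square rat_const_def del: mult_pCons_left)
    then have "f^2 + f * g + g^2 + rat_const a = 0"
      using D0 by (simp add: f_def g_def field_simps power2_eq_square)
    then have "(f - g) * (f^2 + f * g + g^2 + rat_const a) = 0" by simp
    then show "f ^ n + rat_const a * f ^ m = g ^ n + rat_const a * g ^ m"
      unfolding n by (simp add: algebra_simps power2_eq_square power3_eq_cube)
  qed
  then have "to_fract N1 = to_fract N2" using D0 by (simp add: f_def g_def)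
  then have "\<omega> * a = a" by (simp add: N1_def N2_def)
  then show False using \<omega>(2) a by simp
qed

lemma uniqueness_rational_necessary:
  assumes u: "uniqueness_poly_rational P"
  shows "n \<ge> 4 \<and> n - m \<ge> 2 \<and> gcd n m = 1 \<and> a \<noteq> 0"
proof -
  have n2: "n \<ge> 2" using m1 mn by simp
  have a: "a \<noteq> 0"
  proof
    assume "a = 0"
    obtain \<zeta> :: complex where "\<zeta> ^ n = 1" "\<zeta> \<noteq> 1" using root_of_unity_exists[OF n2] by blast
    then show False using unique_imp_no_common_root[OF u] \<open>a = 0\<close> by blast
  qed
  have gcd: "gcd n m = 1"
  proof (rule ccontr)
    assume "gcd n m \<noteq> 1"
    moreover have "gcd n m \<noteq> 0" using n2 by simp
    ultimately have "gcd n m \<ge> 2" by linarith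
    then obtain \<zeta> :: complex where \<zeta>: "\<zeta> ^ gcd n m = 1" "\<zeta> \<noteq> 1" using root_of_unity_exists by blast
    have pw: "\<zeta> ^ j = 1" if "gcd n m dvd j" for j
      using that \<zeta>(1) by (auto simp: power_mult elim!: dvdE)
    have "\<zeta> ^ n = 1" "\<zeta> ^ m = 1" by (intro pw gcd_dvd1, intro pw gcd_dvd2)
    then show False using unique_imp_no_common_root[OF u] \<zeta>(2) by blast
  qed
  have gap: "n - m \<ge> 2" by (rule unique_imp_gap[OF u a])
  have "n \<ge> 4"
  proof (rule ccontr)
    assume "\<not> n \<ge> 4"
    then have "n = 3" "m = 1" using gap m1 by linarith+
    then show False using unique_imp_not_cubic[OF u a] by blast
  qed
  then show ?thesis using gap gcd a by blast
qed

text \<open>If \<open>b = 0\<close> and \<open>\<zeta> ^ (n - m) = 1\<close>, scaling by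
  \<open>\<zeta>\<close> multiplies the centred polynomial by \<open>\<zeta> ^ m\<close>; a gap of
  at least 2 supplies such a \<open>\<zeta>\<close> other than 1.\<close>

lemma strong_uniqueness_rational_necessary:
  assumes s: "strong_uniqueness_poly_rational P" and gap: "n - m \<ge> 2"
  shows "b \<noteq> 0"
proof
  assume b: "b = 0"
  obtain \<zeta> :: complex where \<zeta>: "\<zeta> ^ (n - m) = 1" "\<zeta> \<noteq> 1" using root_of_unity_exists[OF gap] by blast
  have \<zeta>0: "\<zeta> \<noteq> 0" using \<zeta>(1) gap by (auto simp: power_0_left split: if_splits)
  have "\<zeta> ^ n = \<zeta> ^ (m + (n - m))" using m1 mn by simp
  then have \<zeta>n: "\<zeta> ^ n = \<zeta> ^ m" by (simp only: power_add \<zeta>(1)) simp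
  have "rat_eval P (rat_const \<alpha> + rat_const \<zeta> * X) = rat_const (\<zeta> ^ m) * rat_eval P (rat_const \<alpha> + X)"
    unfolding rat_eval_P by (simp add: b power_mult_distrib algebra_simps \<zeta>n flip: rat_const_power)
  moreover have "nonconstant_rational (rat_const \<alpha> + rat_const \<zeta> * X)" "nonconstant_rational (rat_const \<alpha> + X)"
    using linear_nonconstant[OF \<zeta>0] linear_nonconstant[of 1] by auto
  moreover have "\<zeta> ^ m \<noteq> 0" using \<zeta>0 by simp
  ultimately have "rat_const \<alpha> + rat_const \<zeta> * X = rat_const \<alpha> + X"
    using s unfolding strong_uniqueness_poly_rational_def by blast
  then have "\<zeta> = 1" by (simp only: add_left_cancel linear_eq_iff)
  then show False using \<zeta>(2) by blast
qed

lemma uniqueness_meromorphic_not_quartic: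
  assumes u: "uniqueness_poly_meromorphic P" and a: "a \<noteq> 0" and n: "n = 4" "m = 1"
  shows False
proof -
  obtain f g where f: "f meromorphic_on UNIV" "\<not> (\<exists>k. \<forall>\<^sub>\<approx>z. f z = k)"
    and g: "g meromorphic_on UNIV" "\<not> (\<exists>k. \<forall>\<^sub>\<approx>z. g z = k)"
    and rel: "\<forall>\<^sub>\<approx>z. f z ^ 4 + a * f z = g z ^ 4 + a * g z" and ne: "\<not> (\<forall>\<^sub>\<approx>z. f z = g z)"
    by (rule quartic_counterexample[OF a])
  have nc: "nonconstant_meromorphic (\<lambda>z. h z + \<alpha>)" if h: "h meromorphic_on UNIV" "\<not> (\<exists>k. \<forall>\<^sub>\<approx>z. h z = k)" for h
    unfolding nonconstant_meromorphic_def
  proof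
    show "(\<lambda>z. h z + \<alpha>) meromorphic_on UNIV" by (intro meromorphic_intros h)
    show "\<not> (\<exists>k. \<forall>\<^sub>\<approx>z. h z + \<alpha> = k)"
    proof
      assume "\<exists>k. \<forall>\<^sub>\<approx>z. h z + \<alpha> = k"
      then obtain k where "\<forall>\<^sub>\<approx>z. h z + \<alpha> = k" by blast
      then have "\<forall>\<^sub>\<approx>z. h z = k - \<alpha>" by eventually_elim (simp add: algebra_simps)
      then show False using h(2) by blast
    qed
  qed
  have "\<forall>\<^sub>\<approx>z. poly P (f z + \<alpha>) = poly P (g z + \<alpha>)" using rel by eventually_elim (simp add: poly_P n)
  then have "\<forall>\<^sub>\<approx>z. f z + \<alpha> = g z + \<alpha>"
    using u[unfolded uniqueness_poly_meromorphic_def, rule_format, OF nc[OF f] nc[OF g]] by blast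
  then show False using ne by simp
qed

section \<open>Sufficiency of the conditions\<close>

lemma sufficient:
  assumes n: "n \<ge> 5 \<or> n = 4 \<and> (\<lambda>z. f (inverse z)) meromorphic_on UNIV \<and> (\<lambda>z. g (inverse z)) meromorphic_on UNIV"
    and gap: "n - m \<ge> 2" and gcd: "gcd n m = 1" and a: "a \<noteq> 0"
    and f: "f meromorphic_on UNIV" "\<not> (\<exists>k. \<forall>\<^sub>\<approx>z. f z = k)"
    and g: "g meromorphic_on UNIV" "\<not> (\<exists>k. \<forall>\<^sub>\<approx>z. g z = k)"
    and rel: "\<forall>\<^sub>\<approx>z. poly P (f z) = c * poly P (g z)" and c: "c = 1 \<or> c \<noteq> 0 \<and> b \<noteq> 0"
  shows "c = 1 \<and> (\<forall>\<^sub>\<approx>z. f z = g z)"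
proof -
  have nm: "n = m + (n - m)" using gap by simp
  have "gcd (n - m) m = gcd n m" using gap by (intro gcd_diff1_nat) simp
  then have "coprime (n - m) m" using gcd by (simp add: coprime_iff_gcd_eq_1)
  then interpret t: trinomial a b n m "n - m"
    by unfold_locales (use a m1 gap in auto)
  have tP: "poly P x = poly t.T (x - \<alpha>)" for x by (simp add: poly_P t.poly_T)
  define f' g' where "f' = (\<lambda>z. f z - \<alpha>)" and "g' = (\<lambda>z. g z - \<alpha>)"
  have nc: "\<not> (\<exists>k. \<forall>\<^sub>\<approx>z. h z - \<alpha> = k)" if "\<not> (\<exists>k. \<forall>\<^sub>\<approx>z. h z = k)" for h
  proof
    assume "\<exists>k. \<forall>\<^sub>\<approx>z. h z - \<alpha> = k"
    then obtain k where "\<forall>\<^sub>\<approx>z. h z - \<alpha> = k" by blast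
    then have "\<forall>\<^sub>\<approx>z. h z = k + \<alpha>" by eventually_elim (simp add: algebra_simps)
    then show False using that by blast
  qed
  have f': "f' meromorphic_on UNIV" "\<not> (\<exists>k. \<forall>\<^sub>\<approx>z. f' z = k)" and g': "g' meromorphic_on UNIV" "\<not> (\<exists>k. \<forall>\<^sub>\<approx>z. g' z = k)"
    unfolding f'_def g'_def using nc f g by (auto intro!: meromorphic_intros)
  have n': "n \<ge> 5 \<or> n = 4 \<and> (\<lambda>z. f' (inverse z)) meromorphic_on UNIV \<and> (\<lambda>z. g' (inverse z)) meromorphic_on UNIV"
    using n unfolding f'_def g'_def by (auto intro!: meromorphic_intros)
  have rel': "\<forall>\<^sub>\<approx>z. poly t.T (f' z) = c * poly t.T (g' z)"
    using rel by eventually_elim (simp add: tP f'_def g'_def)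
  have c1: "c = 1" using c t.strong_unique[OF n' f' g' rel'] by blast
  then have "\<forall>\<^sub>\<approx>z. f' z = g' z" using t.unique[OF n' f' g'] rel' by simp
  then show ?thesis using c1 by (simp add: f'_def g'_def)
qed

lemma sufficient_meromorphic:
  assumes "n \<ge> 5" "n - m \<ge> 2" "gcd n m = 1" "a \<noteq> 0"
  shows "uniqueness_poly_meromorphic P" "b \<noteq> 0 \<Longrightarrow> strong_uniqueness_poly_meromorphic P"
proof -
  show "uniqueness_poly_meromorphic P"
    unfolding uniqueness_poly_meromorphic_def nonconstant_meromorphic_def
  proof (intro allI impI)
    fix f g assume "f meromorphic_on UNIV \<and> \<not> (\<exists>k. \<forall>\<^sub>\<approx>z. f z = k)" "g meromorphic_on UNIV \<and> \<not> (\<exists>k. \<forall>\<^sub>\<approx>z. g z = k)"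
      "\<forall>\<^sub>\<approx>z. poly P (f z) = poly P (g z)"
    then show "\<forall>\<^sub>\<approx>z. f z = g z" using sufficient[of f g 1] assms by simp
  qed
  assume b: "b \<noteq> 0"
  show "strong_uniqueness_poly_meromorphic P"
    unfolding strong_uniqueness_poly_meromorphic_def nonconstant_meromorphic_def
  proof (intro allI impI)
    fix f g c assume "f meromorphic_on UNIV \<and> \<not> (\<exists>k. \<forall>\<^sub>\<approx>z. f z = k)" "g meromorphic_on UNIV \<and> \<not> (\<exists>k. \<forall>\<^sub>\<approx>z. g z = k)"
      "c \<noteq> 0" "\<forall>\<^sub>\<approx>z. poly P (f z) = c * poly P (g z)"
    then show "c = 1 \<and> (\<forall>\<^sub>\<approx>z. f z = g z)" using sufficient[of f g c] assms b by simp
  qed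
qed

lemma sufficient_rational:
  assumes n: "n \<ge> 4" and c: "n - m \<ge> 2" "gcd n m = 1" "a \<noteq> 0"
  shows "uniqueness_poly_rational P" "b \<noteq> 0 \<Longrightarrow> strong_uniqueness_poly_rational P"
proof -
  have key: "c = 1 \<and> f = g" if "nonconstant_rational f" "nonconstant_rational g"
     "rat_eval P f = rat_const c * rat_eval P g" "c = 1 \<or> c \<noteq> 0 \<and> b \<noteq> 0" for f g c
  proof -
    have "n \<ge> 5 \<or> n = 4 \<and> (\<lambda>z. rat_fun f (inverse z)) meromorphic_on UNIV \<and> (\<lambda>z. rat_fun g (inverse z)) meromorphic_on UNIV"
      using n rat_fun_meromorphic(2) by auto
    then have "c = 1 \<and> (\<forall>\<^sub>\<approx>z. rat_fun f z = rat_fun g z)"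
      by (rule sufficient[OF _ assms(2-4) rat_fun_meromorphic(1) rat_fun_nonconstant[OF that(1)]
            rat_fun_meromorphic(1) rat_fun_nonconstant[OF that(2)] rat_fun_equation[OF that(3)] that(4)])
    then show ?thesis using rat_fun_eq_imp_eq by blast
  qed
  show "uniqueness_poly_rational P"
    unfolding uniqueness_poly_rational_def using key[of _ _ 1] by simp
  assume "b \<noteq> 0"
  then show "strong_uniqueness_poly_rational P"
    unfolding strong_uniqueness_poly_rational_def using key by blast
qed

end

theorem corollary1:
  fixes P :: "complex poly" and \<alpha> a b :: complex and n m :: nat
  assumes "1 \<le> m" and "m \<le> n - 1"
    and "P = [:- \<alpha>, 1:] ^ n + smult a ([:- \<alpha>, 1:] ^ m) + [:b:]"
  shows "(uniqueness_poly_rational P \<longleftrightarrow>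
            n \<ge> 4 \<and> n - m \<ge> 2 \<and> gcd n m = 1 \<and> a \<noteq> 0) \<and>
         (strong_uniqueness_poly_rational P \<longleftrightarrow>
            n \<ge> 4 \<and> n - m \<ge> 2 \<and> gcd n m = 1 \<and> a \<noteq> 0 \<and> b \<noteq> 0) \<and>
         (uniqueness_poly_meromorphic P \<longleftrightarrow>
            n \<ge> 5 \<and> n - m \<ge> 2 \<and> gcd n m = 1 \<and> a \<noteq> 0) \<and>
         (strong_uniqueness_poly_meromorphic P \<longleftrightarrow>
            n \<ge> 5 \<and> n - m \<ge> 2 \<and> gcd n m = 1 \<and> a \<noteq> 0 \<and> b \<noteq> 0)"
proof -
  interpret shifted_trinomial P \<alpha> a b n m by unfold_locales (fact assms)+
  have ur: "n \<ge> 4 \<and> n - m \<ge> 2 \<and> gcd n m = 1 \<and> a \<noteq> 0" if "uniqueness_poly_rational P"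
    using that by (rule uniqueness_rational_necessary)
  have um: "n \<ge> 5 \<and> n - m \<ge> 2 \<and> gcd n m = 1 \<and> a \<noteq> 0" if u: "uniqueness_poly_meromorphic P"
  proof -
    have c: "n \<ge> 4 \<and> n - m \<ge> 2 \<and> gcd n m = 1 \<and> a \<noteq> 0"
      using ur uniqueness_meromorphic_imp_rational[OF u] by blast
    \<comment> \<open>For \<open>n = 4\<close> the gap and coprimality leave \<open>m = 1\<close>,
      where the elliptic curve provides a pair.\<close>
    have "n \<noteq> 4"
    proof
      assume n4: "n = 4"
      then have "m = 1 \<or> m = 2" using c assms(1) by linarith
      moreover have "m \<noteq> 2"
      proof
        assume "m = 2"
        then have "gcd (4::nat) 2 = 1" using c n4 by simp
        moreover have "gcd (4::nat) 2 = 2" by (rule gcd_nat.absorb2) simp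
        ultimately show False by simp
      qed
      ultimately show False using uniqueness_meromorphic_not_quartic[OF u _ n4] c by blast
    qed
    then show ?thesis using c by simp
  qed
  have sr: "b \<noteq> 0" if "strong_uniqueness_poly_rational P"
    using strong_uniqueness_rational_necessary[OF that] ur strong_uniqueness_imp_uniqueness(2)[OF that] by blast
  show ?thesis
  proof (intro conjI)
    show "uniqueness_poly_rational P \<longleftrightarrow> n \<ge> 4 \<and> n - m \<ge> 2 \<and> gcd n m = 1 \<and> a \<noteq> 0"
      by (rule iffI, erule ur) (elim conjE, rule sufficient_rational(1))
    show "uniqueness_poly_meromorphic P \<longleftrightarrow> n \<ge> 5 \<and> n - m \<ge> 2 \<and> gcd n m = 1 \<and> a \<noteq> 0"
      by (rule iffI, erule um) (elim conjE, rule sufficient_meromorphic(1))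
    show "strong_uniqueness_poly_rational P \<longleftrightarrow> n \<ge> 4 \<and> n - m \<ge> 2 \<and> gcd n m = 1 \<and> a \<noteq> 0 \<and> b \<noteq> 0"
    proof
      assume s: "strong_uniqueness_poly_rational P"
      show "n \<ge> 4 \<and> n - m \<ge> 2 \<and> gcd n m = 1 \<and> a \<noteq> 0 \<and> b \<noteq> 0"
        using ur[OF strong_uniqueness_imp_uniqueness(2)[OF s]] sr[OF s] by (elim conjE) (intro conjI)
    qed (elim conjE, rule sufficient_rational(2))
    show "strong_uniqueness_poly_meromorphic P \<longleftrightarrow> n \<ge> 5 \<and> n - m \<ge> 2 \<and> gcd n m = 1 \<and> a \<noteq> 0 \<and> b \<noteq> 0"
    proof
      assume s: "strong_uniqueness_poly_meromorphic P"
      show "n \<ge> 5 \<and> n - m \<ge> 2 \<and> gcd n m = 1 \<and> a \<noteq> 0 \<and> b \<noteq> 0"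
        using um[OF strong_uniqueness_imp_uniqueness(1)[OF s]] sr[OF strong_uniqueness_meromorphic_imp_rational[OF s]]
        by (elim conjE) (intro conjI)
    qed (elim conjE, rule sufficient_meromorphic(2))
  qed
qed

end
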